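(* Let $1\neq\tau\in\mathbb{F}_q^\ast$, let $c\in\mathbb{F}_q^\ast$ be a non-square and let $\mathbb{F}_q[Z]/\mathbb{F}_q$ be the quadratic field extension with $Z^2=c$. The group $\Gamma_\tau$ is a torsion free arithmetic lattice in $G(K)$ with finite presentation $$\Gamma_\tau=\left\langle\begin{array}{c} a_\xi,\ b_\eta \text{ for } \xi,\eta\in\mathbb{F}_q[Z] \text{ with}\\ N(\xi)=-c \text{ and } N(\eta)=\frac{c\tau}{1-\tau}\end{array}\ \left|\ \begin{array}{c} a_\xi a_{-\xi}=1,\ b_\eta b_{-\eta}=1\\ \text{and } a_\xi b_\eta=b_\lambda a_\mu \text{ if in } \mathbb{F}_q[Z]:\\ \eta=\lambda^q(\lambda-\xi)^{1-q} \text{ and } \mu=\xi^q(\xi-\lambda)^{1-q}\end{array}\right.\right\rangle$$ which acts simply transitively via the Bruhat–Tits action on the vertices of $T_{q+1}\times T_{q+1}$.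
   Context: $q$ is a power of an odd prime $p$; $K=\mathbb{F}_q(t)$; $D=K\{Z,F\}/(Z^2=c,\ F^2=t(t-1),\ ZF=-FZ)$ is a quaternion algebra over $K$; $G=\mathrm{PGL}_{1,D}$, so $G(K)=D^\ast/K^\ast$. The subring $\mathbb{F}_q[Z]\subset D$ is a field with $q^2$ elements, with norm $N(w)=w^{q+1}$. For $\xi\in\mathbb{F}_q[Z]$ put $\gamma_\xi=tZ+\xi F\in D$. For $N(\xi)=-c$ let $a_\xi$ be the image of $\gamma_\xi Z$ in $G(K)$; for $N(\eta)=\frac{c\tau}{1-\tau}$ let $b_\eta$ be the image of $\gamma_\eta Z$ in $G(K)$. $\Gamma_\tau\subset G(K)$ is the subgroup generated by all these $a_\xi,b_\eta$. In the presentation, $\xi,\mu$ range over elements of norm $-c$ and $\eta,\lambda$ over elements of norm $\frac{c\tau}{1-\tau}$. Bruhat–Tits action: $D$ splits at the places $t=\tau$ and $t=\infty$, so that, with $K_\tau,K_\infty$ the completions of $K$, $G(K_\tau)\simeq\mathrm{PGL}_2(K_\tau)$ and $G(K_\infty)\simeq\mathrm{PGL}_2(K_\infty)$ act on their Bruhat–Tits trees $T_\tau$, $T_\infty$, both isomorphic to the tree $T_{q+1}$ of constant valency $q+1$. The diagonal embedding gives the action of $\Gamma_\tau$ on $T_\tau\times T_\infty\simeq T_{q+1}\times T_{q+1}$. "Arithmetic lattice" means a subgroup of finite index (up to commensurability) in $G(R)=\mathfrak{O}^\ast/R^\ast$, where $R=\mathbb{F}_q[t,\frac{1}{t(t-1)(t-\tau)}]$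 and $\mathfrak{O}=R\oplus RZ\oplus RF\oplus RZF$; it is a discrete cocompact subgroup of $G(K_\tau)\times G(K_\infty)$. *)

theory Defs
  imports
    "HOL-Analysis.Cartesian_Space"
    "HOL-Computational_Algebra.Formal_Laurent_Series"
    "HOL-Computational_Algebra.Polynomial_FPS"
    "HOL-Computational_Algebra.Fraction_Field"
    "HOL-Algebra.Ring"
    "HOL-Algebra.Generated_Groups"
    "HOL-Algebra.Group_Action"
begin

section \<open>Groups\<close>

definition torsion_free :: "('g, 'm) monoid_scheme \<Rightarrow> bool" where
  "torsion_free G \<longleftrightarrow>
     (\<forall>x\<in>carrier G. \<forall>n::nat. n > 0 \<and> x [^]\<^bsub>G\<^esub> n = \<one>\<^bsub>G\<^esub> \<longrightarrow> x = \<one>\<^bsub>G\<^esub>)"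

definition commensurable :: "('g, 'm) monoid_scheme \<Rightarrow> 'g set \<Rightarrow> 'g set \<Rightarrow> bool" where
  "commensurable G H H' \<longleftrightarrow>
     finite (rcosets\<^bsub>G\<lparr>carrier := H\<rparr>\<^esub> (H \<inter> H')) \<and> finite (rcosets\<^bsub>G\<lparr>carrier := H'\<rparr>\<^esub> (H \<inter> H'))"

definition simply_transitive_action ::
    "('g, 'm) monoid_scheme \<Rightarrow> 'v set \<Rightarrow> ('g \<Rightarrow> 'v \<Rightarrow> 'v) \<Rightarrow> bool" where
  "simply_transitive_action G E \<phi> \<longleftrightarrow>
     group_action G E \<phi> \<and> (\<forall>x\<in>E. \<forall>y\<in>E. \<exists>!g. g \<in> carrier G \<and> \<phi> g x = y)"


subsection \<open>Groups given by generators and relations\<close>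

text \<open>
  The letter \<open>(s, True)\<close> stands for the generator \<open>s\<close> and \<open>(s, False)\<close> for its inverse.
  A relation \<open>(u, v)\<close> stands for the equation \<open>u = v\<close>.
\<close>

type_synonym 'g word = "('g \<times> bool) list"

inductive pres_eq :: "'g set \<Rightarrow> ('g word \<times> 'g word) set \<Rightarrow> 'g word \<Rightarrow> 'g word \<Rightarrow> bool"
  for S R where
  rel: "(u, v) \<in> R \<Longrightarrow> pres_eq S R u v"
| cancel: "s \<in> S \<Longrightarrow> pres_eq S R [(s, b), (s, \<not> b)] []"
| refl: "u \<in> lists (S \<times> UNIV) \<Longrightarrow> pres_eq S R u u"
| sym: "pres_eq S R u v \<Longrightarrow> pres_eq S R v u"
| trans: "pres_eq S R u v \<Longrightarrow> pres_eq S R v w \<Longrightarrow> pres_eq S R u w"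
| append: "pres_eq S R u v \<Longrightarrow> pres_eq S R u' v' \<Longrightarrow> pres_eq S R (u @ u') (v @ v')"

definition pres_class :: "'g set \<Rightarrow> ('g word \<times> 'g word) set \<Rightarrow> 'g word \<Rightarrow> 'g word set" where
  "pres_class S R u = {v. pres_eq S R u v}"

definition presented_group :: "'g set \<Rightarrow> ('g word \<times> 'g word) set \<Rightarrow> 'g word set monoid" where
  "presented_group S R =
     \<lparr>carrier = pres_class S R ` lists (S \<times> UNIV),
      mult = (\<lambda>A B. {w. \<exists>u\<in>A. \<exists>v\<in>B. pres_eq S R (u @ v) w}),
      one = pres_class S R []\<rparr>"

definition has_finite_presentation ::
    "('h, 'm) monoid_scheme \<Rightarrow> 'g set \<Rightarrow> ('g word \<times> 'g word) set \<Rightarrow> ('g \<Rightarrow> 'h) \<Rightarrow> bool" where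
  "has_finite_presentation G S R e \<longleftrightarrow>
     finite S \<and> finite R \<and> R \<subseteq> lists (S \<times> UNIV) \<times> lists (S \<times> UNIV) \<and>
     (\<exists>h \<in> iso (presented_group S R) G. \<forall>s\<in>S. h (pres_class S R [(s, True)]) = e s)"

lemma pres_eq_lists:
  assumes "R \<subseteq> lists (S \<times> UNIV) \<times> lists (S \<times> UNIV)" and "pres_eq S R u v"
  shows "u \<in> lists (S \<times> UNIV)" and "v \<in> lists (S \<times> UNIV)"
proof -
  from assms(2) have "u \<in> lists (S \<times> UNIV) \<and> v \<in> lists (S \<times> UNIV)"
    using assms(1) by induction auto
  then show "u \<in> lists (S \<times> UNIV)" and "v \<in> lists (S \<times> UNIV)"
    by auto
qed

lemma pres_class_eq:
  assumes "pres_eq S R u v"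
  shows "pres_class S R u = pres_class S R v"
  unfolding pres_class_def
proof (rule Collect_cong)
  show "pres_eq S R u w \<longleftrightarrow> pres_eq S R v w" for w
    using pres_eq.trans[OF assms, of w] pres_eq.trans[OF pres_eq.sym[OF assms], of w] by blast
qed

lemma presented_group_mult:
  assumes "u \<in> lists (S \<times> UNIV)" and "v \<in> lists (S \<times> UNIV)"
  shows "pres_class S R u \<otimes>\<^bsub>presented_group S R\<^esub> pres_class S R v = pres_class S R (u @ v)"
proof -
  have "(\<exists>u'. pres_eq S R u u' \<and> (\<exists>v'. pres_eq S R v v' \<and> pres_eq S R (u' @ v') w)) \<longleftrightarrow>
        pres_eq S R (u @ v) w" for w
  proof
    assume "\<exists>u'. pres_eq S R u u' \<and> (\<exists>v'. pres_eq S R v v' \<and> pres_eq S R (u' @ v') w)"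
    then obtain u' v' where "pres_eq S R u u'" "pres_eq S R v v'" and w: "pres_eq S R (u' @ v') w"
      by blast
    then show "pres_eq S R (u @ v) w"
      using pres_eq.trans[OF pres_eq.append w] by blast
  next
    assume "pres_eq S R (u @ v) w"
    then show "\<exists>u'. pres_eq S R u u' \<and> (\<exists>v'. pres_eq S R v v' \<and> pres_eq S R (u' @ v') w)"
      using pres_eq.refl[OF assms(1), of R] pres_eq.refl[OF assms(2), of R] by blast
  qed
  then show ?thesis
    by (simp add: presented_group_def pres_class_def)
qed

lemma group_presented_group: "group (presented_group S R)"
proof (rule groupI)
  have car: "carrier (presented_group S R) = pres_class S R ` lists (S \<times> UNIV)"
    and one: "\<one>\<^bsub>presented_group S R\<^esub> = pres_class S R []"
    by (simp_all add: presented_group_def)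
  show "\<one>\<^bsub>presented_group S R\<^esub> \<in> carrier (presented_group S R)"
    by (simp add: car one)
  fix x y z
  assume x: "x \<in> carrier (presented_group S R)"
  then obtain u where u: "u \<in> lists (S \<times> UNIV)" "x = pres_class S R u"
    using car by auto
  show "\<one>\<^bsub>presented_group S R\<^esub> \<otimes>\<^bsub>presented_group S R\<^esub> x = x"
    unfolding one u(2) using presented_group_mult[OF lists.Nil u(1)] by simp
  have inv: "pres_eq S R (rev (map (\<lambda>(s, b). (s, \<not> b)) u) @ u) []"
    if "u \<in> lists (S \<times> UNIV)" for u
    using that
  proof (induction u)
    case Nil
    then show ?case by (auto intro: pres_eq.refl)
  next
    case (Cons a u)
    obtain s b where a: "a = (s, b)" "s \<in> S"
      using Cons.hyps by (cases a) auto
    have "map (\<lambda>(s, b). (s, \<not> b)) u \<in> lists (S \<times> UNIV)"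
      using Cons.hyps by (auto simp: in_lists_conv_set)
    then have w: "pres_eq S R (rev (map (\<lambda>(s, b). (s, \<not> b)) u)) (rev (map (\<lambda>(s, b). (s, \<not> b)) u))"
      by (intro pres_eq.refl) (auto simp: in_lists_conv_set)
    have u: "pres_eq S R u u"
      using Cons.hyps by (intro pres_eq.refl)
    have "pres_eq S R [(s, \<not> b), (s, b)] []"
      using pres_eq.cancel[OF a(2), of R "\<not> b"] by simp
    from pres_eq.append[OF w pres_eq.append[OF this u]]
    have "pres_eq S R (rev (map (\<lambda>(s, b). (s, \<not> b)) (a # u)) @ a # u)
                      (rev (map (\<lambda>(s, b). (s, \<not> b)) u) @ u)"
      by (simp add: a)
    then show ?case
      using Cons.IH by (rule pres_eq.trans)
  qed
  show "\<exists>y\<in>carrier (presented_group S R). y \<otimes>\<^bsub>presented_group S R\<^esub> x = \<one>\<^bsub>presented_group S R\<^esub>"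
  proof -
    have v: "rev (map (\<lambda>(s, b). (s, \<not> b)) u) \<in> lists (S \<times> UNIV)"
      using u(1) by (auto simp: in_lists_conv_set)
    show ?thesis
      by (rule bexI[of _ "pres_class S R (rev (map (\<lambda>(s, b). (s, \<not> b)) u))"])
         (simp_all only: u car one presented_group_mult[OF v u(1)] pres_class_eq[OF inv[OF u(1)]]
           imageI[OF v])
  qed
  assume "y \<in> carrier (presented_group S R)"
  then obtain v where v: "v \<in> lists (S \<times> UNIV)" "y = pres_class S R v"
    using car by auto
  have uv: "u @ v \<in> lists (S \<times> UNIV)"
    using u(1) v(1) by simp
  show "x \<otimes>\<^bsub>presented_group S R\<^esub> y \<in> carrier (presented_group S R)"
    unfolding u(2) v(2) presented_group_mult[OF u(1) v(1)] car using uv by (rule imageI)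
  assume "z \<in> carrier (presented_group S R)"
  then obtain w where w: "w \<in> lists (S \<times> UNIV)" "z = pres_class S R w"
    using car by auto
  have vw: "v @ w \<in> lists (S \<times> UNIV)"
    using v(1) w(1) by simp
  show "x \<otimes>\<^bsub>presented_group S R\<^esub> y \<otimes>\<^bsub>presented_group S R\<^esub> z =
        x \<otimes>\<^bsub>presented_group S R\<^esub> (y \<otimes>\<^bsub>presented_group S R\<^esub> z)"
    unfolding u(2) v(2) w(2) presented_group_mult[OF u(1) v(1)] presented_group_mult[OF v(1) w(1)]
      presented_group_mult[OF uv w(1)] presented_group_mult[OF u(1) vw] by simp
qed


section \<open>Trees\<close>

text \<open>
  A \<open>d\<close>-regular tree: a simple graph of constant valency \<open>d > 0\<close> in which any two vertices are
  joined by exactly one path without repeated vertices.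
\<close>

definition simple_path :: "'v set \<Rightarrow> ('v \<Rightarrow> 'v \<Rightarrow> bool) \<Rightarrow> 'v \<Rightarrow> 'v \<Rightarrow> 'v list \<Rightarrow> bool" where
  "simple_path V E v w p \<longleftrightarrow>
     p \<noteq> [] \<and> hd p = v \<and> last p = w \<and> set p \<subseteq> V \<and> distinct p \<and> successively E p"

definition regular_tree :: "nat \<Rightarrow> 'v set \<Rightarrow> ('v \<Rightarrow> 'v \<Rightarrow> bool) \<Rightarrow> bool" where
  "regular_tree d V E \<longleftrightarrow>
     V \<noteq> {} \<and> (\<forall>v\<in>V. \<not> E v v) \<and> (\<forall>v\<in>V. \<forall>w\<in>V. E v w \<longrightarrow> E w v) \<and>
     (\<forall>v\<in>V. finite {w \<in> V. E v w} \<and> card {w \<in> V. E v w} = d) \<and>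
     (\<forall>v\<in>V. \<forall>w\<in>V. \<exists>!p. simple_path V E v w p)"


section \<open>Quaternion algebras\<close>

text \<open>
  The algebra generated over the field of scalars by \<open>Z\<close> and \<open>F\<close> subject to \<open>Z\<^sup>2 = a\<close>,
  \<open>F\<^sup>2 = b\<close> and \<open>ZF = -FZ\<close>, in coordinates with respect to its basis \<open>1, Z, F, ZF\<close>;
  see \<open>quat_alg_relations\<close> and the universal property \<open>quat_alg_universal\<close>.
\<close>

datatype 'k quat = Quat 'k 'k 'k 'k

fun quat_add :: "'k::field quat \<Rightarrow> 'k quat \<Rightarrow> 'k quat" where
  "quat_add (Quat x0 x1 x2 x3) (Quat y0 y1 y2 y3) = Quat (x0 + y0) (x1 + y1) (x2 + y2) (x3 + y3)"

fun quat_mult :: "'k::field \<Rightarrow> 'k \<Rightarrow> 'k quat \<Rightarrow> 'k quat \<Rightarrow> 'k quat" where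
  "quat_mult a b (Quat x0 x1 x2 x3) (Quat y0 y1 y2 y3) =
     Quat (x0 * y0 + a * x1 * y1 + b * x2 * y2 - a * b * x3 * y3)
          (x0 * y1 + x1 * y0 - b * x2 * y3 + b * x3 * y2)
          (x0 * y2 + x2 * y0 + a * x1 * y3 - a * x3 * y1)
          (x0 * y3 + x3 * y0 + x1 * y2 - x2 * y1)"

definition quat_scalar :: "'k::field \<Rightarrow> 'k quat" where
  "quat_scalar x = Quat x 0 0 0"

definition quat_Z :: "'k::field quat" where
  "quat_Z = Quat 0 1 0 0"

definition quat_F :: "'k::field quat" where
  "quat_F = Quat 0 0 1 0"

definition quat_alg :: "'k::field \<Rightarrow> 'k \<Rightarrow> 'k quat ring" where
  "quat_alg a b =
     \<lparr>carrier = UNIV, mult = quat_mult a b, one = quat_scalar 1,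
      zero = quat_scalar 0, add = quat_add\<rparr>"

lemma quat_alg_simps [simp]:
  "carrier (quat_alg a b) = UNIV"
  "x \<otimes>\<^bsub>quat_alg a b\<^esub> y = quat_mult a b x y"
  "x \<oplus>\<^bsub>quat_alg a b\<^esub> y = quat_add x y"
  "\<one>\<^bsub>quat_alg a b\<^esub> = quat_scalar 1"
  "\<zero>\<^bsub>quat_alg a b\<^esub> = quat_scalar 0"
  by (simp_all add: quat_alg_def)

lemma ring_quat_alg: "ring (quat_alg a b)"
proof (rule ringI)
  show "abelian_group (quat_alg a b)"
  proof (rule abelian_groupI, goal_cases)
    case (3 x y z)
    show ?case by (cases x; cases y; cases z) (simp add: add.assoc)
  next
    case (4 x y)
    show ?case by (cases x; cases y) (simp add: add.commute)
  next
    case (5 x)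
    show ?case by (cases x) (simp add: quat_scalar_def)
  next
    case (6 x)
    obtain x0 x1 x2 x3 where "x = Quat x0 x1 x2 x3" by (cases x)
    then show ?case
      by (intro bexI[of _ "Quat (- x0) (- x1) (- x2) (- x3)"]) (simp_all add: quat_scalar_def)
  qed simp_all
  show "Group.monoid (quat_alg a b)"
  proof (rule Group.monoidI, goal_cases)
    case (3 x y z)
    show ?case by (cases x; cases y; cases z) (simp add: algebra_simps)
  next
    case (4 x)
    show ?case by (cases x) (simp add: quat_scalar_def)
  next
    case (5 x)
    show ?case by (cases x) (simp add: quat_scalar_def)
  qed simp_all
next
  fix x y z :: "'a quat"
  show "(x \<oplus>\<^bsub>quat_alg a b\<^esub> y) \<otimes>\<^bsub>quat_alg a b\<^esub> z =
        x \<otimes>\<^bsub>quat_alg a b\<^esub> z \<oplus>\<^bsub>quat_alg a b\<^esub> y \<otimes>\<^bsub>quat_alg a b\<^esub> z"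
    by (cases x; cases y; cases z) (simp add: algebra_simps)
  show "z \<otimes>\<^bsub>quat_alg a b\<^esub> (x \<oplus>\<^bsub>quat_alg a b\<^esub> y) =
        z \<otimes>\<^bsub>quat_alg a b\<^esub> x \<oplus>\<^bsub>quat_alg a b\<^esub> z \<otimes>\<^bsub>quat_alg a b\<^esub> y"
    by (cases x; cases y; cases z) (simp add: algebra_simps)
qed

lemma quat_alg_relations:
  "quat_Z \<otimes>\<^bsub>quat_alg a b\<^esub> quat_Z = quat_scalar a"
  "quat_F \<otimes>\<^bsub>quat_alg a b\<^esub> quat_F = quat_scalar b"
  "quat_Z \<otimes>\<^bsub>quat_alg a b\<^esub> quat_F = \<ominus>\<^bsub>quat_alg a b\<^esub> (quat_F \<otimes>\<^bsub>quat_alg a b\<^esub> quat_Z)"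
proof -
  interpret ring "quat_alg a b" by (rule ring_quat_alg)
  show "quat_Z \<otimes>\<^bsub>quat_alg a b\<^esub> quat_Z = quat_scalar a"
    and "quat_F \<otimes>\<^bsub>quat_alg a b\<^esub> quat_F = quat_scalar b"
    by (simp_all add: quat_Z_def quat_F_def quat_scalar_def)
  show "quat_Z \<otimes>\<^bsub>quat_alg a b\<^esub> quat_F = \<ominus>\<^bsub>quat_alg a b\<^esub> (quat_F \<otimes>\<^bsub>quat_alg a b\<^esub> quat_Z)"
    by (rule minus_equality[symmetric]) (simp_all add: quat_Z_def quat_F_def quat_scalar_def)
qed

lemma quat_alg_universal:
  fixes \<sigma> :: "'k::field \<Rightarrow> 'r::ring_1" and z f :: 'r
  assumes \<sigma>: "\<sigma> 1 = 1" "\<And>x y. \<sigma> (x + y) = \<sigma> x + \<sigma> y" "\<And>x y. \<sigma> (x * y) = \<sigma> x * \<sigma> y"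
    and central: "\<And>x r. \<sigma> x * r = r * \<sigma> x"
    and z: "z * z = \<sigma> a" and f: "f * f = \<sigma> b" and zf: "z * f = - (f * z)"
  shows "\<exists>!h. (\<forall>x y. h (x \<oplus>\<^bsub>quat_alg a b\<^esub> y) = h x + h y) \<and>
              (\<forall>x y. h (x \<otimes>\<^bsub>quat_alg a b\<^esub> y) = h x * h y) \<and>
              (\<forall>x. h (quat_scalar x) = \<sigma> x) \<and> h quat_Z = z \<and> h quat_F = f"
proof -
  have sub: "\<sigma> (x - y) = \<sigma> x - \<sigma> y" for x y
    using \<sigma>(2)[of "x - y" y] by (simp add: algebra_simps)
  have s0: "\<sigma> 0 = 0" using \<sigma>(2)[of 0 0] by simp
  define h where "h = (\<lambda>q. case q of Quat x0 x1 x2 x3 \<Rightarrow>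
    \<sigma> x0 + \<sigma> x1 * z + \<sigma> x2 * f + \<sigma> x3 * (z * f))"
  have zl: "z * \<sigma> x = \<sigma> x * z" "z * (\<sigma> x * s) = \<sigma> x * (z * s)"
    "f * \<sigma> x = \<sigma> x * f" "f * (\<sigma> x * s) = \<sigma> x * (f * s)" for x s
    using central[of x z] central[of x f] by (simp_all add: mult.assoc[symmetric])
  have fz: "f * z = - (z * f)" using zf by simp
  have fz': "f * (z * r) = - (z * (f * r))" for r
    using fz by (metis mult.assoc mult_minus_left)
  have zz': "z * (z * r) = \<sigma> a * r" for r using z by (metis mult.assoc)
  have ff': "f * (f * r) = \<sigma> b * r" for r using f by (metis mult.assoc)
  have 1: "h (quat_mult a b x y) = h x * h y" for x y
  proof (cases x; cases y)
    fix x0 x1 x2 x3 y0 y1 y2 y3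
    assume x: "x = Quat x0 x1 x2 x3" and y: "y = Quat y0 y1 y2 y3"
    have c: "\<sigma> x * \<sigma> y = \<sigma> y * \<sigma> x" "\<sigma> x * (\<sigma> y * r) = \<sigma> y * (\<sigma> x * r)" for x y r
      using central by (metis mult.assoc)+
    show "h (quat_mult a b x y) = h x * h y"
      unfolding x y h_def quat_mult.simps quat.case \<sigma>(2,3) sub distrib_left distrib_right
        left_diff_distrib right_diff_distrib mult.assoc zl z f fz fz' zz' ff'
        mult_minus_left mult_minus_right
      by (simp add: algebra_simps c)
  qed
  have 2: "h (quat_add x y) = h x + h y" for x y
    by (cases x; cases y) (simp add: h_def \<sigma> algebra_simps)
  have 3: "h (quat_scalar x) = \<sigma> x" "h quat_Z = z" "h quat_F = f" for x
    by (simp_all add: h_def quat_scalar_def quat_Z_def quat_F_def s0 \<sigma>)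
  show ?thesis
  proof (rule ex1I[of _ h], goal_cases)
    case 1
    show ?case using \<open>\<And>x y. h (quat_mult a b x y) = h x * h y\<close> 2 3 by simp
  next
    case (2 g)
    have "g q = h q" for q
    proof (cases q)
      case (Quat x0 x1 x2 x3)
      have q: "q = quat_add (quat_add (quat_scalar x0) (quat_mult a b (quat_scalar x1) quat_Z))
            (quat_add (quat_mult a b (quat_scalar x2) quat_F)
               (quat_mult a b (quat_scalar x3) (quat_mult a b quat_Z quat_F)))"
        by (simp add: Quat quat_scalar_def quat_Z_def quat_F_def)
      have "g q = \<sigma> x0 + \<sigma> x1 * z + (\<sigma> x2 * f + \<sigma> x3 * (z * f))"
        unfolding q using 2 by simp
      then show ?thesis by (simp add: Quat h_def add.assoc)
    qed
    then show ?case by auto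
  qed
qed


subsection \<open>The projective unit group\<close>

definition nonzero_scalars :: "'k::field quat set" where
  "nonzero_scalars = quat_scalar ` (- {0})"

definition PGL1 :: "'k::field \<Rightarrow> 'k \<Rightarrow> 'k quat set monoid" where
  "PGL1 a b = units_of (quat_alg a b) Mod nonzero_scalars"

definition PGL1_class :: "'k::field \<Rightarrow> 'k \<Rightarrow> 'k quat \<Rightarrow> 'k quat set" where
  "PGL1_class a b x = nonzero_scalars #>\<^bsub>units_of (quat_alg a b)\<^esub> x"

lemma nonzero_scalars_normal: "nonzero_scalars \<lhd> units_of (quat_alg a b)"
proof -
  interpret ring "quat_alg a b" by (rule ring_quat_alg)
  interpret U: group "units_of (quat_alg a b)" by (rule units_group)
  have comm: "quat_mult a b (quat_scalar s) y = quat_mult a b y (quat_scalar s)" for s y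
    by (cases y) (simp add: quat_scalar_def algebra_simps)
  have mult: "quat_mult a b (quat_scalar s) (quat_scalar s') = quat_scalar (s * s')" for s s'
    by (simp add: quat_scalar_def)
  have unit: "quat_scalar s \<in> Units (quat_alg a b)" if "s \<noteq> 0" for s
    unfolding Units_def using that by (auto simp: mult intro!: exI[of _ "quat_scalar (inverse s)"])
  have "subgroup nonzero_scalars (units_of (quat_alg a b))"
  proof (rule U.subgroupI, goal_cases)
    case 1
    then show ?case using unit by (auto simp: nonzero_scalars_def units_of_def)
  next
    case 2
    show ?case unfolding nonzero_scalars_def using one_neq_zero by blast
  next
    case (3 x)
    then obtain s where s: "s \<noteq> 0" "x = quat_scalar s" by (auto simp: nonzero_scalars_def)
    have "inv\<^bsub>units_of (quat_alg a b)\<^esub> x = quat_scalar (inverse s)"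
      using s unit[of s] unit[of "inverse s"]
      by (intro U.inv_equality) (auto simp: units_of_def mult)
    then show ?case using s by (simp add: nonzero_scalars_def)
  next
    case (4 x y)
    then show ?case by (auto simp: nonzero_scalars_def units_of_def mult)
  qed
  moreover have "x \<otimes>\<^bsub>units_of (quat_alg a b)\<^esub> h \<otimes>\<^bsub>units_of (quat_alg a b)\<^esub>
      inv\<^bsub>units_of (quat_alg a b)\<^esub> x \<in> nonzero_scalars"
    if x: "x \<in> carrier (units_of (quat_alg a b))" and h: "h \<in> nonzero_scalars" for x h
  proof -
    have hU: "h \<in> carrier (units_of (quat_alg a b))"
      using h unit by (auto simp: nonzero_scalars_def units_of_def)
    have "x \<otimes>\<^bsub>units_of (quat_alg a b)\<^esub> h = h \<otimes>\<^bsub>units_of (quat_alg a b)\<^esub> x"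
      using h comm by (auto simp: nonzero_scalars_def units_of_def)
    then show ?thesis using x h hU by (simp add: U.m_assoc)
  qed
  ultimately show ?thesis by (simp add: U.normal_inv_iff)
qed

lemma group_PGL1: "group (PGL1 a b)"
  unfolding PGL1_def by (rule normal.factorgroup_is_group[OF nonzero_scalars_normal])


section \<open>The rational function field and two of its completions\<close>

definition ratfun_const :: "'a::field \<Rightarrow> 'a poly fract" where
  "ratfun_const x = Fract [:x:] 1"

definition ratfun_t :: "'a::field poly fract" where
  "ratfun_t = Fract [:0, 1:] 1"

text \<open>
  The completion of \<open>k(t)\<close> at \<open>t = \<tau>\<close> is the field of Laurent series in the uniformiser
  \<open>t - \<tau>\<close>, and the one at \<open>t = \<infinity>\<close> is the field of Laurent series in \<open>1/t\<close>.
  So both are given by the type \<open>'a fls\<close>, with the embeddings sending \<open>t\<close> to \<open>\<tau> + X\<close>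
  and to \<open>1/X\<close>.
\<close>

definition poly_fls :: "'a::field fls \<Rightarrow> 'a poly \<Rightarrow> 'a fls" where
  "poly_fls s p = poly (map_poly fls_const p) s"

lemma poly_fls_altdef: "poly_fls s p = (\<Sum>i\<le>degree p. fls_const (coeff p i) * s ^ i)"
proof -
  have "degree (map_poly fls_const p) = degree p"
    by (rule degree_map_poly) (auto simp: fls_const_nonzero)
  then show ?thesis
    by (simp add: poly_fls_def poly_altdef coeff_map_poly)
qed

lemma poly_fls_add: "poly_fls s (p + r) = poly_fls s p + poly_fls s r"
proof -
  have "map_poly fls_const (p + r) = map_poly fls_const p + map_poly fls_const r"
    by (intro poly_eqI) (simp add: coeff_map_poly fls_plus_const)
  then show ?thesis by (simp add: poly_fls_def)
qed

lemma poly_fls_pCons: "poly_fls s (pCons x p) = fls_const x + s * poly_fls s p"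
  by (simp add: poly_fls_def map_poly_pCons)

lemma poly_fls_0 [simp]: "poly_fls s 0 = 0"
  by (simp add: poly_fls_def)

lemma poly_fls_1 [simp]: "poly_fls s 1 = 1"
  by (simp add: poly_fls_def)

lemma poly_fls_mult: "poly_fls s (p * r) = poly_fls s p * poly_fls s r"
proof (induction p)
  case (pCons x p)
  have "poly_fls s (smult x r) = fls_const x * poly_fls s r"
    by (induction r) (simp_all add: poly_fls_pCons algebra_simps flip: fls_const_mult_const)
  then show ?case
    using pCons.IH by (simp add: poly_fls_add poly_fls_pCons algebra_simps)
qed simp

lemma poly_fls_shift: "poly_fls (fls_const \<tau> + fls_X) p = fps_to_fls (fps_of_poly (p \<circ>\<^sub>p [:\<tau>, 1:]))"
proof (induction p)
  case (pCons x p)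
  have "fps_to_fls (fps_of_poly [:\<tau>, 1:]) = fls_const \<tau> + fls_X"
    by (simp add: fps_of_poly_pCons)
  then show ?case
    using pCons.IH
    by (simp add: poly_fls_pCons pcompose_pCons fps_of_poly_add fps_of_poly_mult fps_of_poly_const
        fls_times_fps_to_fls del: mult_pCons_left)
qed simp

lemma poly_fls_shift_eq_0_iff [simp]: "poly_fls (fls_const \<tau> + fls_X) p = 0 \<longleftrightarrow> p = 0"
proof
  assume "poly_fls (fls_const \<tau> + fls_X) p = 0"
  then have "p \<circ>\<^sub>p [:\<tau>, 1:] = 0"
    by (simp add: poly_fls_shift)
  then show "p = 0"
    by (rule pcompose_eq_0) simp
qed simp

lemma poly_fls_X_inv_eq_0_iff [simp]: "poly_fls fls_X_inv p = 0 \<longleftrightarrow> p = 0"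
proof
  assume p: "poly_fls fls_X_inv p = 0"
  have "coeff p n = 0" for n
  proof (cases "n \<le> degree p")
    case True
    have "fls_nth (poly_fls fls_X_inv p) (- int n) = (\<Sum>i\<le>degree p. if i = n then coeff p i else 0)"
      unfolding poly_fls_altdef fls_nth_sum by (intro sum.cong) auto
    also have "\<dots> = coeff p n"
      using True by simp
    finally show ?thesis by (simp add: p)
  qed (simp add: coeff_eq_0)
  then show "p = 0" by (intro poly_eqI) simp
qed simp

lemma poly_fls_quotient_eq:
  assumes "\<And>p. poly_fls s p = 0 \<longleftrightarrow> p = 0" and "r \<noteq> 0" "r' \<noteq> 0" "p * r' = p' * r"
  shows "poly_fls s p / poly_fls s r = poly_fls s p' / poly_fls s r'"
proof -
  have "poly_fls s p * poly_fls s r' = poly_fls s p' * poly_fls s r"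
    using arg_cong[OF assms(4), of "poly_fls s"] by (simp only: poly_fls_mult)
  then show ?thesis
    by (subst frac_eq_eq) (simp_all only: assms(1-3) not_False_eq_True)
qed

lift_definition embed_at :: "'a::field \<Rightarrow> 'a poly fract \<Rightarrow> 'a fls"
  is "\<lambda>\<tau> (p, r). poly_fls (fls_const \<tau> + fls_X) p / poly_fls (fls_const \<tau> + fls_X) r"
  by (clarsimp simp only: fractrel_iff fst_conv snd_conv split_paired_all prod.case)
     (rule poly_fls_quotient_eq; (assumption | simp only: poly_fls_shift_eq_0_iff poly_fls_X_inv_eq_0_iff))

lift_definition embed_infinity :: "'a::field poly fract \<Rightarrow> 'a fls"
  is "\<lambda>(p, r). poly_fls fls_X_inv p / poly_fls fls_X_inv r"
  by (clarsimp simp only: fractrel_iff fst_conv snd_conv split_paired_all prod.case)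
     (rule poly_fls_quotient_eq; (assumption | simp only: poly_fls_shift_eq_0_iff poly_fls_X_inv_eq_0_iff))

lemma embed_at_Fract:
  assumes "r \<noteq> 0"
  shows "embed_at \<tau> (Fract p r) =
    poly_fls (fls_const \<tau> + fls_X) p / poly_fls (fls_const \<tau> + fls_X) r"
  using assms by (simp add: Fract.abs_eq embed_at.abs_eq)

lemma embed_infinity_Fract:
  assumes "r \<noteq> 0"
  shows "embed_infinity (Fract p r) = poly_fls fls_X_inv p / poly_fls fls_X_inv r"
  using assms by (simp add: Fract.abs_eq embed_infinity.abs_eq)

lemma embed_at_hom:
  "embed_at \<tau> 1 = 1"
  "embed_at \<tau> (x + y) = embed_at \<tau> x + embed_at \<tau> y"
  "embed_at \<tau> (x * y) = embed_at \<tau> x * embed_at \<tau> y"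
  "embed_at \<tau> (ratfun_const u) = fls_const u"
  "embed_at \<tau> ratfun_t = fls_const \<tau> + fls_X"
proof -
  show "embed_at \<tau> 1 = 1" by (simp add: One_fract_def embed_at_Fract)
  show "embed_at \<tau> (x + y) = embed_at \<tau> x + embed_at \<tau> y"
    by (cases x; cases y) (simp add: embed_at_Fract poly_fls_add poly_fls_mult add_frac_eq)
  show "embed_at \<tau> (x * y) = embed_at \<tau> x * embed_at \<tau> y"
    by (cases x; cases y) (simp add: embed_at_Fract poly_fls_mult)
  show "embed_at \<tau> (ratfun_const u) = fls_const u"
    "embed_at \<tau> ratfun_t = fls_const \<tau> + fls_X"
    by (simp_all add: ratfun_const_def ratfun_t_def embed_at_Fract poly_fls_pCons)
qed

lemma embed_infinity_hom:
  "embed_infinity 1 = 1"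
  "embed_infinity (x + y) = embed_infinity x + embed_infinity y"
  "embed_infinity (x * y) = embed_infinity x * embed_infinity y"
  "embed_infinity (ratfun_const u) = fls_const u"
  "embed_infinity ratfun_t = fls_X_inv"
proof -
  show "embed_infinity 1 = 1" by (simp add: One_fract_def embed_infinity_Fract)
  show "embed_infinity (x + y) = embed_infinity x + embed_infinity y"
    by (cases x; cases y) (simp add: embed_infinity_Fract poly_fls_add poly_fls_mult add_frac_eq)
  show "embed_infinity (x * y) = embed_infinity x * embed_infinity y"
    by (cases x; cases y) (simp add: embed_infinity_Fract poly_fls_mult)
  show "embed_infinity (ratfun_const u) = fls_const u"
    "embed_infinity ratfun_t = fls_X_inv"
    by (simp_all add: ratfun_const_def ratfun_t_def embed_infinity_Fract poly_fls_pCons)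
qed


section \<open>The Bruhat--Tits tree\<close>

text \<open>
  The tree of \<open>PGL\<^sub>2\<close> of the local field \<open>'a fls\<close>, whose valuation ring
  \<open>range fps_to_fls\<close> consists of the power series. Its vertices are the homothety classes of
  lattices. Since both completions are realised on the type \<open>'a fls\<close>, this one tree serves as
  \<open>T\<^sub>\<tau>\<close> and as \<open>T\<^sub>\<infinity>\<close>; the places differ in the embeddings of \<open>k(t)\<close>.
\<close>

definition lattice_in_plane :: "('a::field fls ^ 2) set \<Rightarrow> bool" where
  "lattice_in_plane L \<longleftrightarrow>
     (\<exists>B :: 'a fls ^ 2 ^ 2. invertible B \<and> L = (\<lambda>v. B *v v) ` {v. \<forall>i. v $ i \<in> range fps_to_fls})"

definition homothety_class :: "('a::field fls ^ 2) set \<Rightarrow> ('a fls ^ 2) set set" where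
  "homothety_class L = {(\<lambda>v. x *s v) ` L | x. x \<noteq> 0}"

definition bt_vertices :: "('a::field fls ^ 2) set set set" where
  "bt_vertices = {homothety_class L | L. lattice_in_plane L}"

definition bt_adjacent :: "('a::field fls ^ 2) set set \<Rightarrow> ('a fls ^ 2) set set \<Rightarrow> bool" where
  "bt_adjacent v w \<longleftrightarrow> (\<exists>L\<in>v. \<exists>M\<in>w. (\<lambda>u. fls_X *s u) ` L \<subset> M \<and> M \<subset> L)"

text \<open>
  \<open>\<phi>\<close> is an isomorphism of algebras over the field \<open>'a fls\<close>: by the last two clauses it is linear
  and preserves the unit.
\<close>

definition is_splitting :: "'a::field fls \<Rightarrow> 'a fls \<Rightarrow> ('a fls quat \<Rightarrow> 'a fls ^ 2 ^ 2) \<Rightarrow> bool" where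
  "is_splitting a b \<phi> \<longleftrightarrow>
     bij \<phi> \<and>
     (\<forall>x y. \<phi> (x \<oplus>\<^bsub>quat_alg a b\<^esub> y) = \<phi> x + \<phi> y) \<and>
     (\<forall>x y. \<phi> (x \<otimes>\<^bsub>quat_alg a b\<^esub> y) = \<phi> x ** \<phi> y) \<and>
     (\<forall>s. \<phi> (quat_scalar s) = mat s)"

text \<open>
  The action of an element \<open>g\<close> of \<open>D\<^sup>*/K\<^sup>*\<close>, a coset, on a homothety class of lattices \<open>v\<close>, given
  a matrix representation \<open>\<rho>\<close> of \<open>D\<close>: the result is again a full homothety class.
\<close>

definition bt_act :: "('d \<Rightarrow> 'a::field fls ^ 2 ^ 2) \<Rightarrow> 'd set
    \<Rightarrow> ('a fls ^ 2) set set \<Rightarrow> ('a fls ^ 2) set set" where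
  "bt_act \<rho> g v = {(\<lambda>u. \<rho> x *v u) ` L | x L. x \<in> g \<and> L \<in> v}"

definition bt_product_act :: "('d \<Rightarrow> 'a::field fls ^ 2 ^ 2) \<Rightarrow> ('d \<Rightarrow> 'a fls ^ 2 ^ 2) \<Rightarrow> 'd set
    \<Rightarrow> ('a fls ^ 2) set set \<times> ('a fls ^ 2) set set
    \<Rightarrow> ('a fls ^ 2) set set \<times> ('a fls ^ 2) set set" where
  "bt_product_act \<rho> \<rho>' g = (\<lambda>(v, w) \<in> bt_vertices \<times> bt_vertices. (bt_act \<rho> g v, bt_act \<rho>' g w))"


section \<open>The lattice\<close>

text \<open>In this section \<open>K = \<bbbF>\<^sub>q(t)\<close> is the type \<open>'a poly fract\<close> with \<open>q = CARD('a)\<close>.\<close>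

definition D_b :: "'a::field poly fract" where
  "D_b = ratfun_t * (ratfun_t - 1)"

definition D_alg :: "'a::field \<Rightarrow> 'a poly fract quat ring" where
  "D_alg c = quat_alg (ratfun_const c) D_b"

definition GK :: "'a::field \<Rightarrow> 'a poly fract quat set monoid" where
  "GK c = PGL1 (ratfun_const c) D_b"

definition GK_class :: "'a::field \<Rightarrow> 'a poly fract quat \<Rightarrow> 'a poly fract quat set" where
  "GK_class c x = PGL1_class (ratfun_const c) D_b x"

definition FqZ :: "'a::field poly fract quat set" where
  "FqZ = {Quat (ratfun_const x) (ratfun_const y) 0 0 | x y. True}"

definition norm_set :: "'a::{field,finite} \<Rightarrow> 'a \<Rightarrow> 'a poly fract quat set" where
  "norm_set c m =
     {w \<in> FqZ. w [^]\<^bsub>D_alg c\<^esub> (CARD('a) + 1) = quat_scalar (ratfun_const m)}"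

definition gamma_elt :: "'a::field \<Rightarrow> 'a poly fract quat \<Rightarrow> 'a poly fract quat" where
  "gamma_elt c w =
     quat_scalar ratfun_t \<otimes>\<^bsub>D_alg c\<^esub> quat_Z \<oplus>\<^bsub>D_alg c\<^esub> w \<otimes>\<^bsub>D_alg c\<^esub> quat_F"

text \<open>Both \<open>a\<^sub>\<xi>\<close> and \<open>b\<^sub>\<eta>\<close> are given by this formula.\<close>

definition gen_elt :: "'a::field \<Rightarrow> 'a poly fract quat \<Rightarrow> 'a poly fract quat set" where
  "gen_elt c w = GK_class c (gamma_elt c w \<otimes>\<^bsub>D_alg c\<^esub> quat_Z)"

abbreviation normset_a :: "'a::{field,finite} \<Rightarrow> 'a poly fract quat set" where
  "normset_a c \<equiv> norm_set c (- c)"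

abbreviation normset_b :: "'a::{field,finite} \<Rightarrow> 'a \<Rightarrow> 'a poly fract quat set" where
  "normset_b c \<tau> \<equiv> norm_set c (c * \<tau> / (1 - \<tau>))"

definition Gamma_set :: "'a::{field,finite} \<Rightarrow> 'a \<Rightarrow> 'a poly fract quat set set" where
  "Gamma_set c \<tau> = generate (GK c) (gen_elt c ` normset_a c \<union> gen_elt c ` normset_b c \<tau>)"

definition Gamma :: "'a::{field,finite} \<Rightarrow> 'a \<Rightarrow> 'a poly fract quat set monoid" where
  "Gamma c \<tau> = (GK c)\<lparr>carrier := Gamma_set c \<tau>\<rparr>"


subsection \<open>Arithmeticity\<close>

text \<open>\<open>R = \<bbbF>\<^sub>q[t, 1/(t(t-1)(t-\<tau>))]\<close>\<close>

definition R_ring :: "'a::field \<Rightarrow> 'a poly fract set" where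
  "R_ring \<tau> =
     {Fract p 1 / (ratfun_t * (ratfun_t - 1) * (ratfun_t - ratfun_const \<tau>)) ^ n | p n. True}"

definition R_order :: "'a::field \<Rightarrow> 'a poly fract quat set" where
  "R_order \<tau> =
     {Quat x0 x1 x2 x3 | x0 x1 x2 x3.
        x0 \<in> R_ring \<tau> \<and> x1 \<in> R_ring \<tau> \<and> x2 \<in> R_ring \<tau> \<and> x3 \<in> R_ring \<tau>}"

text \<open>
  The group \<open>\<OO>\<^sup>*/R\<^sup>*\<close>, where \<open>\<OO>\<close> is the order \<open>R_order \<tau>\<close>, as a subgroup of \<open>D\<^sup>*/K\<^sup>*\<close>:
  the image of \<open>\<OO>\<^sup>*\<close>, the map \<open>\<OO>\<^sup>*/R\<^sup>* \<rightarrow> D\<^sup>*/K\<^sup>*\<close> being injective.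
\<close>

definition GR_set :: "'a::field \<Rightarrow> 'a \<Rightarrow> 'a poly fract quat set set" where
  "GR_set c \<tau> = GK_class c ` Units ((D_alg c)\<lparr>carrier := R_order \<tau>\<rparr>)"

text \<open>Subgroups of finite index in \<open>\<OO>\<^sup>*/R\<^sup>*\<close>, up to commensurability:\<close>

definition arithmetic_lattice :: "'a::field \<Rightarrow> 'a \<Rightarrow> 'a poly fract quat set set \<Rightarrow> bool" where
  "arithmetic_lattice c \<tau> H \<longleftrightarrow> subgroup H (GK c) \<and> commensurable (GK c) H (GR_set c \<tau>)"


subsection \<open>The presentation\<close>

datatype 'w gen = GenA 'w | GenB 'w

fun gen_value :: "'a::field \<Rightarrow> 'a poly fract quat gen \<Rightarrow> 'a poly fract quat set" where
  "gen_value c (GenA w) = gen_elt c w"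
| "gen_value c (GenB w) = gen_elt c w"

definition pres_gens :: "'a::{field,finite} \<Rightarrow> 'a \<Rightarrow> 'a poly fract quat gen set" where
  "pres_gens c \<tau> = GenA ` normset_a c \<union> GenB ` normset_b c \<tau>"

abbreviation la :: "'w \<Rightarrow> 'w gen \<times> bool" where "la w \<equiv> (GenA w, True)"
abbreviation lb :: "'w \<Rightarrow> 'w gen \<times> bool" where "lb w \<equiv> (GenB w, True)"

definition pres_rels ::
    "'a::{field,finite} \<Rightarrow> 'a \<Rightarrow> ('a poly fract quat gen word \<times> 'a poly fract quat gen word) set" where
  "pres_rels c \<tau> =
     {([la \<xi>, la (\<ominus>\<^bsub>D_alg c\<^esub> \<xi>)], []) | \<xi>. \<xi> \<in> normset_a c} \<union>
     {([lb \<eta>, lb (\<ominus>\<^bsub>D_alg c\<^esub> \<eta>)], []) | \<eta>. \<eta> \<in> normset_b c \<tau>} \<union>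
     {([la \<xi>, lb \<eta>], [lb \<nu>, la \<mu>]) | \<xi> \<eta> \<nu> \<mu>.
        \<xi> \<in> normset_a c \<and> \<mu> \<in> normset_a c \<and> \<eta> \<in> normset_b c \<tau> \<and> \<nu> \<in> normset_b c \<tau> \<and>
        \<eta> = \<nu> [^]\<^bsub>D_alg c\<^esub> CARD('a) \<otimes>\<^bsub>D_alg c\<^esub> (\<nu> \<ominus>\<^bsub>D_alg c\<^esub> \<xi>) [^]\<^bsub>D_alg c\<^esub> (1 - int CARD('a)) \<and>
        \<mu> = \<xi> [^]\<^bsub>D_alg c\<^esub> CARD('a) \<otimes>\<^bsub>D_alg c\<^esub> (\<xi> \<ominus>\<^bsub>D_alg c\<^esub> \<nu>) [^]\<^bsub>D_alg c\<^esub> (1 - int CARD('a))}"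


subsection \<open>The actions at the two places\<close>

text \<open>
  For a completion \<open>K\<^sub>v\<close> with embedding \<open>\<iota>\<close> the algebra \<open>D \<otimes>\<^sub>K K\<^sub>v\<close> is the quaternion algebra
  with parameters \<open>\<iota> c\<close> and \<open>\<iota> (t(t-1))\<close>, and \<open>map_quat \<iota>\<close> is the map \<open>D \<rightarrow> D \<otimes>\<^sub>K K\<^sub>v\<close>.
\<close>

definition D_splitting ::
    "'a::field \<Rightarrow> ('a poly fract \<Rightarrow> 'a fls) \<Rightarrow> ('a fls quat \<Rightarrow> 'a fls ^ 2 ^ 2) \<Rightarrow> bool" where
  "D_splitting c \<iota> \<phi> \<longleftrightarrow> is_splitting (\<iota> (ratfun_const c)) (\<iota> D_b) \<phi>"

definition Gamma_act :: "'a::field \<Rightarrow> ('a fls quat \<Rightarrow> 'a fls ^ 2 ^ 2) \<Rightarrow> ('a fls quat \<Rightarrow> 'a fls ^ 2 ^ 2)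
    \<Rightarrow> 'a poly fract quat set
    \<Rightarrow> ('a fls ^ 2) set set \<times> ('a fls ^ 2) set set
    \<Rightarrow> ('a fls ^ 2) set set \<times> ('a fls ^ 2) set set" where
  "Gamma_act \<tau> \<phi> \<psi> = bt_product_act (\<phi> \<circ> map_quat (embed_at \<tau>)) (\<psi> \<circ> map_quat embed_infinity)"

end

(*
The element gamma_xi Z has reduced norm c^2 t if N(xi) = -c, and gamma_eta Z has reduced norm
c^2 t (t - tau) / (1 - tau) if N(eta) = c tau / (1 - tau).  Hence the a_xi fix the base vertex of
T_tau and move the base vertex of T_infinity to its q + 1 neighbours, all of them distinct, while for
the b_eta the two trees change roles.  So a nonempty reduced word in the a_xi is a path without
backtracking in T_infinity and moves the base vertex, and likewise for the b_eta in T_tau.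

The relation for the pair (xi, -lambda) rewrites b_lambda a_xi as a product a b.  Every word is
therefore equal, modulo the relations, to a reduced word in the a_xi followed by a reduced word in the
b_eta, and such a product fixes the base vertex of the product of the trees only if both words are
empty.  This gives the presentation and the triviality of stabilisers at once; transitivity holds
because the generators reach all neighbours of the base vertex in either tree.

Torsion: D is ramified at t = 1, and there an element of Gamma reduces to a nonzero constant, so the
pure part of its n-th power has leading coefficient n times a unit; this settles n prime to p, and the
factor p is removed by the Frobenius after adjoining a square root of the square of the pure part.

Finite index: an element of G(R) that fixes the base vertex is represented by a primitive quaternion
with polynomial coordinates.  Its reduced norm has at most simple zeros at the ramified places 0 and 1
and no other zero, and the condition at infinity then bounds the degrees of the coordinates by 1.

The tree itself is described from one of its ends: its vertices are the balls of the field of Laurent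
series, and the parent of a ball is the next larger ball with the same centre.
*)

theory Submission
  imports "HOL-Algebra.Algebraic_Closure_Type" "HOL-Analysis.Determinants" Defs
begin

section \<open>Trees\<close>

text \<open>Everything local is computed in one explicit splitting per place, chosen so that the
  maximal order preserving the standard lattice is visible: a matrix is integral exactly when four
  rescaled coordinates are. For the generators the valuation of the reduced norm then decides
  whether the base vertex stays or moves to a neighbour. At t = infinity the norm of the
  \<open>b_eta\<close> has a pole of order two, which the homothety by 1/t absorbs; this is why they
  fix the base vertex there. Arbitrary splittings are reached only at the end, through an inner
  automorphism of the matrix algebra, which merely changes the base point.

  Each norm equation has exactly q + 1 solutions, so once different generators are known to give
  different neighbours, all neighbours are reached.

  Simple transitivity alone does not exclude torsion, since an element of finite order could invert
  an edge; hence the separate argument at t = 1.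

  Finite index uses transitivity: every coset of the group in G(R) meets the stabiliser of the base
  vertex, so only this stabiliser has to be shown finite.\<close>

lemma simple_path_shorten:
  assumes "successively E p" "set p \<subseteq> V" "p \<noteq> []"
  shows "\<exists>q. simple_path V E (hd p) (last p) q"
  using assms
proof (induction p)
  case (Cons x p)
  show ?case
  proof (cases "p = []")
    case True
    then show ?thesis using Cons.prems by (intro exI[of _ "[x]"]) (simp add: simple_path_def)
  next
    case False
    then obtain q where q: "simple_path V E (hd p) (last p) q"
      using Cons by (auto simp: successively_Cons)
    show ?thesis
    \<comment> \<open>Loop erasure: if \<open>x\<close> recurs on the shortened tail, the path
      starts afresh at that occurrence.\<close>
    proof (cases "x \<in> set q")
      case True
      then obtain q1 q2 where "q = q1 @ x # q2" by (meson split_list)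
      then show ?thesis
        using q False by (intro exI[of _ "x # q2"]) (auto simp: simple_path_def successively_append_iff)
    next
      case x: False
      have "E x (hd q)" using Cons.prems False q by (auto simp: successively_Cons simple_path_def)
      then show ?thesis
        using q False x Cons.prems
        by (intro exI[of _ "x # q"]) (auto simp: simple_path_def successively_Cons)
    qed
  qed
qed simp

lemma simple_path_Cons:
  assumes "simple_path V E v w p" "v \<noteq> w"
  obtains p' where "p = v # p'" "simple_path V E (hd p') w p'" "E v (hd p')" "hd p' \<in> V" "v \<notin> set p'"
proof -
  obtain p' where p: "p = v # p'" using assms by (cases p) (auto simp: simple_path_def)
  then have "p' \<noteq> []" using assms by (auto simp: simple_path_def)
  then show thesis
    using assms p by (intro that[of p']) (auto simp: simple_path_def successively_Cons)
qed

lemma simple_path_same: "simple_path V E v v p \<Longrightarrow> p = [v]"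
  by (cases p) (auto simp: simple_path_def split: if_splits)

text \<open>
  A tree seen from one of its ends: every vertex has one parent, the neighbour in the direction of
  the end, and \<open>lev\<close> is the Busemann function of the end.
\<close>

locale parent_tree =
  fixes V :: "'v set" and E :: "'v \<Rightarrow> 'v \<Rightarrow> bool" and par :: "'v \<Rightarrow> 'v" and lev :: "'v \<Rightarrow> int"
  assumes nonempty: "V \<noteq> {}"
    and par_in: "v \<in> V \<Longrightarrow> par v \<in> V"
    and lev_par: "v \<in> V \<Longrightarrow> lev (par v) = lev v - 1"
    and adj_iff: "v \<in> V \<Longrightarrow> w \<in> V \<Longrightarrow> E v w \<longleftrightarrow> w = par v \<or> v = par w"
    and common: "v \<in> V \<Longrightarrow> w \<in> V \<Longrightarrow> \<exists>i j. (par ^^ i) v = (par ^^ j) w"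
begin

lemma funpow_in: "v \<in> V \<Longrightarrow> (par ^^ i) v \<in> V"
  by (induction i) (auto intro: par_in)

lemma lev_funpow: "v \<in> V \<Longrightarrow> lev ((par ^^ i) v) = lev v - int i"
  by (induction i) (auto simp: lev_par funpow_in)

text \<open>For vertices this is the cone below \<open>u\<close>: the component away from the end
  after the edge between \<open>u\<close> and \<open>par u\<close> is removed.\<close>

definition desc :: "'v \<Rightarrow> 'v set" where
  "desc u = {x. \<exists>j. (par ^^ j) x = u}"

lemma desc_refl: "u \<in> desc u"
  unfolding desc_def by (auto intro: exI[of _ 0])

lemma desc_par: "par x \<in> desc u \<Longrightarrow> x \<in> desc u"
proof -
  assume "par x \<in> desc u"
  then obtain j where "(par ^^ j) (par x) = u" by (auto simp: desc_def)
  then have "(par ^^ Suc j) x = u" by (simp add: funpow_swap1)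
  then show ?thesis unfolding desc_def by blast
qed

lemma desc_cases: "x \<in> desc u \<Longrightarrow> x = u \<or> par x \<in> desc u"
proof -
  assume "x \<in> desc u"
  then obtain j where j: "(par ^^ j) x = u" by (auto simp: desc_def)
  then show ?thesis
  proof (cases j)
    case (Suc k)
    then have "(par ^^ k) (par x) = u" using j by (simp add: funpow_swap1)
    then show ?thesis unfolding desc_def by blast
  qed simp
qed

text \<open>By \<open>desc_par\<close> and \<open>desc_cases\<close> the edge between
  \<open>u\<close> and \<open>par u\<close> is the only one joining the cone of \<open>u\<close> to
  its complement, so a walk that gets in has to use it.\<close>

lemma par_in_path_of_enter:
  assumes "successively E p" "set p \<subseteq> V" "p \<noteq> []" "hd p \<notin> desc u" "last p \<in> desc u"
  shows "par u \<in> set p"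
  using assms
proof (induction p)
  case (Cons x p)
  show ?case
  proof (cases "hd p \<in> desc u")
    case True
    have ne: "p \<noteq> []" using Cons.prems by auto
    then have "E x (hd p)" "x \<in> V" "hd p \<in> V"
      using Cons.prems by (auto simp: successively_Cons)
    then have "hd p = par x \<or> x = par (hd p)" by (simp add: adj_iff)
    then show ?thesis
      using True Cons.prems desc_par[of x u] desc_cases[of "hd p" u] by auto
  next
    case False
    have "p \<noteq> []" using Cons.prems by auto
    then show ?thesis using False Cons by (auto simp: successively_Cons)
  qed
qed simp

lemma par_in_path_of_exit:
  assumes "successively E p" "set p \<subseteq> V" "p \<noteq> []" "hd p \<in> desc u" "last p \<notin> desc u"
  shows "par u \<in> set p"
  using assms
proof (induction p)
  case (Cons x p)
  have ne: "p \<noteq> []" using Cons.prems by auto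
  show ?case
  proof (cases "hd p \<in> desc u")
    case False
    have "E x (hd p)" "x \<in> V" "hd p \<in> V"
      using Cons.prems ne by (auto simp: successively_Cons)
    then have "hd p = par x \<or> x = par (hd p)" by (simp add: adj_iff)
    then have "hd p = par u"
      using False Cons.prems desc_par[of "hd p" u] desc_cases[of x u] by auto
    then show ?thesis using ne by (metis list.set_intros(2) hd_in_set)
  next
    case True
    then show ?thesis using ne Cons by (auto simp: successively_Cons)
  qed
qed simp

text \<open>Going down: the first step must lead to the child \<open>u\<close> of \<open>v\<close>
  whose cone contains \<open>w\<close>, and then induction applies.\<close>

lemma simple_path_unique_ancestor:
  assumes "(par ^^ j) w = v" "w \<in> V" "simple_path V E v w p" "simple_path V E v w q"
  shows "p = q"
  using assms
proof (induction j arbitrary: v p q)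
  case 0
  then show ?case using simple_path_same by (metis funpow_0)
next
  case (Suc j)
  have v: "v \<in> V" using Suc.prems funpow_in[of w "Suc j"] by simp
  have "v \<noteq> w"
    using Suc.prems lev_funpow[of w "Suc j"] by auto
  define u where "u = (par ^^ j) w"
  have u: "u \<in> V" "par u = v" "w \<in> desc u"
    using Suc.prems funpow_in by (auto simp: u_def desc_def)
  have step: "\<exists>p'. r = v # p' \<and> simple_path V E u w p'" if r: "simple_path V E v w r" for r
  proof -
    obtain p' where p': "r = v # p'" "simple_path V E (hd p') w p'" "E v (hd p')" "hd p' \<in> V" "v \<notin> set p'"
      using simple_path_Cons[OF r \<open>v \<noteq> w\<close>] by metis
    \<comment> \<open>Otherwise the rest of the path enters the cone of \<open>u\<close> later and
      visits \<open>par u = v\<close> a second time.\<close>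
    have "hd p' \<in> desc u"
      using par_in_path_of_enter[of p' u] p' u by (auto simp: simple_path_def)
    then obtain k where k: "(par ^^ k) (hd p') = u" by (auto simp: desc_def)
    then have lev: "lev u = lev (hd p') - int k" using lev_funpow p' by blast
    have "hd p' = par v \<or> v = par (hd p')" using p' v by (simp add: adj_iff)
    \<comment> \<open>As a member of the cone the next vertex has level
      \<open>lev v + 1 + k\<close>, while a neighbour of \<open>v\<close> has level
      \<open>lev v - 1\<close> or \<open>lev v + 1\<close>.\<close>
    then have "k = 0"
    proof
      assume "hd p' = par v"
      then show ?thesis using lev lev_par[OF v] lev_par[OF u(1)] u by simp
    next
      assume "v = par (hd p')"
      then show ?thesis using lev lev_par[OF p'(4)] lev_par[OF u(1)] u by simp
    qed
    then show ?thesis using k p' by auto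
  qed
  show ?case
    using step[OF Suc.prems(3)] step[OF Suc.prems(4)] Suc.IH[of u] Suc.prems(2) u_def by auto
qed

text \<open>Induction on the number of steps from \<open>v\<close> up to a common ancestor. While
  \<open>w\<close> is not below \<open>v\<close>, a simple path has to go up: after a step down to a
  child of \<open>v\<close> it could leave the cone of that child only through
  \<open>v\<close>.\<close>

lemma simple_path_unique:
  assumes "(par ^^ i) v = (par ^^ j) w" "v \<in> V" "w \<in> V" "simple_path V E v w p" "simple_path V E v w q"
  shows "p = q"
  using assms
proof (induction i arbitrary: v p q)
  case 0
  then show ?case using simple_path_unique_ancestor[of j w v] by simp
next
  case (Suc i)
  show ?case
  proof (cases "w \<in> desc v")
    case True
    then show ?thesis using simple_path_unique_ancestor Suc.prems unfolding desc_def by blast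
  next
    case False
    then have "v \<noteq> w" using desc_refl by auto
    have step: "\<exists>p'. r = v # p' \<and> simple_path V E (par v) w p'" if r: "simple_path V E v w r" for r
    proof -
      obtain p' where p': "r = v # p'" "simple_path V E (hd p') w p'" "E v (hd p')" "hd p' \<in> V" "v \<notin> set p'"
        using simple_path_Cons[OF r \<open>v \<noteq> w\<close>] by metis
      have "v \<noteq> par (hd p')"
      proof
        assume v: "v = par (hd p')"
        have "w \<notin> desc (hd p')"
        proof
          assume "w \<in> desc (hd p')"
          then obtain k where "(par ^^ k) w = hd p'" by (auto simp: desc_def)
          then have "(par ^^ Suc k) w = v" using v by simp
          then show False using False unfolding desc_def by blast
        qed
        then show False
          using par_in_path_of_exit[of p' "hd p'"] p' v desc_refl by (auto simp: simple_path_def)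
      qed
      then have "hd p' = par v" using p' Suc.prems by (simp add: adj_iff)
      then show ?thesis using p' by auto
    qed
    have "(par ^^ i) (par v) = (par ^^ j) w" using Suc.prems(1) by (simp add: funpow_swap1)
    then show ?thesis
      using step[OF Suc.prems(4)] step[OF Suc.prems(5)] Suc.IH[of "par v"] Suc.prems par_in by auto
  qed
qed

lemma walk_to_ancestor:
  assumes "v \<in> V"
  shows "\<exists>p. successively E p \<and> set p \<subseteq> V \<and> p \<noteq> [] \<and> hd p = v \<and> last p = (par ^^ i) v"
proof (induction i)
  case 0
  show ?case using assms by (intro exI[of _ "[v]"]) simp
next
  case (Suc i)
  then obtain p where p: "successively E p" "set p \<subseteq> V" "p \<noteq> []" "hd p = v" "last p = (par ^^ i) v"
    by blast
  then show ?case
    using assms funpow_in[of v i] par_in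
    by (intro exI[of _ "p @ [(par ^^ Suc i) v]"]) (auto simp: successively_append_iff adj_iff)
qed

lemma adj_sym: "E v w \<Longrightarrow> v \<in> V \<Longrightarrow> w \<in> V \<Longrightarrow> E w v"
  by (auto simp: adj_iff)

lemma simple_path_exists:
  assumes "v \<in> V" "w \<in> V"
  shows "\<exists>p. simple_path V E v w p"
proof -
  obtain i j where ij: "(par ^^ i) v = (par ^^ j) w" using common assms by blast
  obtain p where p: "successively E p" "set p \<subseteq> V" "p \<noteq> []" "hd p = v" "last p = (par ^^ i) v"
    using walk_to_ancestor[OF assms(1)] by blast
  obtain q where q: "successively E q" "set q \<subseteq> V" "q \<noteq> []" "hd q = w" "last q = (par ^^ j) w"
    using walk_to_ancestor[OF assms(2)] by blast
  have "successively E (rev q)"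
    unfolding successively_rev
    using q(2) by (intro successively_mono[OF q(1)]) (blast intro: adj_sym)
  then have "successively E (p @ tl (rev q))"
    using p q ij by (cases "rev q") (auto simp: successively_append_iff successively_Cons hd_rev)
  moreover have "last (p @ tl (rev q)) = w"
    using p q ij by (cases q rule: rev_cases) (auto simp: last_append last_rev hd_append split: if_splits)
  moreover have "set (tl (rev q)) \<subseteq> V"
    using q(2) by (metis list.set_sel(2) rev.simps(1) set_rev subset_code(1) tl_Nil)
  ultimately show ?thesis
    using simple_path_shorten[of E "p @ tl (rev q)" V] p by auto
qed

lemma regular_tree:
  assumes "\<And>v. v \<in> V \<Longrightarrow> finite {w \<in> V. par w = v} \<and> card {w \<in> V. par w = v} = d"
  shows "regular_tree (d + 1) V E"
proof -
  have "finite {w \<in> V. E v w} \<and> card {w \<in> V. E v w} = d + 1" if v: "v \<in> V" for v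
  proof -
    have "{w \<in> V. E v w} = insert (par v) {w \<in> V. par w = v}"
      using v par_in by (auto simp: adj_iff)
    moreover have "par (par v) \<noteq> v"
      using lev_par[OF v] lev_par[OF par_in[OF v]] by auto
    ultimately show ?thesis using assms[OF v] by simp
  qed
  moreover have "\<not> E v v" if v: "v \<in> V" for v
    using lev_par[OF v] v by (auto simp: adj_iff)
  moreover have "\<exists>!p. simple_path V E v w p" if "v \<in> V" "w \<in> V" for v w
    using simple_path_exists[OF that] simple_path_unique common[OF that] that by metis
  ultimately show ?thesis
    using nonempty by (auto simp: regular_tree_def adj_iff)
qed

end

text \<open>The tail is simple by induction. If its predecessor \<open>x\<close> occurred on it, the
  segment from \<open>hd p\<close> to \<open>x\<close> and the single edge would be two simple paths
  with the same ends; by uniqueness \<open>x\<close> is then the second vertex of the tail, which is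
  a backtracking.\<close>

lemma nonbacktracking_imp_simple_path:
  assumes T: "regular_tree d V E" and "p \<noteq> []" "set p \<subseteq> V" "successively E p"
    and "\<And>i. i + 2 < length p \<Longrightarrow> p ! (i + 2) \<noteq> p ! i"
  shows "simple_path V E (hd p) (last p) p"
  using assms(2-)
proof (induction p)
  case (Cons x p)
  show ?case
  proof (cases "p = []")
    case False
    have IH: "simple_path V E (hd p) (last p) p"
    proof (rule Cons.IH[OF False])
      show "p ! (i + 2) \<noteq> p ! i" if "i + 2 < length p" for i
        using Cons.prems(4)[of "Suc i"] that by auto
    qed (use Cons.prems in \<open>auto simp: successively_Cons\<close>)
    have E: "E x (hd p)" "x \<in> V" "hd p \<in> V"
      using Cons.prems False by (auto simp: successively_Cons)
    then have E': "E (hd p) x" "hd p \<noteq> x" using T by (auto simp: regular_tree_def)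
    have "x \<notin> set p"
    proof
      assume "x \<in> set p"
      then obtain p1 p2 where p: "p = p1 @ x # p2" by (meson split_list)
      then have "p1 \<noteq> []" using E' by auto
      then have "simple_path V E (hd p) x (p1 @ [x])"
        using IH p by (auto simp: simple_path_def successively_append_iff)
      moreover have "simple_path V E (hd p) x [hd p, x]"
        using E E' by (auto simp: simple_path_def)
      moreover have "\<exists>!r. simple_path V E (hd p) x r"
        using T E by (simp add: regular_tree_def)
      ultimately have "p1 @ [x] = [hd p, x]" by blast
      then have "p = hd p # x # p2" using p by simp
      then have "length p = length p2 + 2" "p ! 1 = x"
        by (metis length_Cons add_2_eq_Suc') (metis \<open>p = hd p # x # p2\<close> One_nat_def nth_Cons_0 nth_Cons_Suc)
      then show False using Cons.prems(4)[of 0] by simp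
    qed
    then show ?thesis
      using IH E False Cons.prems by (auto simp: simple_path_def)
  qed (use Cons in \<open>auto simp: simple_path_def\<close>)
qed simp


section \<open>Lattices in the plane\<close>

subsection \<open>The valuation ring\<close>

definition val_ring :: "'a::field fls set" where
  "val_ring = range fps_to_fls"

lemma val_ring_iff: "f \<in> val_ring \<longleftrightarrow> 0 \<le> fls_subdegree f"
proof
  assume "f \<in> val_ring"
  then show "0 \<le> fls_subdegree f" by (auto simp: val_ring_def fls_subdegree_fls_to_fps_gt0)
next
  assume "0 \<le> fls_subdegree f"
  then have "f = fps_to_fls (fls_regpart f)" by (simp add: fls_regpart_to_fls_trivial)
  then show "f \<in> val_ring" unfolding val_ring_def by blast
qed

lemma val_ring_add: "f \<in> val_ring \<Longrightarrow> g \<in> val_ring \<Longrightarrow> f + g \<in> val_ring"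
  by (auto simp: val_ring_def simp flip: fps_to_fls_plus)

lemma val_ring_mult: "f \<in> val_ring \<Longrightarrow> g \<in> val_ring \<Longrightarrow> f * g \<in> val_ring"
  by (auto simp: val_ring_def simp flip: fls_times_fps_to_fls)

lemma val_ring_diff: "f \<in> val_ring \<Longrightarrow> g \<in> val_ring \<Longrightarrow> f - g \<in> val_ring"
  by (auto simp: val_ring_def simp flip: fps_to_fls_minus)

lemma val_ring_uminus [simp]: "- f \<in> val_ring \<longleftrightarrow> f \<in> val_ring"
  by (simp add: val_ring_iff)

lemma val_ring_simps [simp, intro]:
  "0 \<in> val_ring" "1 \<in> val_ring" "fls_const x \<in> val_ring" "fls_X \<in> val_ring"
  by (simp_all add: val_ring_iff)

lemma val_ring_inverse_unit: "fls_subdegree f = 0 \<Longrightarrow> inverse f \<in> val_ring"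
  by (simp add: val_ring_iff fls_inverse_subdegree)

lemma val_ring_unit_mult_iff [simp]:
  assumes "f \<noteq> 0" "fls_subdegree f = 0"
  shows "f * g \<in> val_ring \<longleftrightarrow> g \<in> val_ring" "g * f \<in> val_ring \<longleftrightarrow> g \<in> val_ring"
proof -
  show "f * g \<in> val_ring \<longleftrightarrow> g \<in> val_ring" using assms by (cases "g = 0") (auto simp: val_ring_iff)
  then show "g * f \<in> val_ring \<longleftrightarrow> g \<in> val_ring" by (simp add: mult.commute)
qed


subsection \<open>Two by two matrices\<close>

definition mat2 :: "'k \<Rightarrow> 'k \<Rightarrow> 'k \<Rightarrow> 'k \<Rightarrow> 'k ^ 2 ^ 2" where
  "mat2 a b c d = (\<chi> i j. if i = 1 then (if j = 1 then a else b) else (if j = 1 then c else d))"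

lemma mat2_nth [simp]:
  "mat2 a b c d $ 1 $ 1 = a" "mat2 a b c d $ 1 $ 2 = b"
  "mat2 a b c d $ 2 $ 1 = c" "mat2 a b c d $ 2 $ 2 = d"
  by (simp_all add: mat2_def)

lemma mat2_cases [cases type]: obtains a b c d where "A = mat2 a b c d"
proof
  show "A = mat2 (A $ 1 $ 1) (A $ 1 $ 2) (A $ 2 $ 1) (A $ 2 $ 2)"
    by (simp add: vec_eq_iff forall_2)
qed

lemma mat2_eq_iff [simp]: "mat2 a b c d = mat2 a' b' c' d' \<longleftrightarrow> a = a' \<and> b = b' \<and> c = c' \<and> d = d'"
  by (auto simp: vec_eq_iff forall_2)

lemma mat2_mult [simp]:
  "mat2 a b c d ** mat2 a' b' c' d' =
     mat2 (a * a' + b * c') (a * b' + b * d') (c * a' + d * c') (c * b' + d * d')"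
  by (simp add: vec_eq_iff forall_2 matrix_matrix_mult_def sum_2)

lemma mat2_add [simp]:
  "mat2 a b c d + mat2 a' b' c' d' = mat2 (a + a') (b + b') (c + c') (d + d')"
  by (simp add: vec_eq_iff forall_2)

lemma mat_eq_mat2: "mat s = mat2 s 0 0 s"
  by (simp add: vec_eq_iff forall_2 mat_def)

lemma det_mat2 [simp]: "det (mat2 a b c d) = a * d - b * c"
  by (simp add: det_2)

lemma mat_mult_commute: "mat s ** A = A ** mat s" for s :: "'k::comm_semiring_1" and A :: "'k ^ 2 ^ 2"
  by (cases A) (simp add: mat_eq_mat2 mult.commute)

lemma mat_mat_mult: "mat s ** mat t = (mat (s * t) :: 'k::comm_semiring_1 ^ 2 ^ 2)"
  by (simp add: mat_eq_mat2)

lemma scale_eq_mat_mult: "s *s v = mat s *v v" for s :: "'k::comm_semiring_1" and v :: "'k ^ 2"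
  by (simp add: vec_eq_iff forall_2 mat_def matrix_vector_mult_def sum_2)

lemma det_mat_2 [simp]: "det (mat s :: 'k::comm_ring_1 ^ 2 ^ 2) = s * s"
  by (simp add: mat_eq_mat2)

definition adj2 :: "'k::comm_ring_1 ^ 2 ^ 2 \<Rightarrow> 'k ^ 2 ^ 2" where
  "adj2 A = mat2 (A $ 2 $ 2) (- A $ 1 $ 2) (- A $ 2 $ 1) (A $ 1 $ 1)"

lemma adj2_mat2 [simp]: "adj2 (mat2 a b c d) = mat2 d (- b) (- c) a"
  by (simp add: adj2_def)

lemma adj2_mult: "adj2 A ** A = mat (det A)" "A ** adj2 A = mat (det A)"
  by (cases A; simp add: mat_eq_mat2 algebra_simps)+

lemma invertible_iff_det2: "invertible A \<longleftrightarrow> det A \<noteq> 0"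
  for A :: "'k::field ^ 2 ^ 2"
  by (simp add: invertible_det_nz)

definition int_mat :: "'a::field fls ^ 2 ^ 2 \<Rightarrow> bool" where
  "int_mat A \<longleftrightarrow> (\<forall>i j. A $ i $ j \<in> val_ring)"

lemma int_mat_mat2 [simp]:
  "int_mat (mat2 a b c d) \<longleftrightarrow> a \<in> val_ring \<and> b \<in> val_ring \<and> c \<in> val_ring \<and> d \<in> val_ring"
  by (auto simp: int_mat_def forall_2)

lemma int_mat_mult: "int_mat A \<Longrightarrow> int_mat B \<Longrightarrow> int_mat (A ** B)"
  by (cases A; cases B) (auto intro!: val_ring_add val_ring_mult)

lemma int_mat_adj2: "int_mat A \<Longrightarrow> int_mat (adj2 A)"
  by (cases A) auto

lemma int_mat_det: "int_mat A \<Longrightarrow> 0 \<le> fls_subdegree (det A)"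
  by (cases A) (auto simp flip: val_ring_iff intro!: val_ring_diff val_ring_mult)


subsection \<open>Lattices\<close>

definition lat :: "'a::field fls ^ 2 ^ 2 \<Rightarrow> ('a fls ^ 2) set" where
  "lat B = (\<lambda>v. B *v v) ` {v. \<forall>i. v $ i \<in> val_ring}"

lemma lat_mult: "lat (A ** B) = (\<lambda>v. A *v v) ` lat B"
  by (simp add: lat_def image_image matrix_vector_mul_assoc)

lemma lat_subset_lat_1: "lat B \<subseteq> lat (mat 1) \<longleftrightarrow> int_mat B"
proof
  have 1: "lat (mat 1) = {v :: 'a fls ^ 2. \<forall>i. v $ i \<in> val_ring}"
    by (simp add: lat_def)
  assume B: "lat B \<subseteq> lat (mat 1)"
  have "B $ i $ j \<in> val_ring" for i j
  proof -
    have "axis j 1 \<in> {v :: 'a fls ^ 2. \<forall>i. v $ i \<in> val_ring}" by (simp add: axis_def)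
    then have "B *v axis j 1 \<in> lat B" unfolding lat_def by (rule imageI)
    then have "B *v axis j 1 \<in> lat (mat 1)" using B by blast
    then show ?thesis
      unfolding 1 by (simp add: matrix_vector_mult_def axis_def if_distrib cong: if_cong)
  qed
  then show "int_mat B" by (simp add: int_mat_def)
next
  assume "int_mat B"
  moreover have "lat (mat 1) = {v :: 'a fls ^ 2. \<forall>i. v $ i \<in> val_ring}"
    by (simp add: lat_def)
  ultimately show "lat B \<subseteq> lat (mat 1)"
    by (auto simp: lat_def int_mat_def matrix_vector_mult_def sum_2 intro!: val_ring_add val_ring_mult)
qed

lemma inverse_adj2_mult:
  assumes "det C \<noteq> (0 :: 'k::field)"
  shows "mat (inverse (det C)) ** adj2 C ** C = mat 1" "C ** (mat (inverse (det C)) ** adj2 C) = mat 1"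
proof -
  show "mat (inverse (det C)) ** adj2 C ** C = mat 1"
    unfolding matrix_mul_assoc[symmetric] adj2_mult mat_mat_mult using assms by simp
  have "C ** (mat (inverse (det C)) ** adj2 C) = mat (det C) ** mat (inverse (det C))"
    unfolding mat_mult_commute[of _ "adj2 C"] matrix_mul_assoc adj2_mult ..
  then show "C ** (mat (inverse (det C)) ** adj2 C) = mat 1"
    unfolding mat_mat_mult using assms by simp
qed

lemma inj_matrix_vector:
  assumes "det A \<noteq> 0"
  shows "inj (\<lambda>v. A *v (v :: 'k::field ^ 2))"
proof (rule inj_on_inverseI)
  show "(mat (inverse (det A)) ** adj2 A) *v (A *v v) = v" for v
    using inverse_adj2_mult[OF assms] by (simp add: matrix_vector_mul_assoc)
qed

lemma lat_mult_subset_iff: "det A \<noteq> 0 \<Longrightarrow> lat (A ** B) \<subseteq> lat (A ** C) \<longleftrightarrow> lat B \<subseteq> lat C"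
  unfolding lat_mult by (rule inj_image_subset_iff[OF inj_matrix_vector])

lemma lat_mult_eq_iff: "det A \<noteq> 0 \<Longrightarrow> lat (A ** B) = lat (A ** C) \<longleftrightarrow> lat B = lat C"
  unfolding set_eq_subset by (simp add: lat_mult_subset_iff)

lemma matrix_eq_mult:
  assumes "det (C :: 'k::field ^ 2 ^ 2) \<noteq> 0"
  obtains U where "B = C ** U"
proof
  show "B = C ** (mat (inverse (det C)) ** adj2 C ** B)"
    using inverse_adj2_mult[OF assms] by (metis matrix_mul_assoc matrix_mul_lid)
qed

lemma lat_unit:
  assumes "int_mat U" "det U \<noteq> 0" "fls_subdegree (det U) = 0"
  shows "lat U = lat (mat 1)"
proof
  show "lat U \<subseteq> lat (mat 1)" using assms by (simp add: lat_subset_lat_1)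
  define W where "W = mat (inverse (det U)) ** adj2 U"
  have "int_mat W"
    unfolding W_def using assms
    by (intro int_mat_mult int_mat_adj2) (auto simp: mat_eq_mat2 val_ring_inverse_unit)
  moreover have "U ** W = mat 1"
    unfolding W_def using assms(2) by (rule inverse_adj2_mult)
  ultimately show "lat (mat 1) \<subseteq> lat U"
    using lat_mult_subset_iff[of U W "mat 1"] assms lat_subset_lat_1[of W] by simp
qed

lemma lat_mult_unit:
  assumes "int_mat U" "det U \<noteq> 0" "fls_subdegree (det U) = 0"
  shows "lat (B ** U) = lat B"
  using lat_unit[OF assms] by (metis lat_mult matrix_mul_rid)

text \<open>With \<open>B = C ** U\<close> and \<open>U\<close> integral, the valuation of
  \<open>det U\<close> measures the index of the two lattices; if it is 0, then \<open>U\<close> is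
  invertible over the valuation ring.\<close>

lemma lat_subset_subdegree:
  assumes "lat B \<subseteq> lat C" "det B \<noteq> 0" "det C \<noteq> 0"
  shows "fls_subdegree (det C) \<le> fls_subdegree (det B)"
    and "fls_subdegree (det C) = fls_subdegree (det B) \<Longrightarrow> lat B = lat C"
proof -
  obtain U where U: "B = C ** U" using matrix_eq_mult assms by blast
  then have "lat U \<subseteq> lat (mat 1)" using assms lat_mult_subset_iff[of C U "mat 1"] by simp
  then have int: "int_mat U" by (simp add: lat_subset_lat_1)
  have det: "det B = det C * det U" using U by (simp add: det_mul)
  then have *: "fls_subdegree (det B) = fls_subdegree (det C) + fls_subdegree (det U)" using assms by auto
  then show "fls_subdegree (det C) \<le> fls_subdegree (det B)" using int_mat_det[OF int] by simp
  show "lat B = lat C" if "fls_subdegree (det C) = fls_subdegree (det B)"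
    unfolding U by (rule lat_mult_unit) (use int that * det assms in auto)
qed

lemma lat_psubset_subdegree:
  assumes "det B \<noteq> 0" "det C \<noteq> 0"
  shows "lat B \<subset> lat C \<longleftrightarrow> lat B \<subseteq> lat C \<and> fls_subdegree (det C) < fls_subdegree (det B)"
  using lat_subset_subdegree[of B C] lat_subset_subdegree[of C B] assms
  by (metis nless_le order.strict_iff_not subset_not_subset_eq order_refl)

lemma lat_scale: "(\<lambda>v. s *s v) ` lat B = lat (mat s ** B)"
  by (simp add: lat_mult scale_eq_mat_mult)


subsection \<open>Vertices of the tree\<close>

definition vx :: "'a::field fls ^ 2 ^ 2 \<Rightarrow> ('a fls ^ 2) set set" where
  "vx B = homothety_class (lat B)"

lemma mem_vx: "L \<in> vx B \<longleftrightarrow> (\<exists>s. s \<noteq> 0 \<and> L = lat (mat s ** B))"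
  unfolding vx_def homothety_class_def lat_scale by blast

lemma bt_vertices_eq: "bt_vertices = {vx B | B. det B \<noteq> 0}"
  unfolding bt_vertices_def lattice_in_plane_def vx_def lat_def val_ring_def invertible_iff_det2 by auto

lemma vx_in [intro, simp]: "det B \<noteq> 0 \<Longrightarrow> vx B \<in> bt_vertices"
  by (auto simp: bt_vertices_eq)

lemma vx_scale: "s \<noteq> 0 \<Longrightarrow> vx (mat s ** B) = vx B"
proof -
  assume s: "s \<noteq> 0"
  have "L \<in> vx (mat s ** B) \<longleftrightarrow> L \<in> vx B" for L
  proof
    assume "L \<in> vx (mat s ** B)"
    then obtain t where "t \<noteq> 0" "L = lat (mat t ** (mat s ** B))" by (auto simp: mem_vx)
    then show "L \<in> vx B"
      unfolding mem_vx using s by (intro exI[of _ "t * s"]) (simp add: matrix_mul_assoc mat_mat_mult)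
  next
    assume "L \<in> vx B"
    then obtain t where "t \<noteq> 0" "L = lat (mat t ** B)" by (auto simp: mem_vx)
    then show "L \<in> vx (mat s ** B)"
      unfolding mem_vx using s by (intro exI[of _ "t / s"]) (simp add: matrix_mul_assoc mat_mat_mult)
  qed
  then show ?thesis by blast
qed

lemma vx_eq_iff: "vx B = vx C \<longleftrightarrow> (\<exists>s. s \<noteq> 0 \<and> lat (mat s ** B) = lat C)"
proof
  assume eq: "vx B = vx C"
  have "lat C \<in> vx C" unfolding mem_vx by (intro exI[of _ 1]) simp
  then have "lat C \<in> vx B" by (simp only: eq)
  then show "\<exists>s. s \<noteq> 0 \<and> lat (mat s ** B) = lat C" unfolding mem_vx by metis
next
  assume "\<exists>s. s \<noteq> 0 \<and> lat (mat s ** B) = lat C"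
  then obtain s where "s \<noteq> 0" "lat (mat s ** B) = lat C" by blast
  then show "vx B = vx C" using vx_scale[of s B] by (simp add: vx_def)
qed

lemma vx_mult_eq_iff: "det A \<noteq> 0 \<Longrightarrow> vx (A ** B) = vx (A ** C) \<longleftrightarrow> vx B = vx C"
proof -
  assume "det A \<noteq> 0"
  moreover have "mat s ** (A ** B) = A ** (mat s ** B)" for s
    by (metis mat_mult_commute matrix_mul_assoc)
  ultimately show ?thesis unfolding vx_eq_iff by (simp add: lat_mult_eq_iff)
qed

text \<open>A lattice inside the standard one equals it as soon as its determinant is a unit. So
  only a scaling factor has to be found, and its valuation is minus half that of
  \<open>det B\<close>.\<close>

lemma vx_eq_1_iff:
  assumes "det B \<noteq> 0"
  shows "vx B = vx (mat 1) \<longleftrightarrow>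
    (\<exists>s. s \<noteq> 0 \<and> int_mat (mat s ** B) \<and> 2 * fls_subdegree s + fls_subdegree (det B) = 0)"
proof -
  have "lat (mat s ** B) = lat (mat 1) \<longleftrightarrow>
      int_mat (mat s ** B) \<and> 2 * fls_subdegree s + fls_subdegree (det B) = 0" if "s \<noteq> 0" for s
  proof -
    have d: "fls_subdegree (det (mat s ** B)) = 2 * fls_subdegree s + fls_subdegree (det B)"
      "det (mat s ** B) \<noteq> 0"
      using that assms by (simp_all add: det_mul)
    then show ?thesis
      using lat_subset_subdegree[of "mat s ** B" "mat 1"] lat_subset_subdegree[of "mat 1" "mat s ** B"]
      by (auto simp: lat_subset_lat_1[symmetric])
  qed
  then show ?thesis unfolding vx_eq_iff by blast
qed

lemma bt_adjacent_vx:
  "bt_adjacent (vx A) (vx B) \<longleftrightarrow>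
    (\<exists>s. s \<noteq> 0 \<and> lat (mat fls_X ** A) \<subset> lat (mat s ** B) \<and> lat (mat s ** B) \<subset> lat A)"
proof
  assume "bt_adjacent (vx A) (vx B)"
  then obtain L M where LM: "L \<in> vx A" "M \<in> vx B" "(\<lambda>u. fls_X *s u) ` L \<subset> M" "M \<subset> L"
    unfolding bt_adjacent_def by blast
  obtain t u where tu: "t \<noteq> 0" "u \<noteq> 0" and L: "L = lat (mat t ** A)" and M: "M = lat (mat u ** B)"
    using LM(1,2) unfolding mem_vx by metis
  note tu = tu LM(3,4)[unfolded L M lat_scale]
  have t: "det (mat t :: 'a fls ^ 2 ^ 2) \<noteq> 0" using tu by simp
  have eq: "mat fls_X ** (mat t ** A) = mat t ** (mat fls_X ** A)"
      "mat u ** B = mat t ** (mat (u / t) ** B)"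
    using tu(1) by (simp_all add: matrix_mul_assoc mat_mat_mult mult.commute)
  show "\<exists>s. s \<noteq> 0 \<and> lat (mat fls_X ** A) \<subset> lat (mat s ** B) \<and> lat (mat s ** B) \<subset> lat A"
    by (rule exI[of _ "u / t"], use tu in
      \<open>simp add: eq psubset_eq lat_mult_subset_iff[OF t] lat_mult_eq_iff[OF t]\<close>)
next
  assume "\<exists>s. s \<noteq> 0 \<and> lat (mat fls_X ** A) \<subset> lat (mat s ** B) \<and> lat (mat s ** B) \<subset> lat A"
  then obtain s where s: "s \<noteq> 0" "lat (mat fls_X ** A) \<subset> lat (mat s ** B)" "lat (mat s ** B) \<subset> lat A"
    by blast
  have "lat A \<in> vx A" "lat (mat s ** B) \<in> vx B"
    unfolding mem_vx using s(1) by (auto intro: exI[of _ 1])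
  then show "bt_adjacent (vx A) (vx B)"
    unfolding bt_adjacent_def lat_scale[symmetric] using s(2,3) by (metis lat_scale)
qed

lemma bt_adjacent_mult:
  assumes "det A \<noteq> 0"
  shows "bt_adjacent (vx (A ** B)) (vx (A ** C)) \<longleftrightarrow> bt_adjacent (vx B) (vx C)"
proof -
  have eq: "mat s ** (A ** B) = A ** (mat s ** B)" for s B
    by (metis mat_mult_commute matrix_mul_assoc)
  show ?thesis
    unfolding bt_adjacent_vx psubset_eq eq
    by (simp only: lat_mult_subset_iff[OF assms] lat_mult_eq_iff[OF assms])
qed

text \<open>The lower inclusion comes for free: if \<open>C\<close> is integral and
  \<open>det C\<close> has valuation 1, then \<open>mat fls_X\<close> is \<open>C\<close> times the
  integral matrix \<open>mat (fls_X / det C) ** adj2 C\<close>.\<close>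

lemma bt_adjacent_1_vx:
  assumes "det B \<noteq> 0"
  shows "bt_adjacent (vx (mat 1)) (vx B) \<longleftrightarrow>
    (\<exists>s. s \<noteq> 0 \<and> int_mat (mat s ** B) \<and> 2 * fls_subdegree s + fls_subdegree (det B) = 1)"
proof -
  have "(lat (mat fls_X ** mat 1) \<subset> lat (mat s ** B) \<and> lat (mat s ** B) \<subset> lat (mat 1)) \<longleftrightarrow>
     (int_mat (mat s ** B) \<and> 2 * fls_subdegree s + fls_subdegree (det B) = 1)" if "s \<noteq> 0" for s
  proof -
    define C where "C = mat s ** B"
    have C: "fls_subdegree (det C) = 2 * fls_subdegree s + fls_subdegree (det B)" "det C \<noteq> 0"
      using that assms by (simp_all add: det_mul C_def)
    have "lat (mat fls_X) \<subseteq> lat C" if "int_mat C" "fls_subdegree (det C) = 1"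
    proof -
      have "C ** (mat (fls_X / det C) ** adj2 C) = mat (fls_X / det C) ** (C ** adj2 C)"
        by (metis mat_mult_commute matrix_mul_assoc)
      also have "\<dots> = mat fls_X" using C by (simp add: adj2_mult mat_mat_mult)
      finally have "lat (mat fls_X) = lat (C ** (mat (fls_X / det C) ** adj2 C))" by simp
      moreover have "fls_X / det C \<in> val_ring"
        using that C by (simp add: val_ring_iff fls_divide_subdegree)
      then have "int_mat (mat (fls_X / det C) ** adj2 C)"
        using that by (intro int_mat_mult int_mat_adj2) (auto simp: mat_eq_mat2)
      ultimately show ?thesis
        using lat_mult_subset_iff[of C _ "mat 1"] C(2) by (simp add: lat_subset_lat_1)
    qed
    then show ?thesis
      unfolding C_def[symmetric] C(1)[symmetric]
      using lat_psubset_subdegree[of "mat fls_X" C] lat_psubset_subdegree[of C "mat 1"] C(2)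
      by (auto simp: lat_subset_lat_1)
  qed
  then show ?thesis unfolding bt_adjacent_vx by metis
qed


subsection \<open>Vertices as balls\<close>

definition Xp :: "int \<Rightarrow> 'a::field fls" where
  "Xp n = fls_X_intpow n"

lemma Xp_mult: "Xp m * Xp n = Xp (m + n)"
  unfolding Xp_def by (rule fls_X_intpow_times_fls_X_intpow)

lemma Xp_simps [simp]: "Xp n \<noteq> 0" "fls_subdegree (Xp n) = n" "Xp 0 = 1" "Xp 1 = fls_X"
  by (simp_all add: Xp_def fls_X_conv_shift_1)

lemma Xp_mult_assoc: "Xp m * (Xp n * f) = Xp (m + n) * f"
  by (simp add: Xp_mult[symmetric] mult.assoc)

lemma Xp_cancel [simp]: "Xp n * (Xp (- n) * f) = f" "Xp (- n) * (Xp n * f) = f"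
  by (simp_all add: Xp_mult_assoc)

lemma Xp_mult_in_val_ring: "Xp m * (f :: 'a::field fls) \<in> val_ring \<Longrightarrow> m \<le> n \<Longrightarrow> Xp n * f \<in> val_ring"
proof -
  assume f: "Xp m * f \<in> val_ring" "m \<le> n"
  have "Xp n * f = Xp (n - m) * (Xp m * f)" by (simp add: Xp_mult_assoc)
  moreover have "Xp (n - m) \<in> (val_ring :: 'a fls set)" using f(2) by (simp add: val_ring_iff)
  ultimately show ?thesis using val_ring_mult[OF _ f(1)] by metis
qed

lemma Xp_decomp: "f \<noteq> 0 \<Longrightarrow> \<exists>u. f = Xp (fls_subdegree f) * u \<and> u \<noteq> 0 \<and> fls_subdegree u = 0"
  by (intro exI[of _ "Xp (- fls_subdegree f) * f"]) simp

text \<open>The ball of radius \<open>n\<close> about \<open>f\<close> stands for the lattice with basis \<open>(X^n, 0)\<close>, \<open>(f, 1)\<close>.\<close>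

definition ball_mat :: "int \<Rightarrow> 'a::field fls \<Rightarrow> 'a fls ^ 2 ^ 2" where
  "ball_mat n f = mat2 (Xp n) f 0 1"

definition bv :: "int \<Rightarrow> 'a::field fls \<Rightarrow> ('a fls ^ 2) set set" where
  "bv n f = vx (ball_mat n f)"

lemma det_ball_mat [simp]: "det (ball_mat n f) = Xp n"
  by (simp add: ball_mat_def)

lemma ball_mat_quotient:
  "ball_mat n' f' = ball_mat n f ** ball_mat (n' - n) (Xp (- n) * (f' - f))"
  by (simp add: ball_mat_def Xp_mult Xp_mult_assoc)

lemma int_mat_scale_ball_mat:
  "int_mat (mat s ** ball_mat n f) \<longleftrightarrow> s * Xp n \<in> val_ring \<and> s * f \<in> val_ring \<and> s \<in> val_ring"
  by (simp add: ball_mat_def mat_eq_mat2)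

lemma bv_in [simp]: "bv n f \<in> bt_vertices"
  by (simp add: bv_def)

text \<open>\<open>ball_mat n f\<close> carries the comparison back to the standard vertex. There
  \<open>s\<close> and \<open>s * Xp d\<close> are integral with valuations summing to 0, so both
  are units.\<close>

lemma bv_eq_iff: "bv n f = bv n' f' \<longleftrightarrow> n = n' \<and> Xp (- n) * (f' - f) \<in> val_ring"
proof -
  define d e where "d = n' - n" and "e = Xp (- n) * (f' - f)"
  have "bv n f = bv n' f' \<longleftrightarrow> vx (ball_mat d e) = vx (mat 1)"
    unfolding bv_def ball_mat_quotient[of n' f' n f] d_def e_def
    using vx_mult_eq_iff[of "ball_mat n f" "mat 1"] by auto
  also have "\<dots> \<longleftrightarrow> (\<exists>s. s \<noteq> 0 \<and> s * Xp d \<in> val_ring \<and> s * e \<in> val_ring \<and> s \<in> val_ring \<and>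
      2 * fls_subdegree s + d = 0)"
    by (simp add: vx_eq_1_iff int_mat_scale_ball_mat)
  also have "\<dots> \<longleftrightarrow> d = 0 \<and> e \<in> val_ring"
  proof
    assume "\<exists>s. s \<noteq> 0 \<and> s * Xp d \<in> val_ring \<and> s * e \<in> val_ring \<and> s \<in> val_ring \<and> 2 * fls_subdegree s + d = 0"
    then obtain s where s: "s \<noteq> 0" "0 \<le> fls_subdegree s + d" "s * e \<in> val_ring"
        "0 \<le> fls_subdegree s" "2 * fls_subdegree s + d = 0"
      by (auto simp: val_ring_iff)
    then show "d = 0 \<and> e \<in> val_ring" by (auto simp: val_ring_unit_mult_iff)
  qed (auto intro!: exI[of _ 1])
  finally show ?thesis unfolding d_def e_def by auto
qed

text \<open>As for equality, but now the valuations of \<open>s\<close> and \<open>s * Xp d\<close>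
  sum to 1: one is a unit and the other a uniformiser. The two cases are the two directions of the
  parent relation.\<close>

lemma bt_adjacent_bv:
  "bt_adjacent (bv n f) (bv n' f') \<longleftrightarrow> bv n' f' = bv (n - 1) f \<or> bv n f = bv (n' - 1) f'"
proof -
  define d e where "d = n' - n" and "e = Xp (- n) * (f' - f)"
  have "bt_adjacent (bv n f) (bv n' f') \<longleftrightarrow> bt_adjacent (vx (mat 1)) (vx (ball_mat d e))"
    unfolding bv_def ball_mat_quotient[of n' f' n f] d_def e_def
    using bt_adjacent_mult[of "ball_mat n f" "mat 1"] by auto
  also have "\<dots> \<longleftrightarrow> (\<exists>s. s \<noteq> 0 \<and> s * Xp d \<in> val_ring \<and> s * e \<in> val_ring \<and> s \<in> val_ring \<and>
      2 * fls_subdegree s + d = 1)"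
    by (simp add: bt_adjacent_1_vx int_mat_scale_ball_mat)
  also have "\<dots> \<longleftrightarrow> d = 1 \<and> e \<in> val_ring \<or> d = - 1 \<and> fls_X * e \<in> val_ring"
  proof
    assume "\<exists>s. s \<noteq> 0 \<and> s * Xp d \<in> val_ring \<and> s * e \<in> val_ring \<and> s \<in> val_ring \<and> 2 * fls_subdegree s + d = 1"
    then obtain s where s: "s \<noteq> 0" "0 \<le> fls_subdegree s + d" "s * e \<in> val_ring"
        "0 \<le> fls_subdegree s" "2 * fls_subdegree s + d = 1"
      by (auto simp: val_ring_iff)
    then have "fls_subdegree s = 0 \<and> d = 1 \<or> fls_subdegree s = 1 \<and> d = - 1" by presburger
    then consider "fls_subdegree s = 0" "d = 1" | "fls_subdegree s = 1" "d = - 1" by blast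
    then show "d = 1 \<and> e \<in> val_ring \<or> d = - 1 \<and> fls_X * e \<in> val_ring"
    proof cases
      case 1
      then show ?thesis using s by auto
    next
      case 2
      obtain u where u: "s = Xp 1 * u" "u \<noteq> 0" "fls_subdegree u = 0" using Xp_decomp[OF s(1)] 2 by auto
      then have "u * (fls_X * e) \<in> val_ring" using s by (simp add: mult_ac)
      then show ?thesis using u 2 by simp
    qed
  next
    assume "d = 1 \<and> e \<in> val_ring \<or> d = - 1 \<and> fls_X * e \<in> val_ring"
    then show "\<exists>s. s \<noteq> 0 \<and> s * Xp d \<in> val_ring \<and> s * e \<in> val_ring \<and> s \<in> val_ring \<and> 2 * fls_subdegree s + d = 1"
    proof
      assume "d = 1 \<and> e \<in> val_ring"
      then show ?thesis by (intro exI[of _ 1]) auto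
    next
      assume "d = - 1 \<and> fls_X * e \<in> val_ring"
      then show ?thesis by (intro exI[of _ fls_X]) (auto simp: val_ring_iff)
    qed
  qed
  also have "\<dots> \<longleftrightarrow> bv n' f' = bv (n - 1) f \<or> bv n f = bv (n' - 1) f'"
  proof -
    have "Xp 1 * e = Xp (- (n - 1)) * (f' - f)" by (simp only: e_def Xp_mult_assoc) simp
    then have "bv (n - 1) f = bv n' f' \<longleftrightarrow> d = - 1 \<and> fls_X * e \<in> val_ring"
      unfolding bv_eq_iff by (auto simp: d_def)
    moreover have "bv n f = bv (n' - 1) f' \<longleftrightarrow> d = 1 \<and> e \<in> val_ring"
      unfolding bv_eq_iff e_def[symmetric] by (auto simp: d_def)
    ultimately show ?thesis by metis
  qed
  finally show ?thesis .
qed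

text \<open>Hermite normal form: a swap of columns makes the quotient of the bottom row integral, a
  column operation over the valuation ring then clears its first entry, and a homothety turns the
  second one into 1.\<close>

lemma bt_vertex_cases:
  assumes "v \<in> bt_vertices"
  obtains n f where "v = bv n f"
proof -
  obtain B where B: "v = vx B" "det B \<noteq> 0" using assms by (auto simp: bt_vertices_eq)
  obtain a b c d where abcd: "B = mat2 a b c d" by (cases B)
  have swap: "vx (mat2 a b c d) = vx (mat2 b a d c)" for a b c d :: "'a fls"
    using lat_mult_unit[of "mat2 0 1 1 0" "mat2 a b c d"] by (simp add: vx_def)
  have *: "\<exists>n f. vx (mat2 a b c d) = bv n f"
    if "a * d - b * c \<noteq> 0" "d \<noteq> 0" "c / d \<in> val_ring" for a b c d :: "'a fls"
  proof -
    define x where "x = a - b * (c / d)"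
    have x: "x \<noteq> 0" using that by (auto simp: x_def field_simps)
    have "lat (mat2 a b c d) = lat (mat2 a b c d ** mat2 1 0 (- (c / d)) 1)"
      by (rule lat_mult_unit[symmetric]) (use that in auto)
    also have "mat2 a b c d ** mat2 1 0 (- (c / d)) 1 = mat2 x b 0 d"
      using that by (simp add: x_def)
    finally have 1: "vx (mat2 a b c d) = vx (mat2 x b 0 d)" by (simp add: vx_def)
    obtain u where u: "x / d = Xp (fls_subdegree (x / d)) * u" "u \<noteq> 0" "fls_subdegree u = 0"
      using Xp_decomp[of "x / d"] x \<open>d \<noteq> 0\<close> by auto
    have "vx (mat2 x b 0 d) = vx (mat (1 / d) ** mat2 x b 0 d)"
      using that by (simp add: vx_scale)
    also have "mat (1 / d) ** mat2 x b 0 d = ball_mat (fls_subdegree (x / d)) (b / d) ** mat2 u 0 0 1"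
      using that u(1) by (simp add: mat_eq_mat2 ball_mat_def)
    also have "vx \<dots> = bv (fls_subdegree (x / d)) (b / d)"
      unfolding vx_def bv_def by (subst lat_mult_unit) (use u in \<open>auto simp: val_ring_iff\<close>)
    finally show ?thesis using 1 by blast
  qed
  have "\<exists>n f. v = bv n f"
  proof (cases "d \<noteq> 0 \<and> c / d \<in> val_ring")
    case True
    then show ?thesis using *[of a d b c] B abcd by auto
  next
    case False
    have det: "a * d - b * c \<noteq> 0" using B abcd by simp
    then have "c \<noteq> 0" using False by auto
    moreover have "d / c \<in> val_ring"
    proof (cases "d = 0")
      case False
      then show ?thesis using \<open>\<not> (d \<noteq> 0 \<and> c / d \<in> val_ring)\<close> \<open>c \<noteq> 0\<close>
        by (simp add: val_ring_iff fls_divide_subdegree)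
    qed simp
    moreover have "b * c - a * d \<noteq> 0" using det by (simp add: algebra_simps)
    ultimately show ?thesis using *[of b c a d] B(1) abcd swap[of a b c d] by auto
  qed
  then show ?thesis using that by blast
qed

definition ball_parent :: "('a::field fls ^ 2) set set \<Rightarrow> ('a fls ^ 2) set set" where
  "ball_parent v = (THE w. \<exists>n f. v = bv n f \<and> w = bv (n - 1) f)"

definition ball_level :: "('a::field fls ^ 2) set set \<Rightarrow> int" where
  "ball_level v = (THE n. \<exists>f. v = bv n f)"

lemma ball_parent [simp]: "ball_parent (bv n f) = bv (n - 1) f"
  unfolding ball_parent_def
proof (rule the_equality)
  show "\<exists>n' f'. bv n f = bv n' f' \<and> bv (n - 1) f = bv (n' - 1) f'" by blast
  fix w assume "\<exists>n' f'. bv n f = bv n' f' \<and> w = bv (n' - 1) f'"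
  then obtain f' where "w = bv (n - 1) f'" "Xp (- n) * (f' - f) \<in> val_ring" by (auto simp: bv_eq_iff)
  then show "w = bv (n - 1) f"
    using Xp_mult_in_val_ring[of "- n" "f' - f" "- (n - 1)"] bv_eq_iff[of "n - 1" f "n - 1" f'] by simp
qed

lemma ball_level [simp]: "ball_level (bv n f) = n"
  unfolding ball_level_def by (rule the_equality) (blast, simp add: bv_eq_iff)

lemma ball_parent_funpow: "(ball_parent ^^ i) (bv n f) = bv (n - int i) f"
  by (induction i) (simp_all add: algebra_simps)

interpretation bt: parent_tree bt_vertices bt_adjacent ball_parent ball_level
proof
  fix v w :: "('a fls ^ 2) set set"
  assume v: "v \<in> bt_vertices"
  then obtain n f where nf: "v = bv n f" by (rule bt_vertex_cases)
  show "ball_parent v \<in> bt_vertices" "ball_level (ball_parent v) = ball_level v - 1"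
    by (simp_all add: nf)
  assume w: "w \<in> bt_vertices"
  then obtain n' f' where nf': "w = bv n' f'" by (rule bt_vertex_cases)
  show "bt_adjacent v w \<longleftrightarrow> w = ball_parent v \<or> v = ball_parent w"
    by (simp add: nf nf' bt_adjacent_bv)
  \<comment> \<open>A level at which the balls about \<open>f\<close> and \<open>f'\<close> coincide
    and which is not above either given level. For \<open>f' = f\<close> the subdegree is 0 by
    convention, which only makes \<open>m\<close> smaller than necessary.\<close>
  define m where "m = min (min n n') (fls_subdegree (f' - f))"
  have "Xp (- m) * (f' - f) \<in> val_ring"
    by (cases "f' = f") (auto simp: val_ring_iff m_def)
  then have "bv m f = bv m f'" by (simp add: bv_eq_iff)
  moreover have "n - int (nat (n - m)) = m" "n' - int (nat (n' - m)) = m" by (auto simp: m_def)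
  ultimately have "(ball_parent ^^ nat (n - m)) v = (ball_parent ^^ nat (n' - m)) w"
    by (simp only: nf nf' ball_parent_funpow)
  then show "\<exists>i j. (ball_parent ^^ i) v = (ball_parent ^^ j) w" by blast
next
  show "bt_vertices \<noteq> ({} :: ('a fls ^ 2) set set set)" using bv_in by blast
qed

lemma val_ring_residue:
  assumes "f \<in> val_ring"
  shows "Xp (- 1) * (f - fls_const (fls_nth f 0)) \<in> val_ring"
proof -
  have "1 \<le> fls_subdegree (f - fls_const (fls_nth f 0))" if "f \<noteq> fls_const (fls_nth f 0)"
  proof (rule fls_subdegree_geI)
    show "fls_nth (f - fls_const (fls_nth f 0)) k = 0" if "k < 1" for k
      using assms that by (cases "k = 0") (auto simp: val_ring_iff)
  qed (use that in auto)
  then show ?thesis by (cases "f = fls_const (fls_nth f 0)") (auto simp: val_ring_iff)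
qed

lemma const_div_X: "Xp (- 1) * fls_const x \<in> val_ring \<longleftrightarrow> x = 0"
  by (cases "x = 0") (auto simp: val_ring_iff fls_const_nonzero)

theorem bt_regular_tree:
  "regular_tree (CARD('a) + 1) (bt_vertices :: ('a::{field,finite} fls ^ 2) set set set) bt_adjacent"
proof (rule bt.regular_tree)
  fix v :: "('a fls ^ 2) set set"
  assume "v \<in> bt_vertices"
  then obtain n f where nf: "v = bv n f" by (rule bt_vertex_cases)
  \<comment> \<open>A ball of level \<open>n\<close> splits into q balls of level
    \<open>n + 1\<close>, told apart by the coefficient of X^n in the centre.\<close>
  define g where "g = (\<lambda>x. bv (n + 1) (f + Xp n * fls_const x))"
  have "inj g"
  proof (rule injI)
    fix x y assume "g x = g y"
    then have "Xp (- (n + 1)) * ((f + Xp n * fls_const y) - (f + Xp n * fls_const x)) \<in> val_ring"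
      by (simp add: g_def bv_eq_iff)
    also have "Xp (- (n + 1)) * ((f + Xp n * fls_const y) - (f + Xp n * fls_const x))
        = Xp (- 1) * fls_const (y - x)"
      by (simp add: right_diff_distrib Xp_mult_assoc flip: fls_minus_const)
    finally show "x = y" by (simp add: const_div_X)
  qed
  have "{w \<in> bt_vertices. ball_parent w = v} = range g"
  proof
    show "range g \<subseteq> {w \<in> bt_vertices. ball_parent w = v}"
      by (simp add: g_def nf bv_eq_iff image_subset_iff algebra_simps Xp_mult_assoc)
    show "{w \<in> bt_vertices. ball_parent w = v} \<subseteq> range g"
    proof
      fix w assume w: "w \<in> {w \<in> bt_vertices. ball_parent w = v}"
      then obtain m h where mh: "w = bv m h" using bt_vertex_cases by blast
      then have m: "m = n + 1" "Xp (- n) * (f - h) \<in> val_ring" using w nf by (auto simp: bv_eq_iff)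
      define e where "e = Xp (- n) * (h - f)"
      have "e = - (Xp (- n) * (f - h))" by (simp add: e_def algebra_simps)
      then have e: "e \<in> val_ring" using m(2) by simp
      have h: "h = f + Xp n * e" by (simp add: e_def)
      define x where "x = fls_nth e 0"
      have "Xp (- (n + 1)) * ((f + Xp n * fls_const x) - h) = - (Xp (- 1) * (e - fls_const x))"
        by (simp add: h left_diff_distrib right_diff_distrib distrib_left Xp_mult_assoc)
      then have "w = g x"
        using val_ring_residue[OF e] by (simp only: mh m(1) g_def bv_eq_iff x_def val_ring_uminus)
      then show "w \<in> range g" by blast
    qed
  qed
  then show "finite {w \<in> bt_vertices. ball_parent w = v} \<and> card {w \<in> bt_vertices. ball_parent w = v} = CARD('a)"
    using \<open>inj g\<close> by (simp add: card_image)
qed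


section \<open>The quadratic extension of a finite field\<close>

text \<open>In characteristic 2 squaring is injective, hence surjective on a finite field, and no
  non-square is left.\<close>

lemma two_neq_0_of_nonsquare:
  fixes c :: "'a::{field,finite}"
  assumes "\<nexists>x. x ^ 2 = c"
  shows "(2 :: 'a) \<noteq> 0"
proof
  assume 2: "(2 :: 'a) = 0"
  have "inj (\<lambda>x :: 'a. x ^ 2)"
  proof (rule injI)
    fix x y :: 'a assume "x ^ 2 = y ^ 2"
    then have "(x - y) ^ 2 = 2 * (y ^ 2 - x * y)" by (simp add: power2_eq_square algebra_simps)
    then show "x = y" using 2 by simp
  qed
  then have "surj (\<lambda>x :: 'a. x ^ 2)" by (simp add: finite_UNIV_inj_surj)
  then show False using assms by (metis surjE)
qed

lemma finite_field_power_card_minus_1: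
  fixes x :: "'a::{field,finite}"
  assumes "x \<noteq> 0"
  shows "x ^ (CARD('a) - 1) = 1"
proof -
  have "bij_betw (\<lambda>y. x * y) (- {0}) (- {0})"
    by (rule bij_betw_byWitness[of _ "\<lambda>y. y / x"]) (use assms in auto)
  then have "(\<Prod>y\<in>- {0}. x * y) = \<Prod>(- {0})"
    by (rule prod.reindex_bij_betw)
  then have "x ^ card (- {0 :: 'a}) * \<Prod>(- {0}) = \<Prod>(- {0})"
    by (simp add: prod.distrib)
  moreover have "\<Prod>(- {0 :: 'a}) \<noteq> 0" by simp
  ultimately show ?thesis by (simp add: Compl_eq_Diff_UNIV)
qed

lemma finite_field_power_card:
  fixes x :: "'a::{field,finite}"
  shows "x ^ CARD('a) = x"
proof (cases "x = 0")
  case False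
  have "x ^ CARD('a) = x * x ^ (CARD('a) - 1)" by (simp flip: power_Suc)
  then show ?thesis using finite_field_power_card_minus_1[OF False] by simp
qed simp

text \<open>The sum of all field elements is unchanged under the shift by 1, so q = 0 in the field;
  therefore its characteristic divides \<open>p ^ m\<close> and is \<open>p\<close>.\<close>

lemma freshmans_dream_card:
  fixes x y :: "'b::comm_semiring_1"
  assumes "prime p" "CARD('a::{field,finite}) = p ^ m" "CHAR('b) = CHAR('a)"
  shows "(x + y) ^ CARD('a) = x ^ CARD('a) + y ^ CARD('a)"
proof -
  have pr: "prime CHAR('a)" by (rule prime_CHAR_semidom) (simp add: finite_imp_CHAR_pos)
  have "bij_betw (\<lambda>x :: 'a. x + 1) UNIV UNIV"
    by (rule bij_betw_byWitness[of _ "\<lambda>x. x - 1"]) auto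
  then have "(\<Sum>x\<in>UNIV. x + (1 :: 'a)) = \<Sum>UNIV" by (rule sum.reindex_bij_betw)
  then have "of_nat CARD('a) = (0 :: 'a)" by (simp add: sum.distrib)
  then have "CHAR('a) dvd p ^ m" by (metis assms(2) of_nat_eq_0_iff_char_dvd)
  then have "CHAR('a) = p" using pr assms(1) prime_dvd_power primes_dvd_imp_eq by blast
  then show ?thesis using freshmans_dream'[of _ m x y] pr assms by simp
qed

text \<open>The square of \<open>z ^ q\<close> is again \<open>to_ac c\<close>, and
  \<open>z ^ q = z\<close> is impossible because the q elements of the ground field already exhaust
  the roots of X^q - X. So the q-th power sends \<open>z\<close> to \<open>- z\<close>.\<close>

lemma conj_power:
  fixes c x y :: "'a::{field,finite}" and z :: "'a alg_closure"
  assumes "prime p" "CARD('a) = p ^ m" and c: "\<nexists>x. x ^ 2 = c" and z: "z ^ 2 = to_ac c"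
  shows "(to_ac x + to_ac y * z) ^ CARD('a) = to_ac x - to_ac y * z"
proof -
  define q where "q = CARD('a)"
  have zr: "z \<notin> range to_ac" using c z by (metis imageE to_ac_eq_iff to_ac_power)
  have "(z ^ q) ^ 2 = z ^ 2"
  proof -
    have "(z ^ q) ^ 2 = (z ^ 2) ^ q" by (simp add: mult.commute flip: power_mult)
    then show ?thesis by (simp add: z q_def finite_field_power_card flip: to_ac_power)
  qed
  moreover have "z ^ q \<noteq> z"
  proof
    assume zq: "z ^ q = z"
    define P :: "'a alg_closure poly" where "P = monom 1 q - monom 1 1"
    have q: "1 < q" using card_mono[of UNIV "{0, 1 :: 'a}"] by (simp add: q_def)
    then have "coeff P q = 1" by (simp add: P_def)
    then have P: "P \<noteq> 0" by auto
    have "degree P \<le> q" unfolding P_def using q by (intro degree_diff_le) (simp_all add: degree_monom_eq)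
    have "insert z (range to_ac) \<subseteq> {x. poly P x = 0}"
      using zq by (auto simp: P_def poly_monom q_def finite_field_power_card simp flip: to_ac_power)
    then have "card (insert z (range (to_ac :: 'a \<Rightarrow> _))) \<le> card {x. poly P x = 0}"
      by (intro card_mono poly_roots_finite[OF P])
    also have "\<dots> \<le> q" using card_poly_roots_bound[OF P] \<open>degree P \<le> q\<close> by simp
    finally show False using zr by (simp add: card_image inj_to_ac q_def)
  qed
  ultimately have "z ^ q = - z" by (simp add: power2_eq_iff)
  moreover have "(to_ac x + to_ac y * z) ^ q = to_ac x ^ q + (to_ac y * z) ^ q"
    unfolding q_def by (rule freshmans_dream_card[OF assms(1,2)]) simp
  ultimately show ?thesis
    by (simp add: power_mult_distrib q_def finite_field_power_card flip: to_ac_power)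
qed

definition nrm :: "'a::comm_ring_1 \<Rightarrow> 'a \<Rightarrow> 'a \<Rightarrow> 'a" where
  "nrm c x y = x ^ 2 - c * y ^ 2"

lemma nrm_eq_0_iff:
  fixes c :: "'a::field"
  assumes "\<nexists>x. x ^ 2 = c"
  shows "nrm c x y = 0 \<longleftrightarrow> x = 0 \<and> y = 0"
proof
  assume n: "nrm c x y = 0"
  have "y = 0"
  proof (rule ccontr)
    assume "y \<noteq> 0"
    then have "(x / y) ^ 2 = c" using n by (simp add: nrm_def field_simps)
    then show False using assms by blast
  qed
  then show "x = 0 \<and> y = 0" using n by (simp add: nrm_def)
qed (simp add: nrm_def)

lemma nrm_mult: "nrm c (x * x' + c * y * y') (x * y' + y * x') = nrm c x y * nrm c x' y'"
  by (simp add: nrm_def power2_eq_square algebra_simps)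

lemma nrm_minus [simp]: "nrm c x (- y) = nrm c x y" "nrm c (- x) y = nrm c x y"
  by (simp_all add: nrm_def)

text \<open>Pigeonhole: more than half of the field elements are squares, so the squares and the
  elements \<open>m + c * y ^ 2\<close> have one in common.\<close>

lemma nrm_surj:
  fixes c m :: "'a::{field,finite}"
  assumes c: "\<nexists>x. x ^ 2 = c"
  shows "\<exists>x y. nrm c x y = m"
proof (rule ccontr)
  assume none: "\<nexists>x y. nrm c x y = m"
  define S where "S = range (\<lambda>x :: 'a. x ^ 2)"
  define T where "T = (\<lambda>s. m + c * s) ` S"
  have "c \<noteq> 0" using c by (metis power_zero_numeral)
  then have "card T = card S" unfolding T_def by (intro card_image inj_onI) simp
  moreover have "S \<inter> T = {}"
  proof -
    have False if "x ^ 2 = m + c * y ^ 2" for x y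
      using none that by (metis add_diff_cancel_right' nrm_def)
    then show ?thesis by (auto simp: S_def T_def)
  qed
  then have "card S + card T = card (S \<union> T)" by (simp add: card_Un_disjoint)
  moreover have "card (S \<union> T) \<le> CARD('a)" by (simp add: card_mono)
  ultimately have le: "2 * card S \<le> CARD('a)" by simp
  have "CARD('a) = card (\<Union>s\<in>S. {x. x ^ 2 = s})"
    by (rule arg_cong[of _ _ card]) (auto simp: S_def)
  also have "\<dots> \<le> (\<Sum>s\<in>S. card {x. x ^ 2 = s})" by (rule card_UN_le) simp
  also have "\<dots> = card {x :: 'a. x ^ 2 = 0} + (\<Sum>s\<in>S - {0}. card {x. x ^ 2 = s})"
    by (rule sum.remove) (auto simp: S_def intro: image_eqI[of _ _ 0])
  also have "{x :: 'a. x ^ 2 = 0} = {0}" by auto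
  also have "(\<Sum>s\<in>S - {0}. card {x. x ^ 2 = s}) \<le> (\<Sum>s\<in>S - {0}. 2)"
  proof (rule sum_mono)
    fix s assume "s \<in> S - {0}"
    then obtain x where "s = x ^ 2" by (auto simp: S_def)
    then have "{y. y ^ 2 = s} = {x, - x}" by (auto simp: power2_eq_iff)
    then show "card {y. y ^ 2 = s} \<le> 2" by (simp add: card_insert_le_m1)
  qed
  also have "card {0 :: 'a} + (\<Sum>s\<in>S - {0}. 2) = 1 + 2 * (card S - 1)"
    by (subst card_Diff_singleton[symmetric]) (auto simp: S_def intro: image_eqI[of _ _ 0])
  finally have "CARD('a) \<le> 1 + 2 * (card S - 1)" by simp
  moreover have "card S > 0" by (simp add: card_gt_0_iff S_def)
  ultimately show False using le by linarith
qed

text \<open>Multiplication by an element of norm k identifies the fibre over 1 with the one over k.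
  The fibre over 0 is a point, so the common size N satisfies q^2 = 1 + (q - 1) N.\<close>

lemma card_nrm_fibre:
  fixes c m :: "'a::{field,finite}"
  assumes c: "\<nexists>x. x ^ 2 = c" and "m \<noteq> 0"
  shows "card {(x, y). nrm c x y = m} = CARD('a) + 1"
proof -
  define fib where "fib = (\<lambda>k. {(x, y). nrm c x y = k})"
  have same: "card (fib k) = card (fib 1)" if k: "k \<noteq> 0" for k
  proof -
    obtain x y where xy: "nrm c x y = k" using nrm_surj[OF c] by blast
    have "bij_betw (\<lambda>(u, v). (x * u + c * y * v, x * v + y * u)) (fib 1) (fib k)"
    proof (rule bij_betw_byWitness[of _ "\<lambda>(u, v). ((x * u - c * y * v) / k, (x * v - y * u) / k)"])
      have k2: "k = x * x - c * (y * y)" using xy by (simp add: nrm_def power2_eq_square)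
      have id1: "x * (x * u + c * y * v) - c * y * (x * v + y * u) = u * k"
          "x * (x * v + y * u) - y * (x * u + c * y * v) = v * k" for u v
        by (simp_all add: k2 algebra_simps)
      have "x * (x * u - c * y * v) + c * y * (x * v - y * u) = u * k"
          "x * (x * v - y * u) + y * (x * u - c * y * v) = v * k" for u v
        by (simp_all add: k2 algebra_simps)
      moreover have "a * (b / k) + d * (e / k) = (a * b + d * e) / k" for a b d e
        by (simp add: add_divide_distrib)
      ultimately have id2: "x * ((x * u - c * y * v) / k) + c * y * ((x * v - y * u) / k) = (u * k) / k"
          "x * ((x * v - y * u) / k) + y * ((x * u - c * y * v) / k) = (v * k) / k" for u v
        by (simp_all only:)
      show "\<forall>a\<in>fib 1. (\<lambda>(u, v). ((x * u - c * y * v) / k, (x * v - y * u) / k))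
          ((\<lambda>(u, v). (x * u + c * y * v, x * v + y * u)) a) = a"
        using k by (clarsimp simp only: id1 prod.case split_paired_all) simp
      show "\<forall>a\<in>fib k. (\<lambda>(u, v). (x * u + c * y * v, x * v + y * u))
          ((\<lambda>(u, v). ((x * u - c * y * v) / k, (x * v - y * u) / k)) a) = a"
        using k by (clarsimp simp only: id2 prod.case split_paired_all) simp
      show "(\<lambda>(u, v). (x * u + c * y * v, x * v + y * u)) ` fib 1 \<subseteq> fib k"
        by (auto simp: fib_def nrm_mult xy)
      have "nrm c ((x * u - c * y * v) / k) ((x * v - y * u) / k) = 1" if "nrm c u v = k" for u v
      proof -
        have "nrm c ((x * u - c * y * v) / k) ((x * v - y * u) / k) = nrm c (x * u + c * (- y) * v) (x * v + (- y) * u) / k ^ 2"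
          by (simp add: nrm_def power_divide diff_divide_distrib[symmetric])
        also have "\<dots> = 1" unfolding nrm_mult using xy that k by (simp add: power2_eq_square)
        finally show ?thesis .
      qed
      then show "(\<lambda>(u, v). ((x * u - c * y * v) / k, (x * v - y * u) / k)) ` fib k \<subseteq> fib 1"
        by (auto simp: fib_def)
    qed
    then show ?thesis by (rule bij_betw_same_card[symmetric])
  qed
  have "CARD('a) * CARD('a) = card (\<Union>k\<in>UNIV. fib k)"
  proof -
    have "(\<Union>k\<in>UNIV. fib k) = UNIV \<times> UNIV" by (auto simp: fib_def)
    then show ?thesis by (simp only: card_cartesian_product)
  qed
  also have "\<dots> = (\<Sum>k\<in>UNIV. card (fib k))"
    by (rule card_UN_disjoint) (auto simp: fib_def)
  also have "\<dots> = card (fib 0) + (\<Sum>k\<in>UNIV - {0}. card (fib k))"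
    by (rule sum.remove) auto
  also have "fib 0 = {(0, 0)}" by (auto simp: fib_def nrm_eq_0_iff[OF c])
  also have "(\<Sum>k\<in>UNIV - {0}. card (fib k)) = (\<Sum>k\<in>UNIV - {0 :: 'a}. card (fib 1))"
    by (rule sum.cong[OF HOL.refl], rule same) simp
  also have "\<dots> = (CARD('a) - 1) * card (fib 1)" by (simp add: card_Diff_singleton)
  finally have "CARD('a) * CARD('a) = 1 + (CARD('a) - 1) * card (fib 1)" by simp
  moreover have "CARD('a) \<ge> 2"
    using card_mono[of UNIV "{0, 1 :: 'a}"] by simp
  moreover have "k = n + 1" if "n * n = 1 + (n - 1) * k" "n \<ge> 2" for n k :: nat
  proof -
    from that(2) obtain r where n: "n = Suc (Suc r)" by (metis add_2_eq_Suc le_Suc_ex)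
    with \<open>n * n = 1 + (n - 1) * k\<close> have "Suc r * k = Suc r * (r + 3)" by (simp add: algebra_simps)
    then have "k = r + 3" unfolding mult_cancel1 by simp
    then show ?thesis using n by simp
  qed
  ultimately have "card (fib 1) = CARD('a) + 1" by blast
  then show ?thesis using same[OF assms(2)] by (simp add: fib_def)
qed


section \<open>Quaternions\<close>

subsection \<open>Reduced norm and the projective unit group\<close>

fun quat_conj :: "'k::field quat \<Rightarrow> 'k quat" where
  "quat_conj (Quat x0 x1 x2 x3) = Quat x0 (- x1) (- x2) (- x3)"

fun nrd :: "'k::field \<Rightarrow> 'k \<Rightarrow> 'k quat \<Rightarrow> 'k" where
  "nrd a b (Quat x0 x1 x2 x3) = nrm a x0 x1 - b * nrm a x2 x3"

fun quat_smult :: "'k::field \<Rightarrow> 'k quat \<Rightarrow> 'k quat" where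
  "quat_smult s (Quat x0 x1 x2 x3) = Quat (s * x0) (s * x1) (s * x2) (s * x3)"

lemma quat_mult_scalar [simp]:
  "quat_mult a b (quat_scalar s) x = quat_smult s x"
  "quat_mult a b x (quat_scalar s) = quat_smult s x"
  by (cases x; simp add: quat_scalar_def mult.commute)+

lemma quat_smult_simps [simp]:
  "quat_smult 1 x = x" "quat_smult s (quat_smult s' x) = quat_smult (s * s') x"
  "quat_smult s (quat_scalar s') = quat_scalar (s * s')"
  by (cases x; simp add: quat_scalar_def mult.assoc)+

lemma quat_mult_smult [simp]:
  "quat_mult a b (quat_smult s x) y = quat_smult s (quat_mult a b x y)"
  "quat_mult a b x (quat_smult s y) = quat_smult s (quat_mult a b x y)"
  by (cases x; cases y; simp add: algebra_simps)+

lemma quat_mult_assoc: "quat_mult a b (quat_mult a b x y) z = quat_mult a b x (quat_mult a b y z)"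
  by (cases x; cases y; cases z) (simp add: algebra_simps)

lemma quat_mult_conj:
  "quat_mult a b x (quat_conj x) = quat_scalar (nrd a b x)"
  "quat_mult a b (quat_conj x) x = quat_scalar (nrd a b x)"
  by (cases x; simp add: quat_scalar_def nrm_def algebra_simps power2_eq_square)+

lemma nrd_mult: "nrd a b (quat_mult a b x y) = nrd a b x * nrd a b y"
  by (cases x; cases y) (simp add: nrm_def algebra_simps power2_eq_square)

lemma nrd_simps [simp]:
  "nrd a b (quat_conj x) = nrd a b x" "nrd a b (quat_smult s x) = s ^ 2 * nrd a b x"
  "nrd a b (quat_scalar s) = s ^ 2"
  by (cases x; simp add: nrm_def quat_scalar_def algebra_simps power2_eq_square)+

lemma quat_units_iff: "x \<in> Units (quat_alg a b) \<longleftrightarrow> nrd a b x \<noteq> 0"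
proof
  assume "x \<in> Units (quat_alg a b)"
  then obtain y where "quat_mult a b x y = quat_scalar 1" by (auto simp: Units_def)
  then have "nrd a b x * nrd a b y = 1" by (metis nrd_mult nrd_simps(3) power_one)
  then show "nrd a b x \<noteq> 0" by auto
next
  assume n: "nrd a b x \<noteq> 0"
  show "x \<in> Units (quat_alg a b)"
    unfolding Units_def
    by (auto intro!: exI[of _ "quat_smult (inverse (nrd a b x)) (quat_conj x)"] simp: quat_mult_conj n)
qed

lemma PGL1_class_eq: "PGL1_class a b x = {quat_smult s x | s. s \<noteq> 0}"
  by (auto simp: PGL1_class_def r_coset_def nonzero_scalars_def units_of_def)

lemma PGL1_class_eq_iff:
  "PGL1_class a b x = PGL1_class a b y \<longleftrightarrow> (\<exists>s. s \<noteq> 0 \<and> x = quat_smult s y)"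
proof
  assume "PGL1_class a b x = PGL1_class a b y"
  moreover have "x \<in> PGL1_class a b x" unfolding PGL1_class_eq by (auto intro: exI[of _ 1])
  ultimately show "\<exists>s. s \<noteq> 0 \<and> x = quat_smult s y" by (auto simp: PGL1_class_eq)
next
  assume "\<exists>s. s \<noteq> 0 \<and> x = quat_smult s y"
  then obtain s where s: "s \<noteq> 0" "x = quat_smult s y" by blast
  have "z \<in> PGL1_class a b x \<longleftrightarrow> z \<in> PGL1_class a b y" for z
  proof
    assume "z \<in> PGL1_class a b y"
    then obtain r where "r \<noteq> 0" "z = quat_smult r y" by (auto simp: PGL1_class_eq)
    then show "z \<in> PGL1_class a b x"
      using s unfolding PGL1_class_eq by (auto intro!: exI[of _ "r / s"])
  qed (use s in \<open>auto simp: PGL1_class_eq\<close>)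
  then show "PGL1_class a b x = PGL1_class a b y" by blast
qed

lemma carrier_PGL1: "carrier (PGL1 a b) = PGL1_class a b ` {x. nrd a b x \<noteq> 0}"
  by (auto simp: PGL1_def FactGroup_def RCOSETS_def PGL1_class_def units_of_def quat_units_iff)

lemma one_PGL1: "\<one>\<^bsub>PGL1 a b\<^esub> = PGL1_class a b (quat_scalar 1)"
  by (auto simp: PGL1_def PGL1_class_eq nonzero_scalars_def)

lemma mult_PGL1:
  assumes "nrd a b x \<noteq> 0" "nrd a b y \<noteq> 0"
  shows "PGL1_class a b x \<otimes>\<^bsub>PGL1 a b\<^esub> PGL1_class a b y = PGL1_class a b (quat_mult a b x y)"
  using normal.rcos_sum[OF nonzero_scalars_normal[of a b], of x y] assms
  by (simp add: PGL1_def PGL1_class_def quat_units_iff units_of_def)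

lemma inv_PGL1:
  assumes "nrd a b x \<noteq> 0"
  shows "inv\<^bsub>PGL1 a b\<^esub> (PGL1_class a b x) = PGL1_class a b (quat_conj x)"
proof (rule group.inv_equality[OF group_PGL1])
  show "PGL1_class a b (quat_conj x) \<otimes>\<^bsub>PGL1 a b\<^esub> PGL1_class a b x = \<one>\<^bsub>PGL1 a b\<^esub>"
    unfolding one_PGL1 using assms
    by (subst mult_PGL1) (auto simp: quat_mult_conj PGL1_class_eq_iff intro!: exI[of _ "nrd a b x"])
qed (use assms in \<open>auto simp: carrier_PGL1\<close>)


subsection \<open>The constant subfield\<close>

definition rf :: "'a::field poly \<Rightarrow> 'a poly fract" where
  "rf p = Fract p 1"

lemma rf_simps [simp]:
  "rf (p + r) = rf p + rf r" "rf (p * r) = rf p * rf r" "rf (- p) = - rf p" "rf (p - r) = rf p - rf r"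
  "rf 0 = 0" "rf 1 = 1" "rf p = rf r \<longleftrightarrow> p = r" "rf p = 0 \<longleftrightarrow> p = 0"
  by (simp_all add: rf_def Zero_fract_def One_fract_def eq_fract)

lemma rf_power [simp]: "rf (p ^ n) = rf p ^ n"
  by (induction n) simp_all

lemma ratfun_const_rf: "ratfun_const x = rf [:x:]"
  and ratfun_t_rf: "ratfun_t = rf [:0, 1:]"
  by (simp_all add: ratfun_const_def ratfun_t_def rf_def)

lemma ratfun_const_simps [simp]:
  "ratfun_const (x + y) = ratfun_const x + ratfun_const y"
  "ratfun_const (x * y) = ratfun_const x * ratfun_const y"
  "ratfun_const (- x) = - ratfun_const x"
  "ratfun_const (x - y) = ratfun_const x - ratfun_const y"
  "ratfun_const 0 = 0" "ratfun_const 1 = 1"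
  "ratfun_const x = ratfun_const y \<longleftrightarrow> x = y" "ratfun_const x = 0 \<longleftrightarrow> x = 0"
proof -
  show "ratfun_const (x * y) = ratfun_const x * ratfun_const y"
    unfolding ratfun_const_rf rf_simps(2)[symmetric] by simp
  show "ratfun_const x = ratfun_const y \<longleftrightarrow> x = y" "ratfun_const x = 0 \<longleftrightarrow> x = 0"
    unfolding ratfun_const_rf by simp_all
qed (unfold ratfun_const_rf rf_simps(1,3-6)[symmetric], simp_all add: one_pCons)

lemma ratfun_const_power [simp]: "ratfun_const (x ^ n) = ratfun_const x ^ n"
  by (induction n) simp_all

lemma ratfun_const_divide [simp]: "ratfun_const (x / y) = ratfun_const x / ratfun_const y"
proof (cases "y = 0")
  case False
  then have "ratfun_const (x / y) * ratfun_const y = ratfun_const x"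
    unfolding ratfun_const_simps(2)[symmetric] by simp
  then show ?thesis using False by (simp add: eq_divide_eq)
qed simp

lemma D_b_rf: "(D_b :: 'a::field poly fract) = rf ([:0, 1:] * [:-1, 1:])"
proof -
  have "rf [:-1, 1:] = (ratfun_t - 1 :: 'a poly fract)"
    unfolding ratfun_t_rf rf_simps(6)[symmetric] rf_simps(4)[symmetric] by (simp add: one_pCons)
  then show ?thesis unfolding D_b_def rf_simps(2) ratfun_t_rf[symmetric] by simp
qed

definition zq :: "'a::field \<Rightarrow> 'a \<Rightarrow> 'a poly fract quat" where
  "zq x y = Quat (ratfun_const x) (ratfun_const y) 0 0"

lemma zq_eq_iff [simp]: "zq x y = zq x' y' \<longleftrightarrow> x = x' \<and> y = y'"
  by (simp add: zq_def)

lemma D_alg_mult [simp]: "x \<otimes>\<^bsub>D_alg c\<^esub> y = quat_mult (ratfun_const c) D_b x y"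
  and D_alg_add [simp]: "x \<oplus>\<^bsub>D_alg c\<^esub> y = quat_add x y"
  and D_alg_one [simp]: "\<one>\<^bsub>D_alg c\<^esub> = quat_scalar 1"
  and D_alg_zero [simp]: "\<zero>\<^bsub>D_alg c\<^esub> = quat_scalar 0"
  and D_alg_carrier [simp]: "carrier (D_alg c) = UNIV"
  by (simp_all add: D_alg_def)

lemma ring_D_alg: "ring (D_alg c)"
  unfolding D_alg_def by (rule ring_quat_alg)

lemma D_alg_uminus [simp]: "\<ominus>\<^bsub>D_alg c\<^esub> x = quat_smult (- 1) x"
proof -
  interpret ring "D_alg c" by (rule ring_D_alg)
  show ?thesis by (rule minus_equality) (cases x; simp add: quat_scalar_def)+
qed

lemma zq_simps [simp]:
  "quat_mult (ratfun_const c) D_b (zq x y) (zq x' y') = zq (x * x' + c * y * y') (x * y' + y * x')"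
  "quat_add (zq x y) (zq x' y') = zq (x + x') (y + y')"
  "quat_smult (- 1) (zq x y) = zq (- x) (- y)"
  "quat_scalar (ratfun_const x) = zq x 0"
  by (simp_all add: zq_def quat_scalar_def)

lemma D_alg_minus_zq [simp]: "zq x y \<ominus>\<^bsub>D_alg c\<^esub> zq x' y' = zq (x - x') (y - y')"
  by (simp add: a_minus_def)

lemma quat_scalar_1: "quat_scalar 1 = zq 1 0"
  by (simp add: zq_def quat_scalar_def)

lemma D_alg_pow [simp]:
  "x [^]\<^bsub>D_alg c\<^esub> (0 :: nat) = quat_scalar 1"
  "x [^]\<^bsub>D_alg c\<^esub> Suc n = quat_mult (ratfun_const c) D_b (x [^]\<^bsub>D_alg c\<^esub> n) x"
  by (simp_all add: nat_pow_def)

lemma zq_mult_commute: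
  "quat_mult (ratfun_const c) D_b (zq x y) (zq x' y') = quat_mult (ratfun_const c) D_b (zq x' y') (zq x y)"
  by (simp add: algebra_simps)

lemma zq_pow_in: "\<exists>u v. zq x y [^]\<^bsub>D_alg c\<^esub> (n :: nat) = zq u v"
  by (induction n) (auto simp: quat_scalar_1)

text \<open>The \<open>q\<close>-th power map on \<open>\<bbbF>\<^sub>q[Z]\<close> is computed in an algebraic closure of \<open>\<bbbF>\<^sub>q\<close>.\<close>

lemma zq_pow_card:
  fixes c x y :: "'a::{field,finite}"
  assumes "prime p" "CARD('a) = p ^ m" and c: "\<nexists>x. x ^ 2 = c"
  shows "zq x y [^]\<^bsub>D_alg c\<^esub> CARD('a) = zq x (- y)"
proof -
  obtain z :: "'a alg_closure" where z: "z ^ 2 = to_ac c"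
    using nth_root_exists[of 2 "to_ac c"] by auto
  have zr: "z \<notin> range to_ac" using c z by (metis imageE to_ac_eq_iff to_ac_power)
  have pow: "\<exists>u v. zq x y [^]\<^bsub>D_alg c\<^esub> n = zq u v \<and> to_ac u + to_ac v * z = (to_ac x + to_ac y * z) ^ n"
    for n :: nat
  proof (induction n)
    case 0
    show ?case by (intro exI[of _ 1] exI[of _ 0]) (simp add: quat_scalar_1)
  next
    case (Suc n)
    then obtain u v where uv: "zq x y [^]\<^bsub>D_alg c\<^esub> n = zq u v"
        "to_ac u + to_ac v * z = (to_ac x + to_ac y * z) ^ n" by blast
    have "(to_ac x + to_ac y * z) ^ Suc n = (to_ac u + to_ac v * z) * (to_ac x + to_ac y * z)"
      using uv(2) by simp
    also have "\<dots> = to_ac (u * x) + to_ac (v * y) * z ^ 2 + to_ac (u * y + v * x) * z"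
      by (simp add: algebra_simps power2_eq_square)
    finally have "(to_ac x + to_ac y * z) ^ Suc n = to_ac (u * x + c * v * y) + to_ac (u * y + v * x) * z"
      by (simp add: z algebra_simps)
    moreover have "zq x y [^]\<^bsub>D_alg c\<^esub> Suc n = zq (u * x + c * v * y) (u * y + v * x)"
      using uv(1) by simp
    ultimately show ?case by metis
  qed
  obtain u v where uv: "zq x y [^]\<^bsub>D_alg c\<^esub> CARD('a) = zq u v"
      "to_ac u + to_ac v * z = to_ac x - to_ac y * z"
    using pow[of "CARD('a)"] conj_power[OF assms z] by metis
  then have eq: "to_ac (v + y) * z = to_ac (x - u)" by (simp add: algebra_simps)
  have "v + y = 0"
  proof (rule ccontr)
    assume "v + y \<noteq> 0"
    then have "to_ac (v + y) \<noteq> 0" unfolding to_ac_eq_0_iff .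
    then have "z = to_ac (x - u) / to_ac (v + y)" by (simp only: eq[symmetric] nonzero_mult_div_cancel_left not_False_eq_True)
    then have "z = to_ac ((x - u) / (v + y))" by (simp only: to_ac_divide)
    then show False using zr by blast
  qed
  then have "v = - y" "u = x" using eq by (auto simp: add_eq_0_iff2)
  then show ?thesis using uv(1) by simp
qed

text \<open>The power w^(q + 1) is w times its conjugate, by \<open>zq_pow_card\<close>. From here
  on, pairs of constants replace powers in \<open>D\<close>.\<close>

lemma norm_set_eq:
  fixes c k :: "'a::{field,finite}"
  assumes "prime p" "CARD('a) = p ^ m" and c: "\<nexists>x. x ^ 2 = c"
  shows "norm_set c k = {zq x y | x y. nrm c x y = k}"
proof -
  have F: "FqZ = {zq x y | x y. True}" by (simp add: FqZ_def zq_def)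
  have P: "zq x y [^]\<^bsub>D_alg c\<^esub> (CARD('a) + 1) = zq (nrm c x y) 0" for x y
    using zq_pow_card[OF assms, of x y] by (simp add: nrm_def power2_eq_square)
  have "norm_set c k =
      {zq x y | x y. zq x y [^]\<^bsub>D_alg c\<^esub> (CARD('a) + 1) = quat_scalar (ratfun_const k)}"
    unfolding norm_set_def F by blast
  then show ?thesis by (simp only: P zq_simps(4) zq_eq_iff simp_thms)
qed

text \<open>Since w^q is the conjugate of w, the power w^(1 - q) is w divided by its conjugate, that
  is w^2 / N(w).\<close>

lemma zq_pow_1_minus_card:
  fixes c x y :: "'a::{field,finite}"
  assumes "prime p" "CARD('a) = p ^ m" and c: "\<nexists>x. x ^ 2 = c" and n: "nrm c x y \<noteq> 0"
  shows "zq x y [^]\<^bsub>D_alg c\<^esub> (1 - int CARD('a)) =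
    zq ((x * x + c * y * y) / nrm c x y) ((x * y + y * x) / nrm c x y)"
proof -
  interpret ring "D_alg c" by (rule ring_D_alg)
  define N where "N = nrm c x y"
  have q: "CARD('a) \<ge> 2" using card_mono[of UNIV "{0, 1 :: 'a}"] by simp
  \<comment> \<open>The negative power is the inverse of w^(q - 1), which is known only through the
    equation saying that w^(q - 1) times w is the conjugate of w.\<close>
  obtain u v where uv: "zq x y [^]\<^bsub>D_alg c\<^esub> (CARD('a) - 1) = zq u v" using zq_pow_in by blast
  have "Suc (CARD('a) - 1) = CARD('a)" using q by simp
  then have "zq x y [^]\<^bsub>D_alg c\<^esub> Suc (CARD('a) - 1) = zq x (- y)"
    using zq_pow_card[OF assms(1-3), of x y] by simp
  then have uv': "u * x + c * v * y = x" "u * y + v * x = - y"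
    unfolding D_alg_pow uv by simp_all
  have "inv\<^bsub>D_alg c\<^esub> (zq u v) = zq ((x * x + c * y * y) / N) ((x * y + y * x) / N)"
  proof (rule inv_char)
    have "u * (x * x + c * y * y) + c * v * (x * y + y * x) = (u * x + c * v * y) * x + c * (u * y + v * x) * y"
      by (simp add: algebra_simps)
    also have "\<dots> = x * x + c * (- y) * y" by (simp only: uv')
    also have "\<dots> = N" by (simp add: N_def nrm_def power2_eq_square)
    finally have 1: "u * (x * x + c * y * y) + c * v * (x * y + y * x) = N" .
    have "u * (x * y + y * x) + v * (x * x + c * y * y) = (u * x + c * v * y) * y + (u * y + v * x) * x"
      by (simp add: algebra_simps)
    also have "\<dots> = 0" by (simp only: uv') simp
    finally have 2: "u * (x * y + y * x) + v * (x * x + c * y * y) = 0" .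
    have 3: "N \<noteq> 0" using n by (simp add: N_def)
    have 4: "a * (b / N) + d * (e / N) = (a * b + d * e) / N" for a b d e by (simp add: add_divide_distrib)
    show "zq u v \<otimes>\<^bsub>D_alg c\<^esub> zq ((x * x + c * y * y) / N) ((x * y + y * x) / N) = \<one>\<^bsub>D_alg c\<^esub>"
      by (simp only: D_alg_mult D_alg_one quat_scalar_1 zq_simps zq_eq_iff 4 1 2) (simp add: 3)
    then show "zq ((x * x + c * y * y) / N) ((x * y + y * x) / N) \<otimes>\<^bsub>D_alg c\<^esub> zq u v = \<one>\<^bsub>D_alg c\<^esub>"
      by (simp only: D_alg_mult zq_mult_commute[of c _ _ u v])
  qed simp_all
  moreover have "1 - int CARD('a) < 0" "nat (- (1 - int CARD('a))) = CARD('a) - 1" using q by auto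
  ultimately show ?thesis
    unfolding int_pow_def2 N_def[symmetric] by (simp only: uv if_True)
qed


section \<open>The generators\<close>

text \<open>This is (tZ + wF)Z = ct - wZF for w = x + yZ. Its only nonzero scalar or Z-coordinate is
  ct, so conjugation just changes the sign of w; this makes the generators at w and -w inverse to
  each other in G(K).\<close>

definition gq :: "'a::field \<Rightarrow> 'a \<Rightarrow> 'a \<Rightarrow> 'a poly fract quat" where
  "gq c x y = Quat (ratfun_const c * ratfun_t) 0 (- ratfun_const (c * y)) (- ratfun_const x)"

lemma gen_elt_zq: "gen_elt c (zq x y) = GK_class c (gq c x y)"
  by (simp add: gen_elt_def gamma_elt_def gq_def zq_def quat_scalar_def quat_Z_def quat_F_def)

lemma quat_conj_gq: "quat_conj (gq c x y) = gq c (- x) (- y)"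
  by (simp add: gq_def)

lemma gq_mult:
  "quat_mult (ratfun_const c) D_b (gq c x y) (gq c u v) =
     Quat (ratfun_const c ^ 2 * ratfun_t ^ 2 - D_b * ratfun_const (c * (x * u - c * y * v)))
          (D_b * ratfun_const (c * (x * v - y * u)))
          (- ratfun_t * ratfun_const (c ^ 2 * (y + v)))
          (- ratfun_t * ratfun_const (c * (x + u)))"
  by (simp add: gq_def algebra_simps power2_eq_square)

lemma nrd_gq: "nrd (ratfun_const c) D_b (gq c x y) =
    ratfun_const c ^ 2 * ratfun_t ^ 2 + D_b * ratfun_const (c * nrm c x y)"
  by (simp add: gq_def nrm_def algebra_simps power2_eq_square)

lemma nrd_gq_a:
  assumes "nrm c x y = - c"
  shows "nrd (ratfun_const c) D_b (gq c x y) = ratfun_const (c ^ 2) * ratfun_t"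
  unfolding nrd_gq assms by (simp add: D_b_def algebra_simps power2_eq_square)

lemma nrd_gq_b:
  assumes "nrm c x y = c * \<tau> / (1 - \<tau>)" "\<tau> \<noteq> 1"
  shows "nrd (ratfun_const c) D_b (gq c x y) =
    ratfun_const (c ^ 2 / (1 - \<tau>)) * ratfun_t * (ratfun_t - ratfun_const \<tau>)"
proof -
  have n: "1 - ratfun_const \<tau> \<noteq> (0 :: 'a poly fract)"
    using assms(2) ratfun_const_simps(7)[of 1 \<tau>] by (simp del: ratfun_const_simps(7))
  show ?thesis unfolding nrd_gq assms using n
    by (simp add: D_b_def divide_simps) (simp add: algebra_simps power2_eq_square)
qed

text \<open>
  The products of two generators are equal as soon as \<open>\<xi> + \<eta> = \<lambda> + \<mu>\<close> and
  \<open>N(\<xi>, \<eta>) = N(\<lambda>, \<mu>)\<close> for the hermitian form \<open>N(\<xi>, \<eta>) = \<xi>\<^sup>q\<eta>\<close>.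
\<close>

lemma gq_relation:
  fixes c x y u v :: "'a::field"
  assumes n: "nrm c (u - x) (v - y) \<noteq> 0"
  defines "P \<equiv> ((u - x) * (u - x) + c * (v - y) * (v - y)) / nrm c (u - x) (v - y)"
    and "Q \<equiv> ((u - x) * (v - y) + (v - y) * (u - x)) / nrm c (u - x) (v - y)"
  shows "quat_mult (ratfun_const c) D_b (gq c x y) (gq c (u * P + c * (- v) * Q) (u * Q + (- v) * P)) =
         quat_mult (ratfun_const c) D_b (gq c u v) (gq c (x * P + c * (- y) * Q) (x * Q + (- y) * P))"
    and "nrm c (u * P + c * (- v) * Q) (u * Q + (- v) * P) = nrm c u v"
    and "nrm c (x * P + c * (- y) * Q) (x * Q + (- y) * P) = nrm c x y"
proof -
  define d e N where "d = u - x" and "e = v - y" and "N = nrm c d e"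
  have N: "N \<noteq> 0" "N = d * d - c * (e * e)"
    using n by (simp_all add: N_def d_def e_def nrm_def power2_eq_square)
  have PQ: "P = (d * d + c * e * e) / N" "Q = (d * e + e * d) / N"
    unfolding P_def Q_def N_def d_def e_def by simp_all
  have "nrm c P Q = (nrm c (d * d + c * e * e) (d * e + e * d)) / N ^ 2"
    by (simp add: PQ nrm_def power_divide diff_divide_distrib)
  also have "\<dots> = 1" unfolding nrm_mult N_def[symmetric] using N(1) by (simp add: power2_eq_square)
  finally have one: "nrm c P Q = 1" .
  show "nrm c (u * P + c * (- v) * Q) (u * Q + (- v) * P) = nrm c u v"
    "nrm c (x * P + c * (- y) * Q) (x * Q + (- y) * P) = nrm c x y"
    using nrm_mult[of c u P "- v" Q] nrm_mult[of c x P "- y" Q] by (simp_all add: one)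
  \<comment> \<open>With \<delta> = d + eZ, the pair (\<open>P\<close>, \<open>Q\<close>) represents
    \<delta>^(1 - q), and the claim is that the conjugate of \<delta> times \<delta>^(1 - q) is
    \<delta>. Hence \<eta> - \<mu> = \<lambda> - \<xi>, which is \<open>s1\<close> and
    \<open>s2\<close>.\<close>
  have k: "d * P - c * e * Q = d" "d * Q - e * P = e"
  proof -
    have "d * P - c * e * Q = (d * (d * d + c * e * e) - c * e * (d * e + e * d)) / N"
      by (simp add: PQ diff_divide_distrib)
    also have "d * (d * d + c * e * e) - c * e * (d * e + e * d) = d * N"
      by (simp add: N(2) algebra_simps)
    finally show "d * P - c * e * Q = d" using N(1) by simp
    have "d * Q - e * P = (d * (d * e + e * d) - e * (d * d + c * e * e)) / N"
      by (simp add: PQ diff_divide_distrib)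
    also have "d * (d * e + e * d) - e * (d * d + c * e * e) = e * N"
      by (simp add: N(2) algebra_simps)
    finally show "d * Q - e * P = e" using N(1) by simp
  qed
  have s1: "x + (u * P + c * (- v) * Q) = u + (x * P + c * (- y) * Q)"
    using k(1) by (simp add: d_def e_def algebra_simps)
  have s2: "y + (u * Q + (- v) * P) = v + (x * Q + (- y) * P)"
    using k(2) by (simp add: d_def e_def algebra_simps)
  \<comment> \<open>The two coordinates of the hermitian product: on both sides it is the conjugate
    of \<xi> times the conjugate of \<lambda> times the common factor \<delta>^(1 - q).\<close>
  have s3: "x * (u * P + c * (- v) * Q) - c * y * (u * Q + (- v) * P) =
      u * (x * P + c * (- y) * Q) - c * v * (x * Q + (- y) * P)"
    by (simp add: algebra_simps)
  have s4: "x * (u * Q + (- v) * P) - y * (u * P + c * (- v) * Q) =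
      u * (x * Q + (- y) * P) - v * (x * P + c * (- y) * Q)"
    by (simp add: algebra_simps)
  show "quat_mult (ratfun_const c) D_b (gq c x y) (gq c (u * P + c * (- v) * Q) (u * Q + (- v) * P)) =
         quat_mult (ratfun_const c) D_b (gq c u v) (gq c (x * P + c * (- y) * Q) (x * Q + (- y) * P))"
    unfolding gq_mult s1 s2 s3 s4 ..
qed


section \<open>Splittings\<close>

text \<open>The columns are the images of the basis vectors 1 and Z when the quaternion is written
  as (x0 + x1 Z) + (x2 + x3 Z) F.\<close>

fun split_mat :: "'k::field \<Rightarrow> 'k \<Rightarrow> 'k \<Rightarrow> 'k quat \<Rightarrow> 'k ^ 2 ^ 2" where
  "split_mat a w0 w1 (Quat x0 x1 x2 x3) =
     mat2 (x0 + (x2 * w0 + a * x3 * w1)) (a * (x1 - (x2 * w1 + x3 * w0)))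
          (x1 + (x2 * w1 + x3 * w0)) (x0 - (x2 * w0 + a * x3 * w1))"

text \<open>
  If \<open>b\<close> is the norm of \<open>w = w0 + w1 Z\<close>, then \<open>F = w\<sigma>\<close> for the conjugation \<open>\<sigma>\<close> of the quadratic
  extension satisfies \<open>F\<^sup>2 = b\<close>, so \<open>D\<close> acts on this extension.
\<close>

lemma split_mat_mult:
  assumes "b = nrm a w0 w1"
  shows "split_mat a w0 w1 (quat_mult a b x y) = split_mat a w0 w1 x ** split_mat a w0 w1 y"
  by (cases x; cases y) (simp add: assms nrm_def power2_eq_square, simp add: algebra_simps)

lemma split_mat_add: "split_mat a w0 w1 (quat_add x y) = split_mat a w0 w1 x + split_mat a w0 w1 y"
  by (cases x; cases y) (simp add: algebra_simps)

lemma split_mat_smult: "split_mat a w0 w1 (quat_smult s x) = mat s ** split_mat a w0 w1 x"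
  by (cases x) (simp add: mat_eq_mat2 algebra_simps)

lemma det_split_mat: "b = nrm a w0 w1 \<Longrightarrow> det (split_mat a w0 w1 x) = nrd a b x"
  by (cases x) (hypsubst, simp add: nrm_def power2_eq_square, simp add: algebra_simps)

lemma half_sum_diff:
  assumes "(2 :: 'k::field) \<noteq> 0"
  shows "(p + q) / 2 + (p - q) / 2 = (p :: 'k)" "(p + q) / 2 - (p - q) / 2 = (q :: 'k)"
proof -
  have "(p + q) / 2 + (p - q) / 2 = (2 * p) / 2" "(p + q) / 2 - (p - q) / 2 = (2 * q) / 2"
    by (simp_all flip: add_divide_distrib diff_divide_distrib)
  then show "(p + q) / 2 + (p - q) / 2 = p" "(p + q) / 2 - (p - q) / 2 = q"
    using assms by (metis nonzero_mult_div_cancel_left)+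
qed

lemma inj_split_mat:
  fixes a b w0 w1 :: "'k::field"
  assumes b: "b = nrm a w0 w1" and "b \<noteq> 0" "a \<noteq> 0" and 2: "(2 :: 'k) \<noteq> 0"
  shows "inj (split_mat a w0 w1)"
proof (rule injI)
  fix x y assume eq: "split_mat a w0 w1 x = split_mat a w0 w1 y"
  obtain x0 x1 x2 x3 where x: "x = Quat x0 x1 x2 x3" by (cases x)
  obtain y0 y1 y2 y3 where y: "y = Quat y0 y1 y2 y3" by (cases y)
  define v0 where "v0 = x2 * w0 + a * x3 * w1"
  define v1 where "v1 = x2 * w1 + x3 * w0"
  define u0 where "u0 = y2 * w0 + a * y3 * w1"
  define u1 where "u1 = y2 * w1 + y3 * w0"
  have "mat2 (x0 + v0) (a * (x1 - v1)) (x1 + v1) (x0 - v0) = mat2 (y0 + u0) (a * (y1 - u1)) (y1 + u1) (y0 - u0)"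
    using eq unfolding x y split_mat.simps v0_def v1_def u0_def u1_def .
  then have e: "x0 + v0 = y0 + u0" "x0 - v0 = y0 - u0" "x1 + v1 = y1 + u1" "x1 - v1 = y1 - u1"
    using \<open>a \<noteq> 0\<close> unfolding mat2_eq_iff mult_cancel_left by blast+
  have sum: "p = p'" "q = q'" if "p + q = p' + q'" "p - q = p' - q'" for p q p' q' :: 'k
  proof -
    have "2 * p = (p + q) + (p - q)" "2 * p' = (p' + q') + (p' - q')" by simp_all
    then have "2 * p = 2 * p'" by (simp only: that)
    then show "p = p'" using 2 unfolding mult_cancel_left by blast
    then show "q = q'" using that(1) by (metis add_left_imp_eq)
  qed
  have *: "x0 = y0" "v0 = u0" "x1 = y1" "v1 = u1" by (rule sum[OF e(1,2)] sum[OF e(3,4)])+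
  have "b * x2 = v0 * w0 - a * v1 * w1" "b * x3 = v1 * w0 - v0 * w1"
    unfolding b nrm_def v0_def v1_def power2_eq_square by (simp_all add: algebra_simps)
  moreover have "b * y2 = u0 * w0 - a * u1 * w1" "b * y3 = u1 * w0 - u0 * w1"
    unfolding b nrm_def u0_def u1_def power2_eq_square by (simp_all add: algebra_simps)
  ultimately have "b * x2 = b * y2" "b * x3 = b * y3" by (simp_all only: *)
  then have "x2 = y2" "x3 = y3" using \<open>b \<noteq> 0\<close> unfolding mult_cancel_left by blast+
  then show "x = y" by (simp only: x y *)
qed

lemma surj_split_mat:
  fixes a b w0 w1 :: "'k::field"
  assumes b: "b = nrm a w0 w1" and "b \<noteq> 0" "a \<noteq> 0" and 2: "(2 :: 'k) \<noteq> 0"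
  shows "\<exists>x. split_mat a w0 w1 x = mat2 p q r s"
proof -
  define q' where "q' = q / a"
  define v0 where "v0 = (p - s) / 2"
  define v1 where "v1 = (r - q') / 2"
  \<comment> \<open>x2 + x3 Z is v0 + v1 Z divided by w, computed as the product with the conjugate
    of w over its norm \<open>b\<close>.\<close>
  define x2 where "x2 = (v0 * w0 - a * v1 * w1) / b"
  define x3 where "x3 = (v1 * w0 - v0 * w1) / b"
  have b': "b = w0 * w0 - a * (w1 * w1)" by (simp add: b nrm_def power2_eq_square)
  have "x2 * w0 + a * x3 * w1 = (v0 * b) / b"
    unfolding x2_def x3_def times_divide_eq_left times_divide_eq_right add_divide_distrib[symmetric]
    by (rule arg_cong[of _ _ "\<lambda>z. z / b"]) (simp add: b' algebra_simps)
  then have v0: "x2 * w0 + a * x3 * w1 = v0" using \<open>b \<noteq> 0\<close> by simp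
  have "x2 * w1 + x3 * w0 = (v1 * b) / b"
    unfolding x2_def x3_def times_divide_eq_left times_divide_eq_right add_divide_distrib[symmetric]
    by (rule arg_cong[of _ _ "\<lambda>z. z / b"]) (simp add: b' algebra_simps)
  then have v1: "x2 * w1 + x3 * w0 = v1" using \<open>b \<noteq> 0\<close> by simp
  have "(p + s) / 2 + v0 = p" "(p + s) / 2 - v0 = s" "(r + q') / 2 + v1 = r" "(r + q') / 2 - v1 = q'"
    unfolding v0_def v1_def by (rule half_sum_diff[OF 2])+
  moreover have "a * q' = q" using \<open>a \<noteq> 0\<close> by (simp add: q'_def)
  ultimately have "split_mat a w0 w1 (Quat ((p + s) / 2) ((r + q') / 2) x2 x3) = mat2 p q r s"
    by (simp only: split_mat.simps v0 v1)
  then show ?thesis by blast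
qed

lemma is_splitting_split_mat:
  fixes a b w0 w1 :: "'a::field fls"
  assumes b: "b = nrm a w0 w1" and "b \<noteq> 0" "a \<noteq> 0" and 2: "(2 :: 'a fls) \<noteq> 0"
  shows "is_splitting a b (split_mat a w0 w1)"
proof -
  have "surj (split_mat a w0 w1)"
    unfolding surj_def using surj_split_mat[OF assms] by (metis mat2_cases)
  then have "bij (split_mat a w0 w1)"
    using inj_split_mat[OF assms] by (simp add: bij_def)
  then show ?thesis
    by (simp add: is_splitting_def split_mat_add split_mat_mult[OF b] quat_scalar_def mat_eq_mat2)
qed

text \<open>
  Skolem--Noether: \<open>G\<close> sends the standard basis to \<open>\<psi>(E\<^sub>1\<^sub>1) u\<close>, \<open>\<psi>(E\<^sub>2\<^sub>1) u\<close>,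
  where \<open>\<psi>(E\<^sub>1\<^sub>1) u \<noteq> 0\<close>.
\<close>

lemma matrix_automorphism_inner:
  fixes \<psi> :: "'k::field ^ 2 ^ 2 \<Rightarrow> 'k ^ 2 ^ 2"
  assumes add: "\<And>x y. \<psi> (x + y) = \<psi> x + \<psi> y" and mult: "\<And>x y. \<psi> (x ** y) = \<psi> x ** \<psi> y"
    and scal: "\<And>s. \<psi> (mat s) = mat s"
  obtains G where "det G \<noteq> 0" "\<And>A. \<psi> A ** G = G ** A"
proof -
  have *: "\<exists>v. A *v v \<noteq> 0" if "A \<noteq> 0" for A :: "'k ^ 2 ^ 2"
    using that by (metis matrix_eq matrix_vector_mult_0)
  have E0: "\<psi> (mat2 1 0 0 0) \<noteq> 0"
  proof
    assume 0: "\<psi> (mat2 1 0 0 0) = 0"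
    \<comment> \<open>The identity lies in the two-sided ideal generated by the first matrix
      unit.\<close>
    have "mat 1 = mat2 1 0 0 0 + mat2 0 0 1 0 ** mat2 1 0 0 0 ** mat2 0 (1 :: 'k) 0 0"
      by (simp add: mat_eq_mat2)
    then have "\<psi> (mat 1) = 0" by (simp only: add mult 0) simp
    then show False unfolding scal by (simp add: vec_eq_iff forall_2 mat_def)
  qed
  obtain u where "\<psi> (mat2 1 0 0 0) *v u \<noteq> 0" using *[OF E0] by blast
  define v where "v = \<psi> (mat2 1 0 0 0) *v u"
  define w where "w = \<psi> (mat2 0 0 1 0) *v u"
  define G where "G = mat2 (v $ 1) (w $ 1) (v $ 2) (w $ 2)"
  have v0: "v \<noteq> 0" unfolding v_def by fact
  have Gx: "G *v x = x $ 1 *s v + x $ 2 *s w" for x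
    by (simp add: G_def vec_eq_iff forall_2 matrix_vector_mult_def sum_2 mult.commute)
  have w': "\<psi> (mat2 0 0 1 0) *v v = w"
    unfolding v_def w_def by (simp add: matrix_vector_mul_assoc flip: mult)
  have ev: "\<psi> (mat2 a b c d) *v v = a *s v + c *s w" "\<psi> (mat2 a b c d) *v w = b *s v + d *s w" for a b c d
  proof -
    have "mat2 a b c d ** mat2 1 0 0 0 = mat a ** mat2 1 0 0 0 + mat c ** mat2 0 0 1 0"
      "mat2 a b c d ** mat2 0 0 1 0 = mat b ** mat2 1 0 0 0 + mat d ** mat2 0 0 1 0"
      by (simp_all add: mat_eq_mat2)
    then have "\<psi> (mat2 a b c d ** mat2 1 0 0 0) = \<psi> (mat a ** mat2 1 0 0 0 + mat c ** mat2 0 0 1 0)"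
      "\<psi> (mat2 a b c d ** mat2 0 0 1 0) = \<psi> (mat b ** mat2 1 0 0 0 + mat d ** mat2 0 0 1 0)"
      by simp_all
    then have "\<psi> (mat2 a b c d) ** \<psi> (mat2 1 0 0 0) = mat a ** \<psi> (mat2 1 0 0 0) + mat c ** \<psi> (mat2 0 0 1 0)"
      "\<psi> (mat2 a b c d) ** \<psi> (mat2 0 0 1 0) = mat b ** \<psi> (mat2 1 0 0 0) + mat d ** \<psi> (mat2 0 0 1 0)"
      unfolding add mult scal by blast+
    then show "\<psi> (mat2 a b c d) *v v = a *s v + c *s w" "\<psi> (mat2 a b c d) *v w = b *s v + d *s w"
      unfolding v_def w_def scale_eq_mat_mult
      by (simp_all only: matrix_vector_mul_assoc matrix_vector_mult_add_rdistrib[symmetric])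
  qed
  have comm: "\<psi> A ** G = G ** A" for A
  proof -
    obtain a b c d where A: "A = mat2 a b c d" by (cases A)
    have "(\<psi> A ** G) *v x = (G ** A) *v x" for x
    proof -
      have "\<psi> A *v (G *v x) = x $ 1 *s (\<psi> A *v v) + x $ 2 *s (\<psi> A *v w)"
        by (simp add: Gx matrix_vector_right_distrib vector_scalar_commute)
      also have "\<dots> = G *v (A *v x)"
        unfolding A ev Gx
        by (simp add: vec_eq_iff forall_2 matrix_vector_mult_def sum_2 algebra_simps)
      finally show ?thesis by (simp add: matrix_vector_mul_assoc)
    qed
    then show ?thesis by (simp add: matrix_eq)
  qed
  \<comment> \<open>If \<open>G ** adj2 G\<close> vanishes, so does \<open>G ** A ** adj2 G\<close>
    for every \<open>A\<close>. For the matrix unit \<open>mat2 0 1 0 0\<close> its entries are, up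
    to sign, the products of two coordinates of \<open>v\<close>, which forces
    \<open>v = 0\<close>.\<close>
  have "det G \<noteq> 0"
  proof
    assume 0: "det G = 0"
    have "G ** (A ** adj2 G) = 0" for A
    proof -
      have "G ** (A ** adj2 G) = \<psi> A ** (G ** adj2 G)" by (metis comm matrix_mul_assoc)
      also have "\<dots> = \<psi> A ** mat 0" by (simp only: adj2_mult 0)
      also have "\<dots> = 0" by (simp add: vec_eq_iff forall_2 mat_def matrix_matrix_mult_def sum_2)
      finally show ?thesis .
    qed
    then have G0: "G ** (mat2 a b c d ** adj2 G) = 0" for a b c d by blast
    have G: "G = mat2 (v $ 1) (w $ 1) (v $ 2) (w $ 2)" by (simp add: G_def)
    have z: "0 = (mat2 0 0 0 0 :: 'k ^ 2 ^ 2)" by (simp add: vec_eq_iff forall_2)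
    have "v $ 1 = 0 \<and> v $ 2 = 0"
      using G0[of 1 0 0 0] G0[of 0 1 0 0] by (auto simp: G z)
    then show False using v0 by (simp add: vec_eq_iff forall_2)
  qed
  then show thesis using comm that by blast
qed


section \<open>The action at one place\<close>

text \<open>The coset consists of the scalar multiples of \<open>x\<close>; the hypothesis turns
  these into homotheties, and a class of lattices absorbs them.\<close>

lemma bt_act_vx:
  assumes "\<And>s. s \<noteq> 0 \<Longrightarrow> \<exists>t. t \<noteq> 0 \<and> R (quat_smult s x) = mat t ** R x"
  shows "bt_act R (PGL1_class a b x) (vx B) = vx (R x ** B)"
proof -
  have "bt_act R (PGL1_class a b x) (vx B) =
      {lat (R (quat_smult s x) ** (mat r ** B)) | s r. s \<noteq> 0 \<and> r \<noteq> 0}"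
    unfolding bt_act_def PGL1_class_eq by (auto simp: mem_vx lat_mult)
  also have "\<dots> = {lat (mat r ** (R x ** B)) | r. r \<noteq> 0}"
  proof (intro subset_antisym subsetI)
    fix L assume "L \<in> {lat (R (quat_smult s x) ** (mat r ** B)) | s r. s \<noteq> 0 \<and> r \<noteq> 0}"
    then obtain s r where sr: "s \<noteq> 0" "r \<noteq> 0" "L = lat (R (quat_smult s x) ** (mat r ** B))" by blast
    obtain t where t: "t \<noteq> 0" "R (quat_smult s x) = mat t ** R x" using assms sr(1) by blast
    have "R (quat_smult s x) ** (mat r ** B) = mat (t * r) ** (R x ** B)"
      unfolding t(2) by (metis mat_mat_mult mat_mult_commute matrix_mul_assoc)
    then show "L \<in> {lat (mat r ** (R x ** B)) | r. r \<noteq> 0}" using sr t(1) by auto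
  next
    fix L assume "L \<in> {lat (mat r ** (R x ** B)) | r. r \<noteq> 0}"
    then obtain r where r: "r \<noteq> 0" "L = lat (mat r ** (R x ** B))" by blast
    have "mat r ** (R x ** B) = R (quat_smult 1 x) ** (mat r ** B)"
      by (metis quat_smult_simps(1) mat_mult_commute matrix_mul_assoc)
    then show "L \<in> {lat (R (quat_smult s x) ** (mat r ** B)) | s r. s \<noteq> 0 \<and> r \<noteq> 0}"
      using r one_neq_zero by (smt (verit, best) mem_Collect_eq)
  qed
  finally show ?thesis by (auto simp: mem_vx)
qed

lemma val_ring_half:
  fixes p q :: "'a::field fls"
  assumes "(2 :: 'a) \<noteq> 0" "p + q \<in> val_ring" "p - q \<in> val_ring"
  shows "p \<in> val_ring" "q \<in> val_ring"
proof -
  have dbl: "fls_const 2 * r = r + r" for r :: "'a fls"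
  proof -
    have "fls_const 2 * r = fls_const (1 + 1) * r" by simp
    also have "\<dots> = r + r" unfolding fls_plus_const[symmetric] distrib_right by simp
    finally show ?thesis .
  qed
  have unit: "fls_const (2 :: 'a) \<noteq> 0" "fls_subdegree (fls_const (2 :: 'a)) = 0"
    by (rule fls_const_nonzero[OF assms(1)]) simp
  have "(p + q) + (p - q) = fls_const 2 * p" "(p + q) - (p - q) = fls_const 2 * q"
    unfolding dbl by simp_all
  then have "fls_const 2 * p \<in> val_ring" "fls_const 2 * q \<in> val_ring"
    using val_ring_add[OF assms(2,3)] val_ring_diff[OF assms(2,3)] by simp_all
  then show "p \<in> val_ring" "q \<in> val_ring"
    unfolding val_ring_unit_mult_iff(1)[OF unit] by simp_all
qed

text \<open>
  A place at which \<open>D\<close> splits: \<open>X\<^sup>2\<^sup>k t(t-1)\<close> is the norm of the unit \<open>w0 + w1 Z\<close>.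
  We have \<open>k = 0\<close> for \<open>t = \<tau>\<close>, and \<open>k = 1\<close> for \<open>t = \<infinity>\<close>.
\<close>

locale place =
  fixes c :: "'a::{field,finite}" and emb :: "'a poly fract \<Rightarrow> 'a fls" and k :: int
    and w0 w1 :: "'a fls"
  assumes nonsquare: "\<nexists>x. x ^ 2 = c"
    and emb_1: "emb 1 = 1" and emb_add: "emb (x + y) = emb x + emb y"
    and emb_mult: "emb (x * y) = emb x * emb y" and emb_const: "emb (ratfun_const u) = fls_const u"
    and emb_t: "fls_subdegree (emb ratfun_t) = - k"
    and w: "w0 \<in> val_ring" "w1 \<in> val_ring"
    and nrm_w: "nrm (fls_const c) w0 w1 \<noteq> 0" "fls_subdegree (nrm (fls_const c) w0 w1) = 0"
    and emb_D_b: "emb D_b = Xp (- 2 * k) * nrm (fls_const c) w0 w1"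
begin

lemma emb_0 [simp]: "emb 0 = 0"
  using emb_add[of 0 0] unfolding add_0_left by (metis add_cancel_right_right)

lemma emb_uminus: "emb (- x) = - emb x"
  using emb_add[of x "- x"] by (simp add: eq_neg_iff_add_eq_0 add.commute)

lemma emb_diff: "emb (x - y) = emb x - emb y"
  using emb_add[of x "- y"] by (simp add: emb_uminus)

lemma emb_power: "emb (x ^ n) = emb x ^ n"
  by (induction n) (simp_all add: emb_1 emb_mult)

lemma emb_eq_0_iff [simp]: "emb x = 0 \<longleftrightarrow> x = 0"
proof
  assume "emb x = 0"
  then have "emb (x * inverse x) = 0" by (simp add: emb_mult)
  then show "x = 0" using emb_1 by (cases "x = 0") auto
qed simp

lemmas emb_simps = emb_1 emb_add emb_mult emb_const emb_uminus emb_diff emb_power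

lemma c_nonzero: "c \<noteq> 0"
  using nonsquare by (metis power_zero_numeral)

definition rep :: "'a poly fract quat \<Rightarrow> 'a fls ^ 2 ^ 2" where
  "rep x = split_mat (fls_const c) (Xp (- k) * w0) (Xp (- k) * w1) (map_quat emb x)"

lemma emb_D_b': "emb D_b = nrm (fls_const c) (Xp (- k) * w0) (Xp (- k) * w1)"
proof -
  have "nrm (fls_const c) (Xp (- k) * w0) (Xp (- k) * w1) = (Xp (- k) * Xp (- k)) * nrm (fls_const c) w0 w1"
    by (simp add: nrm_def power2_eq_square algebra_simps)
  then show ?thesis by (simp add: emb_D_b Xp_mult)
qed

lemma rep_mult: "rep (quat_mult (ratfun_const c) D_b x y) = rep x ** rep y"
proof -
  have "map_quat emb (quat_mult (ratfun_const c) D_b x y) =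
      quat_mult (fls_const c) (emb D_b) (map_quat emb x) (map_quat emb y)"
    by (cases x; cases y) (simp add: emb_simps)
  then show ?thesis by (simp only: rep_def split_mat_mult[OF emb_D_b'])
qed

lemma map_quat_smult: "map_quat emb (quat_smult s x) = quat_smult (emb s) (map_quat emb x)"
  by (cases x) (simp add: emb_simps)

lemma rep_smult: "rep (quat_smult s x) = mat (emb s) ** rep x"
  by (simp add: rep_def map_quat_smult split_mat_smult)

lemma rep_scalar: "rep (quat_scalar s) = mat (emb s)"
  by (simp add: rep_def quat_scalar_def mat_eq_mat2)

lemma det_rep: "det (rep x) = emb (nrd (ratfun_const c) D_b x)"
proof -
  have "nrd (fls_const c) (emb D_b) (map_quat emb x) = emb (nrd (ratfun_const c) D_b x)"
    by (cases x) (simp add: nrm_def emb_simps)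
  then show ?thesis by (simp add: rep_def det_split_mat[OF emb_D_b'])
qed

lemma is_splitting_rep:
  "is_splitting (emb (ratfun_const c)) (emb D_b) (split_mat (fls_const c) (Xp (- k) * w0) (Xp (- k) * w1))"
  unfolding emb_const
proof (rule is_splitting_split_mat[OF emb_D_b'])
  show "emb D_b \<noteq> 0" unfolding emb_D_b using nrm_w by simp
  show "fls_const c \<noteq> 0" using c_nonzero by (rule fls_const_nonzero)
  have "fls_const (2 :: 'a) \<noteq> 0" using two_neq_0_of_nonsquare[OF nonsquare] by (rule fls_const_nonzero)
  moreover have "fls_const (2 :: 'a) = 2" by (metis fls_plus_const fls_const_1 one_add_one)
  ultimately show "(2 :: 'a fls) \<noteq> 0" by metis
qed

text \<open>The order preserving the standard lattice is spanned by 1, Z, X^k F and X^k ZF: since 2,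
  \<open>c\<close> and the norm of w0 + w1 Z are units, integrality of the matrix can be read off
  the coordinates. Concrete statements about the base vertex all go through this criterion.\<close>

lemma int_mat_rep:
  "int_mat (mat s ** rep (Quat x0 x1 x2 x3)) \<longleftrightarrow>
    s * emb x0 \<in> val_ring \<and> s * emb x1 \<in> val_ring \<and>
    s * (Xp (- k) * emb x2) \<in> val_ring \<and> s * (Xp (- k) * emb x3) \<in> val_ring"
proof -
  define C where "C = fls_const c"
  have C: "C \<in> val_ring" "C \<noteq> 0" "fls_subdegree C = 0"
    using c_nonzero by (auto simp: C_def fls_const_nonzero)
  define y0 where "y0 = s * emb x0"
  define y1 where "y1 = s * emb x1"
  define y2 where "y2 = s * (Xp (- k) * emb x2)"
  define y3 where "y3 = s * (Xp (- k) * emb x3)"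
  define v0 where "v0 = y2 * w0 + C * y3 * w1"
  define v1 where "v1 = y2 * w1 + y3 * w0"
  have "mat s ** rep (Quat x0 x1 x2 x3) = mat2 (y0 + v0) (C * (y1 - v1)) (y1 + v1) (y0 - v0)"
    unfolding rep_def v0_def v1_def y0_def y1_def y2_def y3_def C_def[symmetric]
    by (simp add: mat_eq_mat2 algebra_simps)
  then have "int_mat (mat s ** rep (Quat x0 x1 x2 x3)) \<longleftrightarrow>
      y0 + v0 \<in> val_ring \<and> y1 - v1 \<in> val_ring \<and> y1 + v1 \<in> val_ring \<and> y0 - v0 \<in> val_ring"
    using C by simp
  also have "\<dots> \<longleftrightarrow> y0 \<in> val_ring \<and> y1 \<in> val_ring \<and> v0 \<in> val_ring \<and> v1 \<in> val_ring"
    using val_ring_half[OF two_neq_0_of_nonsquare[OF nonsquare]] by (blast intro: val_ring_add val_ring_diff)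
  also have "v0 \<in> val_ring \<and> v1 \<in> val_ring \<longleftrightarrow> y2 \<in> val_ring \<and> y3 \<in> val_ring"
  proof
    assume v: "v0 \<in> val_ring \<and> v1 \<in> val_ring"
    have "nrm C w0 w1 * y2 = v0 * w0 - C * v1 * w1" "nrm C w0 w1 * y3 = v1 * w0 - v0 * w1"
      by (simp_all add: v0_def v1_def nrm_def power2_eq_square algebra_simps)
    moreover have "v0 * w0 - C * v1 * w1 \<in> val_ring" "v1 * w0 - v0 * w1 \<in> val_ring"
      using v w C by (auto intro!: val_ring_diff val_ring_mult)
    ultimately have "nrm C w0 w1 * y2 \<in> val_ring" "nrm C w0 w1 * y3 \<in> val_ring" by simp_all
    then show "y2 \<in> val_ring \<and> y3 \<in> val_ring" using nrm_w by (simp add: C_def)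
  next
    assume "y2 \<in> val_ring \<and> y3 \<in> val_ring"
    then show "v0 \<in> val_ring \<and> v1 \<in> val_ring"
      unfolding v0_def v1_def using w C by (auto intro!: val_ring_add val_ring_mult)
  qed
  finally show ?thesis unfolding y0_def y1_def y2_def y3_def .
qed

lemma int_mat_rep_gq: "int_mat (mat (Xp k) ** rep (gq c x y))"
proof -
  have "Xp k * (fls_const c * emb ratfun_t) \<in> val_ring"
    using c_nonzero emb_t by (cases "ratfun_t = (0 :: 'a poly fract)") (simp_all add: val_ring_iff fls_const_nonzero)
  then show ?thesis
    by (simp add: gq_def int_mat_rep emb_simps val_ring_mult del: ratfun_const_simps)
qed

lemma vx_rep_gq:
  assumes "nrd (ratfun_const c) D_b (gq c x y) \<noteq> 0"
  shows "2 * k + fls_subdegree (emb (nrd (ratfun_const c) D_b (gq c x y))) = 0 \<Longrightarrow>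
      vx (rep (gq c x y)) = vx (mat 1)"
    and "2 * k + fls_subdegree (emb (nrd (ratfun_const c) D_b (gq c x y))) = 1 \<Longrightarrow>
      bt_adjacent (vx (mat 1)) (vx (rep (gq c x y)))"
proof -
  have d: "det (rep (gq c x y)) \<noteq> 0" using assms by (simp add: det_rep)
  show "vx (rep (gq c x y)) = vx (mat 1)"
    if "2 * k + fls_subdegree (emb (nrd (ratfun_const c) D_b (gq c x y))) = 0"
    unfolding vx_eq_1_iff[OF d] by (rule exI[of _ "Xp k"]) (use that int_mat_rep_gq in \<open>simp add: det_rep\<close>)
  show "bt_adjacent (vx (mat 1)) (vx (rep (gq c x y)))"
    if "2 * k + fls_subdegree (emb (nrd (ratfun_const c) D_b (gq c x y))) = 1"
    unfolding bt_adjacent_1_vx[OF d] by (rule exI[of _ "Xp k"]) (use that int_mat_rep_gq in \<open>simp add: det_rep\<close>)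
qed

text \<open>Up to a scalar \<open>quat_conj x\<close> is the inverse of \<open>x\<close>, so
  \<open>quat_conj x\<close> times \<open>y\<close> fixes the base vertex. Its reduced norm has
  valuation 2n, which pins the homothety factor down to a unit times X^(-n).\<close>

lemma vx_rep_eq:
  assumes "vx (rep x) = vx (rep y)" "nrd (ratfun_const c) D_b x \<noteq> 0" "nrd (ratfun_const c) D_b y \<noteq> 0"
    and "fls_subdegree (emb (nrd (ratfun_const c) D_b x)) = n"
    and "fls_subdegree (emb (nrd (ratfun_const c) D_b y)) = n"
  shows "int_mat (mat (Xp (- n)) ** rep (quat_mult (ratfun_const c) D_b (quat_conj x) y))"
proof -
  define z where "z = quat_mult (ratfun_const c) D_b (quat_conj x) y"
  have "det (rep (quat_conj x)) \<noteq> 0" using assms by (simp add: det_rep)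
  then have "vx (rep (quat_conj x) ** rep x) = vx (rep z)"
    using assms(1) by (simp add: vx_mult_eq_iff z_def rep_mult)
  moreover have "rep (quat_conj x) ** rep x = mat (emb (nrd (ratfun_const c) D_b x)) ** mat 1"
    by (simp add: rep_mult[symmetric] quat_mult_conj rep_scalar)
  ultimately have "vx (rep z) = vx (mat 1)" using assms(2) by (simp only: vx_scale emb_eq_0_iff not_False_eq_True)
  moreover have "nrd (ratfun_const c) D_b z = nrd (ratfun_const c) D_b x * nrd (ratfun_const c) D_b y"
    by (simp add: z_def nrd_mult)
  then have d: "det (rep z) \<noteq> 0" "fls_subdegree (det (rep z)) = 2 * n"
    using assms by (simp_all add: det_rep emb_mult)
  ultimately obtain s where s: "s \<noteq> 0" "int_mat (mat s ** rep z)" "fls_subdegree s = - n"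
    unfolding vx_eq_1_iff[OF d(1)] by auto
  obtain u where u: "s = Xp (- n) * u" "u \<noteq> 0" "fls_subdegree u = 0" using Xp_decomp[OF s(1)] s(3) by auto
  obtain z0 z1 z2 z3 where z: "z = Quat z0 z1 z2 z3" by (cases z)
  have "(Xp (- n) * u) * f \<in> val_ring \<longleftrightarrow> Xp (- n) * f \<in> val_ring" for f
    using val_ring_unit_mult_iff(1)[OF u(2,3), of "Xp (- n) * f"] by (simp add: ac_simps)
  then show ?thesis
    using s(2) unfolding z_def[symmetric] z int_mat_rep u(1) by simp
qed

text \<open>In the product of the conjugate of the first element with the second, the F- and
  ZF-coordinates are t times constant multiples of the differences \<open>v - y\<close> and
  \<open>u - x\<close>. After the rescaling of \<open>vx_rep_eq\<close> such a coordinate has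
  valuation -1 unless it is 0, so integrality makes it vanish.\<close>

lemma gq_inj:
  assumes eq: "vx (rep (gq c x y)) = vx (rep (gq c u v))"
    and nz: "nrd (ratfun_const c) D_b (gq c x y) \<noteq> 0" "nrd (ratfun_const c) D_b (gq c u v) \<noteq> 0"
    and "fls_subdegree (emb (nrd (ratfun_const c) D_b (gq c x y))) = 1 - 2 * k"
    and "fls_subdegree (emb (nrd (ratfun_const c) D_b (gq c u v))) = 1 - 2 * k"
  shows "x = u \<and> y = v"
proof -
  have t: "ratfun_t \<noteq> (0 :: 'a poly fract)" by (simp add: ratfun_t_rf)
  obtain T where T: "emb ratfun_t = Xp (- k) * T" "T \<noteq> 0" "fls_subdegree T = 0"
    using Xp_decomp[of "emb ratfun_t"] t emb_t by auto
  have int: "int_mat (mat (Xp (- (1 - 2 * k))) ** rep (quat_mult (ratfun_const c) D_b (gq c (- x) (- y)) (gq c u v)))"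
    using vx_rep_eq[OF eq nz assms(4,5)] by (simp add: quat_conj_gq)
  have X: "Xp (- (1 - 2 * k)) * (Xp (- k) * (- (Xp (- k) * T) * fls_const e)) = - (T * (Xp (- 1) * fls_const e))" for e
  proof -
    have "Xp (- (1 - 2 * k)) * (Xp (- k) * (- (Xp (- k) * T) * fls_const e)) =
      - (T * ((Xp (- (1 - 2 * k)) * (Xp (- k) * Xp (- k))) * fls_const e))" by (simp add: ac_simps)
    then show ?thesis by (simp add: Xp_mult)
  qed
  have "c ^ 2 * (- y + v) = 0" "c * (- x + u) = 0"
    using int unfolding gq_mult int_mat_rep emb_mult emb_const emb_uminus T(1) X
    unfolding val_ring_uminus val_ring_unit_mult_iff(1)[OF T(2,3)] const_div_X by blast+
  then show ?thesis using c_nonzero by simp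
qed

end


subsection \<open>The two places\<close>

text \<open>Solves r^2 = f with constant term 1: the coefficient of X^n in r^2 is twice the unknown
  one plus the terms in the sum.\<close>

fun sqrt_coeff :: "(nat \<Rightarrow> 'a::field) \<Rightarrow> nat \<Rightarrow> 'a" where
  "sqrt_coeff f n =
     (if n = 0 then 1 else (f n - (\<Sum>i = 1..<n. sqrt_coeff f i * sqrt_coeff f (n - i))) / 2)"

declare sqrt_coeff.simps [simp del]

lemma fps_sqrt_exists:
  fixes f :: "'a::field fps"
  assumes "fps_nth f 0 = 1" and 2: "(2 :: 'a) \<noteq> 0"
  shows "\<exists>r. fps_nth r 0 = 1 \<and> r * r = f"
proof (intro exI conjI)
  define s where "s = sqrt_coeff (fps_nth f)"
  define r where "r = Abs_fps s"
  have s0: "s 0 = 1" unfolding s_def by (simp add: sqrt_coeff.simps)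
  then show "fps_nth r 0 = 1" by (simp add: r_def)
  show "r * r = f"
  proof (rule fps_ext)
    fix n show "fps_nth (r * r) n = fps_nth f n"
    proof (cases "n = 0")
      case True
      then show ?thesis using assms by (simp add: r_def s0)
    next
      case False
      have sn: "s n = (fps_nth f n - (\<Sum>i = 1..<n. s i * s (n - i))) / 2"
        unfolding s_def by (subst sqrt_coeff.simps) (simp add: False)
      have "{0..n} = insert 0 (insert n {1..<n})" using False by auto
      then have "fps_nth (r * r) n = s n + s n + (\<Sum>i = 1..<n. s i * s (n - i))"
        using False by (simp add: fps_mult_nth r_def s0 add.assoc)
      also have "s n + s n = 2 * s n" by (simp only: mult_2)
      also have "\<dots> = fps_nth f n - (\<Sum>i = 1..<n. s i * s (n - i))" using 2 by (simp add: sn)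
      finally show ?thesis by simp
    qed
  qed
qed

text \<open>The constant \<tau>(\<tau> - 1) is a norm from the quadratic extension, and t(t - 1)
  divided by it is a power series in t - \<tau> with constant term 1, hence a square. The product of
  an element of that norm with the square root serves as w.\<close>

lemma place_tau:
  fixes c \<tau> :: "'a::{field,finite}"
  assumes c: "\<nexists>x. x ^ 2 = c" and \<tau>: "\<tau> \<noteq> 0" "\<tau> \<noteq> 1"
  shows "\<exists>w0 w1. place c (embed_at \<tau>) 0 w0 w1"
proof -
  define f where "f = fps_const (1 / (\<tau> * (\<tau> - 1))) * ((fps_const \<tau> + fps_X) * (fps_const (\<tau> - 1) + fps_X))"
  have nz: "\<tau> * (\<tau> - 1) \<noteq> 0" using \<tau> by simp
  have "fps_nth f 0 = 1" using nz by (simp add: f_def)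
  then obtain r where r: "fps_nth r 0 = 1" "r * r = f"
    using fps_sqrt_exists two_neq_0_of_nonsquare[OF c] by blast
  obtain u0 u1 where u: "nrm c u0 u1 = \<tau> * (\<tau> - 1)" using nrm_surj[OF c] by blast
  define w0 where "w0 = fls_const u0 * fps_to_fls r"
  define w1 where "w1 = fls_const u1 * fps_to_fls r"
  have "nrm (fls_const c) w0 w1 = fls_const (nrm c u0 u1) * (fps_to_fls r * fps_to_fls r)"
    by (simp add: w0_def w1_def nrm_def power2_eq_square algebra_simps
        flip: fls_const_mult_const fls_minus_const)
  also have "fps_to_fls r * fps_to_fls r = fps_to_fls f" by (simp add: r(2) flip: fls_times_fps_to_fls)
  also have "fls_const (nrm c u0 u1) * fps_to_fls f =
      fps_to_fls (fps_const (\<tau> * (\<tau> - 1)) * f)" by (simp add: u fls_times_fps_to_fls)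
  also have "fps_const (\<tau> * (\<tau> - 1)) * f = (fps_const \<tau> + fps_X) * (fps_const (\<tau> - 1) + fps_X)"
  proof -
    have "fps_const (\<tau> * (\<tau> - 1)) * fps_const (1 / (\<tau> * (\<tau> - 1))) = 1"
      unfolding fps_const_mult using nz by simp
    then show ?thesis unfolding f_def mult.assoc[symmetric] by simp
  qed
  also have "fps_to_fls \<dots> = (fls_const \<tau> + fls_X) * (fls_const (\<tau> - 1) + fls_X)"
    by (simp add: fls_times_fps_to_fls)
  finally have n: "nrm (fls_const c) w0 w1 = (fls_const \<tau> + fls_X) * (fls_const (\<tau> - 1) + fls_X)" .
  have sub: "fls_const x + fls_X \<noteq> 0 \<and> fls_subdegree (fls_const x + fls_X) = 0" if "x \<noteq> 0" for x :: 'a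
  proof -
    have "fls_nth (fls_const x + fls_X) 0 \<noteq> 0" using that by simp
    moreover have "fls_subdegree (fls_const x + fls_X) = 0"
      by (rule fls_subdegree_eqI) (use that in auto)
    ultimately show ?thesis by (metis fls_zero_nth)
  qed
  have b: "embed_at \<tau> D_b = (fls_const \<tau> + fls_X) * (fls_const (\<tau> - 1) + fls_X)"
  proof -
    have "embed_at \<tau> (- 1) = fls_const (- 1)"
      using embed_at_hom(4)[of \<tau> "- 1"] by simp
    then have "embed_at \<tau> (ratfun_t - 1) = fls_const \<tau> + fls_X + fls_const (- 1)"
      using embed_at_hom(2)[of \<tau> ratfun_t "- 1"] by (simp add: embed_at_hom)
    also have "\<dots> = fls_const (\<tau> - 1) + fls_X" by (simp flip: fls_minus_const)
    finally show ?thesis unfolding D_b_def by (simp only: embed_at_hom)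
  qed
  have "place c (embed_at \<tau>) 0 w0 w1"
  proof
    show "fls_subdegree (embed_at \<tau> ratfun_t) = - 0" using sub[OF \<tau>(1)] by (simp add: embed_at_hom)
    show "w0 \<in> val_ring" "w1 \<in> val_ring"
      unfolding w0_def w1_def by (intro val_ring_mult val_ring_simps; simp add: val_ring_def)+
    have "\<tau> - 1 \<noteq> 0" using \<tau> by simp
    then show "nrm (fls_const c) w0 w1 \<noteq> 0" "fls_subdegree (nrm (fls_const c) w0 w1) = 0"
      unfolding n using sub[OF \<tau>(1)] sub[of "\<tau> - 1"] by simp_all
    show "embed_at \<tau> D_b = Xp (- 2 * 0) * nrm (fls_const c) w0 w1" by (simp add: n b)
  qed (fact c, simp_all add: embed_at_hom)
  then show ?thesis by blast
qed

text \<open>With X = 1/t one has t(t - 1) = X^(-2) (1 - X), and 1 - X is itself a square, so the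
  Z-part of w can be 0.\<close>

lemma place_infinity:
  fixes c :: "'a::{field,finite}"
  assumes c: "\<nexists>x. x ^ 2 = c"
  shows "\<exists>w0 w1. place c embed_infinity 1 w0 w1"
proof -
  obtain r :: "'a fps" where r: "fps_nth r 0 = 1" "r * r = 1 - fps_X"
    using fps_sqrt_exists[of "1 - fps_X :: 'a fps"] two_neq_0_of_nonsquare[OF c] by auto
  define w0 where "w0 = fps_to_fls r"
  have "nrm (fls_const c) w0 0 = fps_to_fls (r * r)"
    by (simp add: w0_def nrm_def power2_eq_square fls_times_fps_to_fls)
  then have n: "nrm (fls_const c) w0 0 = 1 - fls_X" by (simp add: r)
  have nz: "(1 - fls_X :: 'a fls) \<noteq> 0" "fls_subdegree (1 - fls_X :: 'a fls) = 0"
  proof -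
    have "fls_nth (1 - fls_X :: 'a fls) 0 \<noteq> 0" by simp
    then show "(1 - fls_X :: 'a fls) \<noteq> 0" by (metis fls_zero_nth)
    show "fls_subdegree (1 - fls_X :: 'a fls) = 0" by (rule fls_subdegree_eqI) auto
  qed
  have Xi: "fls_X_inv = (Xp (- 1) :: 'a fls)" by (simp add: Xp_def fls_X_inv_conv_shift_1)
  have b: "embed_infinity D_b = Xp (- 2) * (1 - fls_X :: 'a fls)"
  proof -
    have "embed_infinity (- 1 :: 'a poly fract) = - 1"
      using embed_infinity_hom(4)[of "- 1 :: 'a"] by simp
    then have "embed_infinity (ratfun_t - 1 :: 'a poly fract) = Xp (- 1) - 1"
      using embed_infinity_hom(2)[of ratfun_t "- 1 :: 'a poly fract"] by (simp add: embed_infinity_hom Xi)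
    also have "\<dots> = Xp (- 1) * (1 - Xp 1)" by (simp only: right_diff_distrib Xp_mult) simp
    finally show ?thesis unfolding D_b_def embed_infinity_hom Xi by (simp add: Xp_mult_assoc)
  qed
  have "place c embed_infinity 1 w0 0"
  proof
    show "w0 \<in> val_ring" by (simp add: w0_def val_ring_def)
    show "embed_infinity D_b = Xp (- 2 * 1) * nrm (fls_const c) w0 0" by (simp add: n b)
    show "nrm (fls_const c) w0 0 \<noteq> 0" "fls_subdegree (nrm (fls_const c) w0 0) = 0"
      unfolding n by (rule nz)+
  qed (fact c, simp_all add: embed_infinity_hom)
  then show ?thesis by blast
qed


section \<open>Presentations and simply transitive actions\<close>

lemma simply_transitive_actionI:
  assumes act: "group_action G E \<phi>" and e: "e \<in> E"
    and trans: "\<And>y. y \<in> E \<Longrightarrow> \<exists>g\<in>carrier G. \<phi> g e = y"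
    and stab: "\<And>g. g \<in> carrier G \<Longrightarrow> \<phi> g e = e \<Longrightarrow> g = \<one>\<^bsub>G\<^esub>"
  shows "simply_transitive_action G E \<phi>"
proof -
  interpret group_action G E \<phi> by (rule act)
  interpret group G using group_hom group_hom.axioms(1) by blast
  have comp: "\<phi> (g \<otimes>\<^bsub>G\<^esub> h) x = \<phi> g (\<phi> h x)" if "g \<in> carrier G" "h \<in> carrier G" "x \<in> E" for g h x
    using composition_rule[OF that(3,1,2)] by simp
  have "\<exists>!g. g \<in> carrier G \<and> \<phi> g x = y" if x: "x \<in> E" and y: "y \<in> E" for x y
  proof -
    obtain h k where h: "h \<in> carrier G" "\<phi> h e = x" and k: "k \<in> carrier G" "\<phi> k e = y"
      using trans x y by blast
    have he: "\<phi> (inv\<^bsub>G\<^esub> h) x = e"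
      using orbit_sym_aux[OF h(1) e] h(2) by simp
    show ?thesis
    proof (rule ex1I[of _ "k \<otimes>\<^bsub>G\<^esub> inv\<^bsub>G\<^esub> h"])
      show "k \<otimes>\<^bsub>G\<^esub> inv\<^bsub>G\<^esub> h \<in> carrier G \<and> \<phi> (k \<otimes>\<^bsub>G\<^esub> inv\<^bsub>G\<^esub> h) x = y"
        using h k x he by (simp add: comp)
      fix g assume g: "g \<in> carrier G \<and> \<phi> g x = y"
      have ky: "\<phi> (inv\<^bsub>G\<^esub> k) y = e"
        using orbit_sym_aux[OF k(1) e] k(2) by simp
      have "\<phi> (inv\<^bsub>G\<^esub> k \<otimes>\<^bsub>G\<^esub> (g \<otimes>\<^bsub>G\<^esub> h)) e = e"
        using g h k e x ky by (simp add: comp)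
      then have "inv\<^bsub>G\<^esub> k \<otimes>\<^bsub>G\<^esub> (g \<otimes>\<^bsub>G\<^esub> h) = \<one>\<^bsub>G\<^esub>"
        using stab g h k by simp
      moreover have "k \<otimes>\<^bsub>G\<^esub> (inv\<^bsub>G\<^esub> k \<otimes>\<^bsub>G\<^esub> (g \<otimes>\<^bsub>G\<^esub> h)) = g \<otimes>\<^bsub>G\<^esub> h"
        using g h k by (simp add: m_assoc[symmetric])
      ultimately have "g \<otimes>\<^bsub>G\<^esub> h = k" using k by simp
      then show "g = k \<otimes>\<^bsub>G\<^esub> inv\<^bsub>G\<^esub> h" using g h k inv_solve_right by blast
    qed
  qed
  then show ?thesis using act by (simp add: simply_transitive_action_def)
qed

definition letter_val :: "('h, 'm) monoid_scheme \<Rightarrow> ('g \<Rightarrow> 'h) \<Rightarrow> 'g \<times> bool \<Rightarrow> 'h" where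
  "letter_val G e = (\<lambda>(s, b). if b then e s else inv\<^bsub>G\<^esub> e s)"

definition word_val :: "('h, 'm) monoid_scheme \<Rightarrow> ('g \<Rightarrow> 'h) \<Rightarrow> 'g word \<Rightarrow> 'h" where
  "word_val G e u = foldr (\<lambda>l h. letter_val G e l \<otimes>\<^bsub>G\<^esub> h) u \<one>\<^bsub>G\<^esub>"

lemma word_val_simps [simp]:
  "word_val G e [] = \<one>\<^bsub>G\<^esub>" "word_val G e (l # u) = letter_val G e l \<otimes>\<^bsub>G\<^esub> word_val G e u"
  by (simp_all add: word_val_def)

context group
begin

lemma letter_val_closed: "e ` S \<subseteq> carrier G \<Longrightarrow> l \<in> S \<times> UNIV \<Longrightarrow> letter_val G e l \<in> carrier G"
  by (auto simp: letter_val_def split: if_splits)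

lemma word_val_closed: "e ` S \<subseteq> carrier G \<Longrightarrow> u \<in> lists (S \<times> UNIV) \<Longrightarrow> word_val G e u \<in> carrier G"
  by (induction u) (auto intro!: m_closed letter_val_closed[of e S])

lemma word_val_append:
  assumes "e ` S \<subseteq> carrier G" "u \<in> lists (S \<times> UNIV)" "v \<in> lists (S \<times> UNIV)"
  shows "word_val G e (u @ v) = word_val G e u \<otimes> word_val G e v"
  using assms(2)
proof (induction u)
  case (Cons l u)
  then show ?case
    using letter_val_closed[OF assms(1), of l] word_val_closed[OF assms(1)] assms(3) by (simp add: m_assoc)
qed (use word_val_closed[OF assms(1,3)] in simp)

lemma word_val_pres_eq:
  assumes e: "e ` S \<subseteq> carrier G" and R: "R \<subseteq> lists (S \<times> UNIV) \<times> lists (S \<times> UNIV)"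
    and rel: "\<And>u v. (u, v) \<in> R \<Longrightarrow> word_val G e u = word_val G e v"
    and "pres_eq S R u v"
  shows "word_val G e u = word_val G e v"
  using assms(4)
proof induction
  case (cancel s b)
  then show ?case using e by (cases b) (auto simp: letter_val_def)
next
  case (append u v u' v')
  then show ?case
    using pres_eq_lists[OF R append.hyps(1)] pres_eq_lists[OF R append.hyps(2)]
    by (simp add: word_val_append[OF e])
qed (use rel in auto)

lemma word_val_generate:
  assumes e: "e ` S \<subseteq> carrier G" and "g \<in> generate G (e ` S)"
  shows "\<exists>u\<in>lists (S \<times> UNIV). word_val G e u = g"
  using assms(2)
proof induction
  case one
  show ?case by (rule bexI[of _ "[]"]) auto
next
  case (incl h)
  then obtain s where "s \<in> S" "h = e s" by blast
  then show ?case using e by (intro bexI[of _ "[(s, True)]"]) (auto simp: letter_val_def)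
next
  case (inv h)
  then obtain s where "s \<in> S" "h = e s" by blast
  then show ?case using e by (intro bexI[of _ "[(s, False)]"]) (auto simp: letter_val_def)
next
  case (eng h1 h2)
  then obtain u v where "u \<in> lists (S \<times> UNIV)" "word_val G e u = h1" "v \<in> lists (S \<times> UNIV)" "word_val G e v = h2"
    by blast
  then show ?case by (intro bexI[of _ "u @ v"]) (auto simp: word_val_append[OF e])
qed

lemma word_val_in_generate:
  assumes "u \<in> lists (S \<times> UNIV)"
  shows "word_val G e u \<in> generate G (e ` S)"
  using assms
proof (induction u)
  case (Cons l u)
  obtain s b where l: "l = (s, b)" "s \<in> S" using Cons.hyps by (cases l) auto
  then have "letter_val G e l \<in> generate G (e ` S)"
    by (auto simp: letter_val_def intro: generate.incl generate.inv)
  then show ?case using Cons.IH by (simp add: generate.eng)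
qed (simp add: generate.one)

text \<open>The isomorphism evaluates an arbitrarily chosen word of each class; \<open>rel\<close>
  makes the choice harmless. Injectivity is tested on the kernel, where \<open>ker\<close>
  applies.\<close>

lemma has_finite_presentationI:
  assumes fin: "finite S" "finite R" and R: "R \<subseteq> lists (S \<times> UNIV) \<times> lists (S \<times> UNIV)"
    and e: "e ` S \<subseteq> carrier G"
    and rel: "\<And>u v. (u, v) \<in> R \<Longrightarrow> word_val G e u = word_val G e v"
    and ker: "\<And>u. u \<in> lists (S \<times> UNIV) \<Longrightarrow> word_val G e u = \<one> \<Longrightarrow> pres_eq S R u []"
  shows "has_finite_presentation (G\<lparr>carrier := generate G (e ` S)\<rparr>) S R e"
proof -
  let ?P = "presented_group S R" and ?H = "G\<lparr>carrier := generate G (e ` S)\<rparr>"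
  interpret P: group ?P by (rule group_presented_group)
  have sub: "subgroup (generate G (e ` S)) G" using e by (rule generate_is_subgroup)
  interpret H: group ?H using sub by (rule subgroup_imp_group)
  define h where "h = (\<lambda>C. word_val G e (SOME u. u \<in> C))"
  have h: "h (pres_class S R u) = word_val G e u" if u: "u \<in> lists (S \<times> UNIV)" for u
  proof -
    have "u \<in> pres_class S R u" using pres_eq.refl[OF u] by (simp add: pres_class_def)
    then have "(SOME v. v \<in> pres_class S R u) \<in> pres_class S R u" by (rule someI)
    then show ?thesis
      unfolding h_def by (simp add: pres_class_def word_val_pres_eq[OF e R rel, symmetric])
  qed
  have car: "carrier ?P = pres_class S R ` lists (S \<times> UNIV)" by (simp add: presented_group_def)
  have hom: "h \<in> hom ?P ?H"
  proof (rule homI)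
    fix x assume "x \<in> carrier ?P"
    then obtain u where "u \<in> lists (S \<times> UNIV)" "x = pres_class S R u" by (auto simp only: car)
    then show "h x \<in> carrier ?H" using word_val_in_generate[of u S e] by (simp only: h) simp
    fix y assume "y \<in> carrier ?P"
    with \<open>x \<in> carrier ?P\<close> obtain u v where uv: "u \<in> lists (S \<times> UNIV)" "v \<in> lists (S \<times> UNIV)"
        "x = pres_class S R u" "y = pres_class S R v" by (auto simp only: car)
    then have "u @ v \<in> lists (S \<times> UNIV)" by simp
    then show "h (x \<otimes>\<^bsub>?P\<^esub> y) = h x \<otimes>\<^bsub>?H\<^esub> h y"
      using uv by (simp add: presented_group_mult h word_val_append[OF e] del: append_in_lists_conv)
  qed
  then interpret hh: group_hom ?P ?H h by unfold_locales
  have "inj_on h (carrier ?P)"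
    unfolding hh.inj_on_one_iff
  proof (intro allI impI)
    fix x assume x: "x \<in> carrier ?P" "h x = \<one>\<^bsub>?H\<^esub>"
    then obtain u where u: "u \<in> lists (S \<times> UNIV)" "x = pres_class S R u" by (auto simp only: car)
    then have "word_val G e u = \<one>" using x(2) by (simp only: h) simp
    then show "x = \<one>\<^bsub>?P\<^esub>" unfolding u(2) using pres_class_eq[OF ker[OF u(1)]] by (simp add: presented_group_def)
  qed
  moreover have "h ` carrier ?P = carrier ?H"
  proof
    show "carrier ?H \<subseteq> h ` carrier ?P"
    proof
      fix g assume "g \<in> carrier ?H"
      then obtain u where "u \<in> lists (S \<times> UNIV)" "word_val G e u = g"
        using word_val_generate[OF e, of g] by auto
      then show "g \<in> h ` carrier ?P" unfolding car
        by (intro image_eqI[where x = "pres_class S R u"]) (simp_all only: h imageI)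
    qed
  qed (use hom in \<open>auto simp: hom_def\<close>)
  ultimately have "h \<in> iso ?P ?H" using hom by (simp add: iso_def bij_betw_def)
  moreover have "h (pres_class S R [(s, True)]) = e s" if "s \<in> S" for s
    using that e by (subst h) (auto simp: letter_val_def)
  ultimately show ?thesis
    unfolding has_finite_presentation_def using fin R by blast
qed

end


section \<open>Reduced words move the base vertex\<close>

abbreviation gqp :: "'a::field \<Rightarrow> 'a \<times> 'a \<Rightarrow> 'a poly fract quat" where
  "gqp c a \<equiv> gq c (fst a) (snd a)"

definition qprod :: "'a::field \<Rightarrow> ('a \<times> 'a) list \<Rightarrow> 'a poly fract quat" where
  "qprod c xs = foldr (\<lambda>a q. quat_mult (ratfun_const c) D_b (gqp c a) q) xs (quat_scalar 1)"

lemma qprod_simps [simp]: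
  "qprod c [] = quat_scalar 1"
  "qprod c (a # xs) = quat_mult (ratfun_const c) D_b (gqp c a) (qprod c xs)"
  by (simp_all add: qprod_def)

lemma qprod_append: "qprod c (xs @ ys) = quat_mult (ratfun_const c) D_b (qprod c xs) (qprod c ys)"
  by (induction xs) (simp_all add: quat_mult_assoc)

text \<open>The letters at \<open>a\<close> and \<open>- a\<close> are inverse to each other, so
  this is freeness from cancellation for words in positive letters.\<close>

definition reduced :: "('a::field \<times> 'a) list \<Rightarrow> bool" where
  "reduced xs \<longleftrightarrow> successively (\<lambda>a b. b \<noteq> - a) xs"

lemma nrd_qprod:
  assumes "\<And>a. a \<in> S \<Longrightarrow> nrd (ratfun_const c) D_b (gqp c a) \<noteq> 0" "xs \<in> lists S"
  shows "nrd (ratfun_const c) D_b (qprod c xs) \<noteq> 0"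
  using assms(2) by (induction xs) (use assms(1) in \<open>simp_all add: nrd_mult\<close>)

context place
begin

lemma vx_mult_cong: "det A \<noteq> 0 \<Longrightarrow> vx B = vx (mat 1) \<Longrightarrow> vx (A ** B) = vx A"
  by (metis matrix_mul_rid vx_mult_eq_iff)

lemma vx_rep_qprod_fixed:
  assumes "\<And>a. a \<in> S \<Longrightarrow> nrd (ratfun_const c) D_b (gqp c a) \<noteq> 0"
    and "\<And>a. a \<in> S \<Longrightarrow> 2 * k + fls_subdegree (emb (nrd (ratfun_const c) D_b (gqp c a))) = 0"
    and "xs \<in> lists S"
  shows "vx (rep (qprod c xs)) = vx (mat 1)"
  using assms(3)
proof (induction xs)
  case Nil
  show ?case by (simp add: rep_scalar emb_1)
next
  case (Cons a xs)
  have "det (rep (gqp c a)) \<noteq> 0" using Cons.hyps assms(1) by (simp add: det_rep)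
  then show ?case
    using vx_mult_cong[of "rep (gqp c a)" "rep (qprod c xs)"] Cons vx_rep_gq(1)[OF assms(1,2)]
    by (simp add: rep_mult)
qed

text \<open>Used with \<open>NA\<close> at t = infinity, where \<open>k = 1\<close> and the
  valuation of the norm is -1, and with \<open>NB\<close> at t = \<tau>, where \<open>k = 0\<close>
  and it is 1.\<close>

context
  fixes S :: "('a \<times> 'a) set"
  assumes nz: "a \<in> S \<Longrightarrow> nrd (ratfun_const c) D_b (gqp c a) \<noteq> 0"
    and deg: "a \<in> S \<Longrightarrow> fls_subdegree (emb (nrd (ratfun_const c) D_b (gqp c a))) = 1 - 2 * k"
    and neg: "a \<in> S \<Longrightarrow> - a \<in> S"
begin

lemma adjacent_gqp: "a \<in> S \<Longrightarrow> bt_adjacent (vx (mat 1)) (vx (rep (gqp c a)))"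
  using vx_rep_gq(2)[OF nz] deg by simp

lemma inj_vx_gqp: "a \<in> S \<Longrightarrow> b \<in> S \<Longrightarrow> vx (rep (gqp c a)) = vx (rep (gqp c b)) \<Longrightarrow> a = b"
  using gq_inj[of "fst a" "snd a" "fst b" "snd b"] nz deg by (simp add: prod_eq_iff)

lemma det_rep_qprod: "xs \<in> lists S \<Longrightarrow> det (rep (qprod c xs)) \<noteq> 0"
  using nrd_qprod[of S c xs] nz by (simp add: det_rep)

lemma vx_rep_gqp_mult:
  assumes "a \<in> S" "b \<in> S" "vx (rep (gqp c a) ** rep (gqp c b)) = vx (mat 1)"
  shows "b = - a"
proof -
  have d: "det (rep (gqp c a)) \<noteq> 0" using nz[OF assms(1)] by (simp add: det_rep)
  have "gqp c (- a) = quat_conj (gqp c a)" by (simp add: quat_conj_gq)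
  then have eq: "rep (gqp c a) ** rep (gqp c (- a)) = mat (emb (nrd (ratfun_const c) D_b (gqp c a))) ** mat 1"
    by (simp add: rep_mult[symmetric] quat_mult_conj rep_scalar)
  have "vx (rep (gqp c a) ** rep (gqp c (- a))) = vx (mat 1)"
    unfolding eq by (rule vx_scale) (simp add: nz[OF assms(1)])
  then have "vx (rep (gqp c a) ** rep (gqp c b)) = vx (rep (gqp c a) ** rep (gqp c (- a)))"
    unfolding assms(3) by (rule HOL.sym)
  then have "vx (rep (gqp c b)) = vx (rep (gqp c (- a)))"
    unfolding vx_mult_eq_iff[OF d] .
  then show ?thesis by (rule inj_vx_gqp[OF assms(2) neg[OF assms(1)]])
qed

text \<open>The path visits the images of the base vertex under the prefixes of the word: a prefix
  acts as an automorphism of the tree and moves the edge from the base vertex to its image under the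
  next letter. By \<open>vx_rep_gqp_mult\<close> a backtracking would mean that two consecutive
  letters cancel.\<close>

lemma reduced_word_moves:
  assumes xs: "xs \<in> lists S" and red: "reduced xs" and fixed: "vx (rep (qprod c xs)) = vx (mat 1)"
  shows "xs = []"
proof (rule ccontr)
  assume ne: "xs \<noteq> []"
  define v where "v = (\<lambda>i. vx (rep (qprod c (take i xs))))"
  define path where "path = map v [0..<Suc (length xs)]"
  have S: "xs ! i \<in> S" if "i < length xs" for i using xs that by (auto simp: in_lists_conv_set)
  have tk: "take i xs \<in> lists S" for i using xs by (auto simp: in_lists_conv_set dest: in_set_takeD)
  have step: "rep (qprod c (take (Suc i) xs)) = rep (qprod c (take i xs)) ** rep (gqp c (xs ! i))"
    if "i < length xs" for i
    using that by (simp add: take_Suc_conv_app_nth qprod_append rep_mult rep_scalar emb_1)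
  have adj: "bt_adjacent (v i) (v (Suc i))" if "i < length xs" for i
    unfolding v_def step[OF that]
    using bt_adjacent_mult[OF det_rep_qprod[OF tk], of i "mat 1"] adjacent_gqp[OF S[OF that]] by simp
  have nb: "v (Suc (Suc i)) \<noteq> v i" if "Suc i < length xs" for i
  proof
    assume "v (Suc (Suc i)) = v i"
    then have "vx (rep (qprod c (take i xs)) ** (rep (gqp c (xs ! i)) ** rep (gqp c (xs ! Suc i)))) =
        vx (rep (qprod c (take i xs)) ** mat 1)"
      using that by (simp add: v_def step matrix_mul_assoc)
    then have "xs ! Suc i = - (xs ! i)"
      unfolding vx_mult_eq_iff[OF det_rep_qprod[OF tk]]
      using that by (intro vx_rep_gqp_mult S) auto
    then show False
      using red that by (auto simp: reduced_def successively_conv_nth)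
  qed
  have "simple_path bt_vertices bt_adjacent (hd path) (last path) path"
  proof (rule nonbacktracking_imp_simple_path[OF bt_regular_tree])
    show "successively bt_adjacent path"
      using adj by (auto simp: successively_conv_nth path_def simp del: upt_Suc)
    have "v i \<in> bt_vertices" for i unfolding v_def by (rule vx_in[OF det_rep_qprod[OF tk]])
    then show "set path \<subseteq> bt_vertices" unfolding path_def by auto
    show "path ! (i + 2) \<noteq> path ! i" if "i + 2 < length path" for i
      using nb[of i] that by (simp add: path_def del: upt_Suc)
  qed (simp add: path_def)
  then have "distinct path" by (simp add: simple_path_def)
  then have "v 0 \<noteq> v (length xs)"
    using ne nth_eq_iff_index_eq[of path 0 "length xs"] by (simp add: path_def del: upt_Suc)
  then show False using fixed by (simp add: v_def rep_scalar emb_1)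
qed

text \<open>By injectivity and the count q + 1 the images of the base vertex under \<open>S\<close>
  are all its neighbours. The group elements reached so far transport this to every vertex along a
  path.\<close>

lemma words_transitive:
  assumes card: "card S = CARD('a) + 1" and v: "v \<in> bt_vertices"
  shows "\<exists>xs\<in>lists S. v = vx (rep (qprod c xs))"
proof -
  have T: "regular_tree (CARD('a) + 1) (bt_vertices :: ('a fls ^ 2) set set set) bt_adjacent"
    by (rule bt_regular_tree)
  have one: "vx (mat 1) \<in> (bt_vertices :: ('a fls ^ 2) set set set)" by simp
  have nbrs: "{w \<in> bt_vertices. bt_adjacent (vx (mat 1)) w} = (\<lambda>a. vx (rep (gqp c a))) ` S"
  proof (rule card_subset_eq[symmetric])
    show "finite {w \<in> bt_vertices. bt_adjacent (vx (mat 1 :: 'a fls ^ 2 ^ 2)) w}"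
      using T one by (simp add: regular_tree_def)
    have "inj_on (\<lambda>a. vx (rep (gqp c a))) S" using inj_vx_gqp by (auto intro: inj_onI)
    then show "card ((\<lambda>a. vx (rep (gqp c a))) ` S) = card {w \<in> bt_vertices. bt_adjacent (vx (mat 1 :: 'a fls ^ 2 ^ 2)) w}"
      using T one card by (simp add: regular_tree_def card_image)
    show "(\<lambda>a. vx (rep (gqp c a))) ` S \<subseteq> {w \<in> bt_vertices. bt_adjacent (vx (mat 1)) w}"
      using adjacent_gqp nz by (auto simp: det_rep)
  qed
  have step: "\<exists>ys\<in>lists S. w = vx (rep (qprod c ys))"
    if xs: "xs \<in> lists S" and w: "w \<in> bt_vertices" "bt_adjacent (vx (rep (qprod c xs))) w" for xs w
  proof -
    define M where "M = rep (qprod c xs)"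
    have M: "det M \<noteq> 0" using det_rep_qprod[OF xs] by (simp add: M_def)
    obtain B where B: "det B \<noteq> 0" "w = vx B" using w(1) by (auto simp: bt_vertices_eq)
    obtain C where C: "B = M ** C" using matrix_eq_mult[OF M] by blast
    have "det C \<noteq> 0" using B C by (auto simp: det_mul)
    moreover have "bt_adjacent (vx (mat 1)) (vx C)"
      using w(2) bt_adjacent_mult[OF M, of "mat 1" C] by (simp add: B C flip: M_def)
    ultimately have "vx C \<in> (\<lambda>a. vx (rep (gqp c a))) ` S" using nbrs by auto
    then obtain a where a: "vx C = vx (rep (gqp c a))" "a \<in> S" by (rule imageE)
    have "w = vx (M ** rep (gqp c a))" unfolding B(2) C vx_mult_eq_iff[OF M] by (rule a(1))
    also have "M ** rep (gqp c a) = rep (qprod c (xs @ [a]))"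
      by (simp add: M_def qprod_append rep_mult rep_scalar emb_1)
    finally show ?thesis using xs a(2) by (intro bexI[of _ "xs @ [a]"]) auto
  qed
  have walk: "\<exists>ys\<in>lists S. last p = vx (rep (qprod c ys))"
    if "p \<noteq> []" "successively bt_adjacent p" "set p \<subseteq> bt_vertices"
      "\<exists>xs\<in>lists S. hd p = vx (rep (qprod c xs))" for p
    using that
  proof (induction p)
    case (Cons w p)
    show ?case
    proof (cases "p = []")
      case False
      have "bt_adjacent w (hd p)" "hd p \<in> bt_vertices"
        using Cons.prems(2,3) False by (auto simp: successively_Cons)
      then have "\<exists>xs\<in>lists S. hd p = vx (rep (qprod c xs))"
        using Cons.prems(4) step[of _ "hd p"] by fastforce
      then have "\<exists>ys\<in>lists S. last p = vx (rep (qprod c ys))"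
        using Cons.prems(2,3) False by (intro Cons.IH) (auto simp: successively_Cons)
      then show ?thesis unfolding last_ConsR[OF False] .
    next
      case True
      show ?thesis unfolding last_ConsL[OF True] using Cons.prems(4) by (simp only: list.sel)
    qed
  qed blast
  obtain p where p: "simple_path bt_vertices bt_adjacent (vx (mat 1)) v p"
  proof -
    have "\<exists>!p. simple_path bt_vertices bt_adjacent (vx (mat 1)) v p"
      using T one v by (simp add: regular_tree_def)
    then show thesis using that by blast
  qed
  show ?thesis
  proof -
    have "vx (mat 1) = vx (rep (qprod c []))" by (simp add: rep_scalar emb_1)
    then have "\<exists>xs\<in>lists S. hd p = vx (rep (qprod c xs))"
      using p by (metis lists.Nil simple_path_def)
    then show ?thesis using walk[of p] p by (auto simp: simple_path_def)
  qed
qed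

end

end


section \<open>The lattice\<close>

abbreviation zqp :: "'a::field \<times> 'a \<Rightarrow> 'a poly fract quat" where
  "zqp a \<equiv> zq (fst a) (snd a)"

locale quat_lattice = T: place c "embed_at \<tau>" 0 w0 w1 + I: place c embed_infinity 1 v0 v1
  for c \<tau> :: "'a::{field,finite}" and w0 w1 v0 v1 +
  fixes char exponent :: nat
  assumes card: "prime char" "CARD('a) = char ^ exponent" and \<tau>: "\<tau> \<noteq> 0" "\<tau> \<noteq> 1"
begin

abbreviation "mulD \<equiv> quat_mult (ratfun_const c) D_b"
abbreviation "nrdD \<equiv> nrd (ratfun_const c) D_b"

section \<open>Norms of the generators and their valuations at the two places\<close>

definition NA :: "('a \<times> 'a) set" where
  "NA = {a. nrm c (fst a) (snd a) = - c}"

definition NB :: "('a \<times> 'a) set" where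
  "NB = {a. nrm c (fst a) (snd a) = c * \<tau> / (1 - \<tau>)}"

lemma norm_sets: "normset_a c = zqp ` NA" "normset_b c \<tau> = zqp ` NB"
proof -
  have "{zq x y | x y. nrm c x y = k} = zqp ` {a. nrm c (fst a) (snd a) = k}" for k
  proof (intro subset_antisym subsetI)
    fix w assume "w \<in> {zq x y | x y. nrm c x y = k}"
    then obtain x y where "w = zqp (x, y)" "(x, y) \<in> {a. nrm c (fst a) (snd a) = k}" by auto
    then show "w \<in> zqp ` {a. nrm c (fst a) (snd a) = k}" by (rule image_eqI)
  qed auto
  then show "normset_a c = zqp ` NA" "normset_b c \<tau> = zqp ` NB"
    unfolding norm_set_eq[OF card T.nonsquare] NA_def NB_def by blast+
qed

lemma NA_neg: "a \<in> NA \<Longrightarrow> - a \<in> NA" and NB_neg: "a \<in> NB \<Longrightarrow> - a \<in> NB"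
  by (simp_all add: NA_def NB_def)

lemma card_NA: "card NA = CARD('a) + 1"
proof -
  have "NA = {(x, y). nrm c x y = - c}" by (auto simp: NA_def)
  then show ?thesis using card_nrm_fibre[OF T.nonsquare, of "- c"] T.c_nonzero by simp
qed

lemma card_NB: "card NB = CARD('a) + 1"
proof -
  have "NB = {(x, y). nrm c x y = c * \<tau> / (1 - \<tau>)}" by (auto simp: NB_def)
  then show ?thesis
    using card_nrm_fibre[OF T.nonsquare, of "c * \<tau> / (1 - \<tau>)"] T.c_nonzero \<tau> by simp
qed

lemma nrd_NA: "a \<in> NA \<Longrightarrow> nrdD (gqp c a) = ratfun_const (c ^ 2) * ratfun_t"
  unfolding NA_def by (rule nrd_gq_a) simp

lemma nrd_NB: "a \<in> NB \<Longrightarrow>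
    nrdD (gqp c a) = ratfun_const (c ^ 2 / (1 - \<tau>)) * ratfun_t * (ratfun_t - ratfun_const \<tau>)"
  unfolding NB_def by (rule nrd_gq_b) (simp_all add: \<tau>)

lemma t_nonzero: "ratfun_t \<noteq> (0 :: 'a poly fract)" "ratfun_t - ratfun_const \<tau> \<noteq> 0"
  unfolding ratfun_t_rf ratfun_const_rf rf_simps(4)[symmetric] by simp_all

lemma consts_nonzero: "c ^ 2 \<noteq> 0" "c ^ 2 / (1 - \<tau>) \<noteq> 0"
  using T.c_nonzero \<tau> by simp_all

lemma nz_NA: "a \<in> NA \<Longrightarrow> nrdD (gqp c a) \<noteq> 0"
  unfolding nrd_NA mult_eq_0_iff ratfun_const_simps(8) using consts_nonzero t_nonzero by blast

lemma nz_NB: "a \<in> NB \<Longrightarrow> nrdD (gqp c a) \<noteq> 0"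
  unfolding nrd_NB mult_eq_0_iff ratfun_const_simps(8) using consts_nonzero t_nonzero by blast

lemma subdegree_t_minus_\<tau>:
  "fls_subdegree (embed_at \<tau> (ratfun_t - ratfun_const \<tau>)) = 1"
  "fls_subdegree (embed_infinity (ratfun_t - ratfun_const \<tau>)) = - 1"
proof -
  have "embed_at \<tau> (ratfun_t - ratfun_const \<tau>) = fls_X"
    by (simp add: T.emb_diff embed_at_hom)
  then show "fls_subdegree (embed_at \<tau> (ratfun_t - ratfun_const \<tau>)) = 1" by simp
  show "fls_subdegree (embed_infinity (ratfun_t - ratfun_const \<tau>)) = - 1"
    unfolding I.emb_diff embed_infinity_hom by (rule fls_subdegree_eqI) auto
qed

lemma deg_NA:
  assumes "a \<in> NA"
  shows "fls_subdegree (embed_at \<tau> (nrdD (gqp c a))) = 0"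
    "fls_subdegree (embed_infinity (nrdD (gqp c a))) = - 1"
  unfolding nrd_NA[OF assms] T.emb_mult I.emb_mult T.emb_const I.emb_const
  using T.emb_t I.emb_t t_nonzero consts_nonzero by (simp_all add: fls_const_nonzero)

lemma deg_NB:
  assumes "a \<in> NB"
  shows "fls_subdegree (embed_at \<tau> (nrdD (gqp c a))) = 1"
    "fls_subdegree (embed_infinity (nrdD (gqp c a))) = - 2"
proof -
  have c': "fls_const (c ^ 2 / (1 - \<tau>)) \<noteq> 0" using consts_nonzero(2) by (rule fls_const_nonzero)
  have e: "embed_at \<tau> (ratfun_t - ratfun_const \<tau>) \<noteq> 0" "embed_infinity (ratfun_t - ratfun_const \<tau>) \<noteq> 0"
    "embed_at \<tau> ratfun_t \<noteq> 0" "embed_infinity (ratfun_t :: 'a poly fract) \<noteq> 0"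
    unfolding T.emb_eq_0_iff I.emb_eq_0_iff by (fact t_nonzero)+
  show "fls_subdegree (embed_at \<tau> (nrdD (gqp c a))) = 1"
    "fls_subdegree (embed_infinity (nrdD (gqp c a))) = - 2"
    unfolding nrd_NB[OF assms] T.emb_mult I.emb_mult T.emb_const I.emb_const
    using T.emb_t I.emb_t subdegree_t_minus_\<tau> c' e by simp_all
qed

lemma qprod_NA_moves: "xs \<in> lists NA \<Longrightarrow> reduced xs \<Longrightarrow> vx (I.rep (qprod c xs)) = vx (mat 1) \<Longrightarrow> xs = []"
  by (rule I.reduced_word_moves[of NA]) (simp_all add: nz_NA deg_NA NA_neg)

lemma qprod_NB_moves: "xs \<in> lists NB \<Longrightarrow> reduced xs \<Longrightarrow> vx (T.rep (qprod c xs)) = vx (mat 1) \<Longrightarrow> xs = []"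
  by (rule T.reduced_word_moves[of NB]) (simp_all add: nz_NB deg_NB NB_neg)

lemma qprod_NB_fixed: "xs \<in> lists NB \<Longrightarrow> vx (I.rep (qprod c xs)) = vx (mat 1)"
  by (rule I.vx_rep_qprod_fixed[of NB]) (simp_all add: nz_NB deg_NB)

lemma qprod_NA_transitive: "v \<in> bt_vertices \<Longrightarrow> \<exists>xs\<in>lists NA. v = vx (I.rep (qprod c xs))"
  by (rule I.words_transitive[of NA]) (simp_all add: nz_NA deg_NA NA_neg card_NA)

lemma qprod_NB_transitive: "v \<in> bt_vertices \<Longrightarrow> \<exists>xs\<in>lists NB. v = vx (T.rep (qprod c xs))"
  by (rule T.words_transitive[of NB]) (simp_all add: nz_NB deg_NB NB_neg card_NB)

lemma nrd_qprod_NA: "xs \<in> lists NA \<Longrightarrow> nrdD (qprod c xs) \<noteq> 0"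
  and nrd_qprod_NB: "xs \<in> lists NB \<Longrightarrow> nrdD (qprod c xs) \<noteq> 0"
  by (rule nrd_qprod; simp add: nz_NA nz_NB)+

sublocale G: group "GK c"
  unfolding GK_def by (rule group_PGL1)

lemma GK_mult: "nrdD x \<noteq> 0 \<Longrightarrow> nrdD y \<noteq> 0 \<Longrightarrow> GK_class c x \<otimes>\<^bsub>GK c\<^esub> GK_class c y = GK_class c (mulD x y)"
  unfolding GK_def GK_class_def by (rule mult_PGL1)

lemma GK_one: "\<one>\<^bsub>GK c\<^esub> = GK_class c (quat_scalar 1)"
  unfolding GK_def GK_class_def by (rule one_PGL1)

lemma GK_closed: "nrdD x \<noteq> 0 \<Longrightarrow> GK_class c x \<in> carrier (GK c)"
  unfolding GK_def GK_class_def carrier_PGL1 by blast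

lemma GK_eq_iff: "GK_class c x = GK_class c y \<longleftrightarrow> (\<exists>s. s \<noteq> 0 \<and> x = quat_smult s y)"
  unfolding GK_class_def by (rule PGL1_class_eq_iff)


subsection \<open>The presentation\<close>

abbreviation "LA a \<equiv> la (zqp a)"
abbreviation "LB a \<equiv> lb (zqp a)"
abbreviation "SS \<equiv> pres_gens c \<tau>"
abbreviation "RR \<equiv> pres_rels c \<tau>"

lemma pres_gens_eq: "SS = GenA ` zqp ` NA \<union> GenB ` zqp ` NB"
  unfolding pres_gens_def norm_sets ..

lemma pres_gens_cases:
  assumes "s \<in> SS"
  obtains a where "a \<in> NA" "s = GenA (zqp a)" | a where "a \<in> NB" "s = GenB (zqp a)"
  using assms unfolding pres_gens_eq by blast

lemma letters [simp, intro]: "a \<in> NA \<Longrightarrow> LA a \<in> SS \<times> UNIV" "a \<in> NB \<Longrightarrow> LB a \<in> SS \<times> UNIV"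
  unfolding pres_gens_eq by auto

lemma gen_value_in: "gen_value c ` SS \<subseteq> carrier (GK c)"
proof (rule image_subsetI)
  fix s assume "s \<in> SS"
  then show "gen_value c s \<in> carrier (GK c)"
    by (cases rule: pres_gens_cases) (simp_all add: gen_elt_zq GK_closed nz_NA nz_NB)
qed

text \<open>Guarantees \<xi> \<noteq> \<lambda> in the mixed relations, so that \<lambda> - \<xi> is
  invertible and its power 1 - q can be computed.\<close>

lemma norm_differ: "- c \<noteq> c * \<tau> / (1 - \<tau>)"
proof
  assume "- c = c * \<tau> / (1 - \<tau>)"
  then have "- c * (1 - \<tau>) = c * \<tau>" using \<tau> by (simp add: eq_divide_eq)
  then show False using T.c_nonzero by (simp add: algebra_simps)
qed

lemma nrm_diff:
  assumes "a \<in> NA" "b \<in> NB"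
  shows "nrm c (fst b - fst a) (snd b - snd a) \<noteq> 0"
proof
  assume "nrm c (fst b - fst a) (snd b - snd a) = 0"
  then have "a = b" by (simp add: nrm_eq_0_iff[OF T.nonsquare] prod_eq_iff)
  then show False using assms norm_differ by (simp add: NA_def NB_def)
qed

text \<open>Coordinates of \<lambda>^q (\<lambda> - \<xi>)^(1 - q) for \<xi> = \<open>a\<close> and
  \<lambda> = \<open>b\<close>: the pair (\<open>P\<close>, \<open>Q\<close>) is (\<lambda> -
  \<xi>)^2 / N(\<lambda> - \<xi>). This is even in \<lambda> - \<xi>, so \<open>mu\<close> has the
  same \<open>P\<close> and \<open>Q\<close>.\<close>

definition eta :: "'a \<times> 'a \<Rightarrow> 'a \<times> 'a \<Rightarrow> 'a \<times> 'a" where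
  "eta a b = (let (x, y) = a; (u, v) = b; N = nrm c (u - x) (v - y);
      P = ((u - x) * (u - x) + c * (v - y) * (v - y)) / N;
      Q = ((u - x) * (v - y) + (v - y) * (u - x)) / N
    in (u * P + c * (- v) * Q, u * Q + (- v) * P))"

definition mu :: "'a \<times> 'a \<Rightarrow> 'a \<times> 'a \<Rightarrow> 'a \<times> 'a" where
  "mu a b = (let (x, y) = a; (u, v) = b; N = nrm c (u - x) (v - y);
      P = ((u - x) * (u - x) + c * (v - y) * (v - y)) / N;
      Q = ((u - x) * (v - y) + (v - y) * (u - x)) / N
    in (x * P + c * (- y) * Q, x * Q + (- y) * P))"

lemma eta_formula:
  assumes "a \<in> NA" "b \<in> NB"
  shows "zqp b [^]\<^bsub>D_alg c\<^esub> CARD('a) \<otimes>\<^bsub>D_alg c\<^esub> (zqp b \<ominus>\<^bsub>D_alg c\<^esub> zqp a) [^]\<^bsub>D_alg c\<^esub> (1 - int CARD('a)) = zqp (eta a b)"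
proof -
  obtain x y u v where ab: "a = (x, y)" "b = (u, v)" by (metis surj_pair)
  have n: "nrm c (u - x) (v - y) \<noteq> 0" using nrm_diff[OF assms] by (simp add: ab)
  show ?thesis
    unfolding ab fst_conv snd_conv D_alg_minus_zq zq_pow_card[OF card T.nonsquare]
      zq_pow_1_minus_card[OF card T.nonsquare n] D_alg_mult zq_simps eta_def Let_def prod.case ..
qed

lemma mu_formula:
  assumes "a \<in> NA" "b \<in> NB"
  shows "zqp a [^]\<^bsub>D_alg c\<^esub> CARD('a) \<otimes>\<^bsub>D_alg c\<^esub> (zqp a \<ominus>\<^bsub>D_alg c\<^esub> zqp b) [^]\<^bsub>D_alg c\<^esub> (1 - int CARD('a)) = zqp (mu a b)"
proof -
  obtain x y u v where ab: "a = (x, y)" "b = (u, v)" by (metis surj_pair)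
  have flip: "nrm c (x - u) (y - v) = nrm c (u - x) (v - y)"
    "(x - u) * (x - u) + c * (y - v) * (y - v) = (u - x) * (u - x) + c * (v - y) * (v - y)"
    "(x - u) * (y - v) + (y - v) * (x - u) = (u - x) * (v - y) + (v - y) * (u - x)"
    by (simp_all add: nrm_def power2_eq_square algebra_simps)
  have n: "nrm c (x - u) (y - v) \<noteq> 0" using nrm_diff[OF assms] by (simp add: ab flip)
  show ?thesis
    unfolding ab fst_conv snd_conv D_alg_minus_zq zq_pow_card[OF card T.nonsquare]
      zq_pow_1_minus_card[OF card T.nonsquare n] D_alg_mult zq_simps mu_def Let_def prod.case flip ..
qed

lemma eta_mu:
  assumes "a \<in> NA" "b \<in> NB"
  shows "eta a b \<in> NB" "mu a b \<in> NA" "mulD (gqp c a) (gqp c (eta a b)) = mulD (gqp c b) (gqp c (mu a b))"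
proof -
  obtain x y u v where ab: "a = (x, y)" "b = (u, v)" by (metis surj_pair)
  have n: "nrm c (u - x) (v - y) \<noteq> 0" using nrm_diff[OF assms] by (simp add: ab)
  show "mulD (gqp c a) (gqp c (eta a b)) = mulD (gqp c b) (gqp c (mu a b))"
    unfolding ab eta_def mu_def Let_def prod.case fst_conv snd_conv by (rule gq_relation(1)[OF n])
  show "eta a b \<in> NB"
    using assms(2) unfolding NB_def mem_Collect_eq ab eta_def Let_def prod.case fst_conv snd_conv
    by (simp only: gq_relation(2)[OF n])
  show "mu a b \<in> NA"
    using assms(1) unfolding NA_def mem_Collect_eq ab mu_def Let_def prod.case fst_conv snd_conv
    by (simp only: gq_relation(3)[OF n])
qed

text \<open>The mixed relations become indexed by the pairs (\<xi>, \<lambda>), because \<eta> and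
  \<mu> are functions of them whose values lie in the right norm sets by
  \<open>eta_mu\<close>.\<close>

lemma pres_rels_eq: "RR =
    {([LA a, LA (- a)], []) | a. a \<in> NA} \<union> {([LB b, LB (- b)], []) | b. b \<in> NB} \<union>
    {([LA a, LB (eta a b)], [LB b, LA (mu a b)]) | a b. a \<in> NA \<and> b \<in> NB}"
proof -
  have neg: "\<ominus>\<^bsub>D_alg c\<^esub> zqp a = zqp (- a)" for a by simp
  have 1: "{([la \<xi>, la (\<ominus>\<^bsub>D_alg c\<^esub> \<xi>)], []) | \<xi>. \<xi> \<in> zqp ` NA} = {([LA a, LA (- a)], []) | a. a \<in> NA}"
    "{([lb \<xi>, lb (\<ominus>\<^bsub>D_alg c\<^esub> \<xi>)], []) | \<xi>. \<xi> \<in> zqp ` NB} = {([LB a, LB (- a)], []) | a. a \<in> NB}"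
    unfolding neg[symmetric] by blast+
  have 2: "{([la \<xi>, lb \<eta>], [lb \<nu>, la \<mu>]) | \<xi> \<eta> \<nu> \<mu>.
        \<xi> \<in> zqp ` NA \<and> \<mu> \<in> zqp ` NA \<and> \<eta> \<in> zqp ` NB \<and> \<nu> \<in> zqp ` NB \<and>
        \<eta> = \<nu> [^]\<^bsub>D_alg c\<^esub> CARD('a) \<otimes>\<^bsub>D_alg c\<^esub> (\<nu> \<ominus>\<^bsub>D_alg c\<^esub> \<xi>) [^]\<^bsub>D_alg c\<^esub> (1 - int CARD('a)) \<and>
        \<mu> = \<xi> [^]\<^bsub>D_alg c\<^esub> CARD('a) \<otimes>\<^bsub>D_alg c\<^esub> (\<xi> \<ominus>\<^bsub>D_alg c\<^esub> \<nu>) [^]\<^bsub>D_alg c\<^esub> (1 - int CARD('a))} =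
      {([LA a, LB (eta a b)], [LB b, LA (mu a b)]) | a b. a \<in> NA \<and> b \<in> NB}" (is "?L = ?R")
  proof
    show "?L \<subseteq> ?R"
    proof
      fix r assume "r \<in> ?L"
      then obtain \<xi> \<eta> \<nu> \<mu> where r: "r = ([la \<xi>, lb \<eta>], [lb \<nu>, la \<mu>])" "\<xi> \<in> zqp ` NA" "\<nu> \<in> zqp ` NB"
        "\<eta> = \<nu> [^]\<^bsub>D_alg c\<^esub> CARD('a) \<otimes>\<^bsub>D_alg c\<^esub> (\<nu> \<ominus>\<^bsub>D_alg c\<^esub> \<xi>) [^]\<^bsub>D_alg c\<^esub> (1 - int CARD('a))"
        "\<mu> = \<xi> [^]\<^bsub>D_alg c\<^esub> CARD('a) \<otimes>\<^bsub>D_alg c\<^esub> (\<xi> \<ominus>\<^bsub>D_alg c\<^esub> \<nu>) [^]\<^bsub>D_alg c\<^esub> (1 - int CARD('a))" by blast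
      obtain a b where ab: "a \<in> NA" "\<xi> = zqp a" "b \<in> NB" "\<nu> = zqp b" using r(2,3) by blast
      have "\<eta> = zqp (eta a b)" "\<mu> = zqp (mu a b)"
        using r(4,5) unfolding ab(2,4) eta_formula[OF ab(1,3)] mu_formula[OF ab(1,3)] .
      then show "r \<in> ?R" using r(1) ab by blast
    qed
    show "?R \<subseteq> ?L"
    proof
      fix r assume "r \<in> ?R"
      then obtain a b where r: "r = ([LA a, LB (eta a b)], [LB b, LA (mu a b)])" and ab: "a \<in> NA" "b \<in> NB"
        by blast
      have mem: "zqp a \<in> zqp ` NA" "zqp b \<in> zqp ` NB" "zqp (eta a b) \<in> zqp ` NB" "zqp (mu a b) \<in> zqp ` NA"
        using ab eta_mu(1,2)[OF ab] by blast+
      show "r \<in> ?L"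
        unfolding mem_Collect_eq
        by (rule exI[of _ "zqp a"], rule exI[of _ "zqp (eta a b)"], rule exI[of _ "zqp b"],
            rule exI[of _ "zqp (mu a b)"])
           (simp only: r eta_formula[OF ab] mu_formula[OF ab] mem simp_thms)
    qed
  qed
  show ?thesis unfolding pres_rels_def norm_sets 1 2 ..
qed

lemma pres_rels_cases:
  assumes "(u, v) \<in> RR"
  obtains a where "a \<in> NA" "u = [LA a, LA (- a)]" "v = []"
    | b where "b \<in> NB" "u = [LB b, LB (- b)]" "v = []"
    | a b where "a \<in> NA" "b \<in> NB" "u = [LA a, LB (eta a b)]" "v = [LB b, LA (mu a b)]"
  using assms unfolding pres_rels_eq by blast

lemma list2_in: "l \<in> SS \<times> UNIV \<Longrightarrow> l' \<in> SS \<times> UNIV \<Longrightarrow> [l, l'] \<in> lists (SS \<times> UNIV)"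
  by (intro lists.intros)

lemma pres_rels_lists: "RR \<subseteq> lists (SS \<times> UNIV) \<times> lists (SS \<times> UNIV)"
proof
  fix r assume r: "r \<in> RR"
  obtain u v where uv: "r = (u, v)" by (cases r)
  from r[unfolded uv] show "r \<in> lists (SS \<times> UNIV) \<times> lists (SS \<times> UNIV)"
  proof (cases rule: pres_rels_cases)
    case 1
    show ?thesis unfolding uv 1(2,3) by (rule SigmaI; intro list2_in letters NA_neg lists.Nil 1(1))
  next
    case 2
    show ?thesis unfolding uv 2(2,3) by (rule SigmaI; intro list2_in letters NB_neg lists.Nil 2(1))
  next
    case (3 a b)
    show ?thesis unfolding uv 3(3,4) by (rule SigmaI; intro list2_in letters eta_mu(1,2) 3(1,2))
  qed
qed

lemma finite_pres: "finite SS" "finite RR"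
proof -
  show S: "finite SS" unfolding pres_gens_eq by simp
  have "RR \<subseteq> {u. set u \<subseteq> SS \<times> UNIV \<and> length u \<le> 2} \<times> {u. set u \<subseteq> SS \<times> UNIV \<and> length u \<le> 2}"
  proof
    fix r assume r: "r \<in> RR"
    obtain u v where uv: "r = (u, v)" by (cases r)
    have "length u \<le> 2 \<and> length v \<le> 2"
      using r unfolding uv by (cases rule: pres_rels_cases) simp_all
    moreover have "u \<in> lists (SS \<times> UNIV) \<and> v \<in> lists (SS \<times> UNIV)"
      using r pres_rels_lists unfolding uv by blast
    ultimately show "r \<in> {u. set u \<subseteq> SS \<times> UNIV \<and> length u \<le> 2} \<times> {u. set u \<subseteq> SS \<times> UNIV \<and> length u \<le> 2}"
      unfolding uv lists_eq_set by simp
  qed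
  moreover have "finite {u. set u \<subseteq> SS \<times> (UNIV :: bool set) \<and> length u \<le> 2}"
    by (rule finite_lists_length_le) (use S in simp)
  ultimately show "finite RR" by (meson finite_SigmaI finite_subset)
qed

abbreviation "val \<equiv> word_val (GK c) (gen_value c)"

lemma letter_val [simp]:
  "letter_val (GK c) (gen_value c) (LA a) = GK_class c (gqp c a)"
  "letter_val (GK c) (gen_value c) (LB a) = GK_class c (gqp c a)"
  by (simp_all add: letter_val_def gen_elt_zq)

lemma val_map_LA: "xs \<in> lists NA \<Longrightarrow> val (map LA xs) = GK_class c (qprod c xs)"
  by (induction xs) (simp_all add: GK_one GK_mult nz_NA nrd_qprod_NA)

lemma val_map_LB: "xs \<in> lists NB \<Longrightarrow> val (map LB xs) = GK_class c (qprod c xs)"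
  by (induction xs) (simp_all add: GK_one GK_mult nz_NB nrd_qprod_NB)

lemma map_LA_lists: "xs \<in> lists NA \<Longrightarrow> map LA xs \<in> lists (SS \<times> UNIV)"
  and map_LB_lists: "xs \<in> lists NB \<Longrightarrow> map LB xs \<in> lists (SS \<times> UNIV)"
  using letters by (induction xs) (auto simp del: mem_Sigma_iff)

lemma val_relation:
  assumes "(u, v) \<in> RR"
  shows "val u = val v"
proof -
  have inv: "GK_class c (mulD (gqp c a) (gqp c (- a))) = \<one>\<^bsub>GK c\<^esub>" if "nrdD (gqp c a) \<noteq> 0" for a
  proof -
    have "gqp c (- a) = quat_conj (gqp c a)" by (simp add: quat_conj_gq)
    then have "mulD (gqp c a) (gqp c (- a)) = quat_smult (nrdD (gqp c a)) (quat_scalar 1)"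
      by (simp add: quat_mult_conj)
    then show ?thesis unfolding GK_one GK_eq_iff using that by blast
  qed
  have pair: "val [l, l'] = GK_class c (mulD (gqp c a) (gqp c b))"
    if "letter_val (GK c) (gen_value c) l = GK_class c (gqp c a)"
      "letter_val (GK c) (gen_value c) l' = GK_class c (gqp c b)"
      "nrdD (gqp c a) \<noteq> 0" "nrdD (gqp c b) \<noteq> 0" for l l' a b
    using that by (simp add: GK_mult GK_closed)
  from assms show ?thesis
  proof (cases rule: pres_rels_cases)
    case 1
    then show ?thesis
      by (simp only: pair[OF letter_val(1,1) nz_NA nz_NA[OF NA_neg]] inv[OF nz_NA] word_val_simps(1))
  next
    case 2
    then show ?thesis
      by (simp only: pair[OF letter_val(2,2) nz_NB nz_NB[OF NB_neg]] inv[OF nz_NB] word_val_simps(1))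
  next
    case (3 a b)
    have "val u = GK_class c (mulD (gqp c a) (gqp c (eta a b)))"
      unfolding 3(3) by (rule pair[OF letter_val]) (use 3 eta_mu nz_NA nz_NB in blast)+
    moreover have "val v = GK_class c (mulD (gqp c b) (gqp c (mu a b)))"
      unfolding 3(4) by (rule pair[OF letter_val(2,1)]) (use 3 eta_mu nz_NA nz_NB in blast)+
    ultimately show ?thesis using eta_mu(3)[OF 3(1,2)] by simp
  qed
qed

section \<open>Normal form of words modulo the relations\<close>

abbreviation pe :: "'a poly fract quat gen word \<Rightarrow> 'a poly fract quat gen word \<Rightarrow> bool" (infix "\<approx>" 50) where
  "u \<approx> v \<equiv> pres_eq SS RR u v"

lemma pe_cong:
  assumes "u \<approx> v" "r \<in> lists (SS \<times> UNIV)" "s \<in> lists (SS \<times> UNIV)"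
  shows "r @ u @ s \<approx> r @ v @ s"
  by (intro pres_eq.append assms(1) pres_eq.refl assms(2,3))

lemma cancel_LA: "a \<in> NA \<Longrightarrow> [LA a, LA (- a)] \<approx> []"
  and cancel_LB: "b \<in> NB \<Longrightarrow> [LB b, LB (- b)] \<approx> []"
  unfolding pres_rels_eq by (rule pres_eq.rel; blast)+

text \<open>
  With \<open>\<lambda> = -b\<close> the relation \<open>a b\<^sub>\<eta> = b\<^sub>\<lambda> a\<^sub>\<mu>\<close> reads \<open>b a = a\<^sub>\<mu> b\<^sub>-\<^sub>\<eta>\<close>, so the map
  \<open>(\<xi>, \<lambda>) \<mapsto> (\<eta>, \<mu>)\<close> need not be inverted.
\<close>

lemma swap_LB_LA:
  assumes "b \<in> NB" "a \<in> NA"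
  shows "\<exists>a'\<in>NA. \<exists>b'\<in>NB. [LB b, LA a] \<approx> [LA a', LB b']"
proof -
  have nb: "- b \<in> NB" using assms NB_neg by blast
  define e where "e = eta a (- b)"
  define n where "n = mu a (- b)"
  have en: "e \<in> NB" "n \<in> NA" using eta_mu[OF assms(2) nb] by (simp_all add: e_def n_def)
  have ne: "- e \<in> NB" using en NB_neg by blast
  have L: "[LB b] \<in> lists (SS \<times> UNIV)" "[LB (- e)] \<in> lists (SS \<times> UNIV)" "[LB b, LA a] \<in> lists (SS \<times> UNIV)"
    "[LA n, LB (- e)] \<in> lists (SS \<times> UNIV)" "[] \<in> lists (SS \<times> (UNIV :: bool set))"
    by (intro lists.intros letters assms en ne)+
  have "[LA a, LB e] \<approx> [LB (- b), LA n]"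
    unfolding pres_rels_eq e_def n_def by (rule pres_eq.rel) (use assms nb in blast)
  from pe_cong[OF this L(1,2)]
  have 1: "[LB b, LA a, LB e, LB (- e)] \<approx> [LB b, LB (- b), LA n, LB (- e)]" by simp
  from pe_cong[OF cancel_LB[OF en(1)] L(3,5)]
  have 2: "[LB b, LA a, LB e, LB (- e)] \<approx> [LB b, LA a]" by simp
  from pe_cong[OF cancel_LB[OF assms(1)] L(5,4)]
  have 3: "[LB b, LB (- b), LA n, LB (- e)] \<approx> [LA n, LB (- e)]" by simp
  have "[LB b, LA a] \<approx> [LA n, LB (- e)]"
    using pres_eq.trans[OF pres_eq.trans[OF pres_eq.sym[OF 2] 1] 3] .
  then show ?thesis using en ne by blast
qed

lemma push_LB:
  assumes "b \<in> NB" "xs \<in> lists NA"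
  shows "\<exists>xs'\<in>lists NA. \<exists>b'\<in>NB. LB b # map LA xs \<approx> map LA xs' @ [LB b']"
  using assms(2,1)
proof (induction xs arbitrary: b)
  case Nil
  have "[LB b] \<approx> [LB b]" using Nil letters by (intro pres_eq.refl) (auto simp del: mem_Sigma_iff)
  then show ?case using Nil by (intro bexI[of _ "[]"] bexI[of _ b]) auto
next
  case (Cons a xs)
  obtain a' b' where ab: "a' \<in> NA" "b' \<in> NB" "[LB b, LA a] \<approx> [LA a', LB b']"
    using swap_LB_LA Cons by blast
  obtain xs' b'' where x: "xs' \<in> lists NA" "b'' \<in> NB" "LB b' # map LA xs \<approx> map LA xs' @ [LB b'']"
    using Cons.IH[OF ab(2)] by blast
  have L: "map LA xs \<in> lists (SS \<times> UNIV)" "[LA a'] \<in> lists (SS \<times> UNIV)" "[] \<in> lists (SS \<times> (UNIV :: bool set))"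
    using map_LA_lists Cons.hyps letters ab by (auto simp del: mem_Sigma_iff)
  from pe_cong[OF ab(3) L(3,1)] have "LB b # map LA (a # xs) \<approx> LA a' # LB b' # map LA xs" by simp
  moreover from pe_cong[OF x(3) L(2,3)] have "LA a' # LB b' # map LA xs \<approx> map LA (a' # xs') @ [LB b'']" by simp
  ultimately have "LB b # map LA (a # xs) \<approx> map LA (a' # xs') @ [LB b'']" by (rule pres_eq.trans)
  then show ?case using x ab by (intro bexI[of _ "a' # xs'"] bexI[of _ b'']) auto
qed

lemma reduce_gen:
  assumes neg: "\<And>a. a \<in> N \<Longrightarrow> - a \<in> N" and cancel: "\<And>a. a \<in> N \<Longrightarrow> [L a, L (- a)] \<approx> []"
    and L: "\<And>a. a \<in> N \<Longrightarrow> L a \<in> SS \<times> UNIV" and xs: "xs \<in> lists N"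
  shows "\<exists>ys\<in>lists N. reduced ys \<and> map L xs \<approx> map L ys"
  using xs
proof (induction xs)
  case Nil
  show ?case by (intro bexI[of _ "[]"]) (auto simp: reduced_def intro: pres_eq.refl)
next
  case (Cons a xs)
  then obtain ys where ys: "ys \<in> lists N" "reduced ys" "map L xs \<approx> map L ys" by blast
  have la: "[L a] \<in> lists (SS \<times> UNIV)" "[] \<in> lists (SS \<times> (UNIV :: bool set))"
    using L Cons.hyps by (auto simp del: mem_Sigma_iff)
  from pe_cong[OF ys(3) la] have 1: "map L (a # xs) \<approx> L a # map L ys" by simp
  show ?case
  proof (cases "\<exists>zs. ys = - a # zs")
    case True
    then obtain zs where zs: "ys = - a # zs" by blast
    have "map L zs \<in> lists (SS \<times> UNIV)" using ys(1) L unfolding zs by (auto simp: in_lists_conv_set simp del: mem_Sigma_iff)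
    from pe_cong[OF cancel[of a] la(2) this] have "L a # map L ys \<approx> map L zs"
      using Cons.hyps by (simp add: zs)
    with 1 have "map L (a # xs) \<approx> map L zs" by (rule pres_eq.trans)
    moreover have "reduced zs" using ys(2) zs by (cases zs) (auto simp: reduced_def)
    ultimately show ?thesis using ys(1) zs by (intro bexI[of _ zs]) auto
  next
    case False
    then have "reduced (a # ys)" using ys(2) by (cases ys) (auto simp: reduced_def)
    then show ?thesis using 1 Cons.hyps ys(1) by (intro bexI[of _ "a # ys"]) auto
  qed
qed

lemma inverse_letter:
  assumes "(s, True) \<in> SS \<times> UNIV" "(s', True) \<in> SS \<times> UNIV" "[(s, True), (s', True)] \<approx> []"
  shows "[(s, False)] \<approx> [(s', True)]"
proof -
  have s: "s \<in> SS" using assms(1) by blast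
  have l: "[(s, False)] \<in> lists (SS \<times> UNIV)" "[(s', True)] \<in> lists (SS \<times> UNIV)"
    "[] \<in> lists (SS \<times> (UNIV :: bool set))"
    by (intro lists.intros SigmaI s UNIV_I assms(2))+
  from pe_cong[OF assms(3) l(1,3)] have 1: "[(s, False), (s, True), (s', True)] \<approx> [(s, False)]" by simp
  from pe_cong[OF pres_eq.cancel[OF s, of RR False] l(3,2)]
  have 2: "[(s, False), (s, True), (s', True)] \<approx> [(s', True)]" by simp
  show ?thesis by (rule pres_eq.trans[OF pres_eq.sym[OF 1] 2])
qed

text \<open>The relations between \<open>a\<close> and \<open>- a\<close> turn a formal inverse into
  a positive letter, so the normal form needs positive letters only.\<close>

lemma letter_cases:
  assumes "l \<in> SS \<times> UNIV"
  obtains a where "a \<in> NA" "[l] \<approx> [LA a]" | a where "a \<in> NB" "[l] \<approx> [LB a]"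
proof -
  obtain s b where l: "l = (s, b)" by (cases l)
  have s: "s \<in> SS" using assms unfolding l by blast
  have r: "[l] \<approx> [l]" by (intro pres_eq.refl lists.intros assms)
  from s show thesis
  proof (cases rule: pres_gens_cases)
    case (1 a)
    note inv = inverse_letter[OF letters(1)[OF 1(1)] letters(1)[OF NA_neg[OF 1(1)]] cancel_LA[OF 1(1)]]
    show thesis
    proof (cases b)
      case True
      then have "l = LA a" unfolding l 1(2) by simp
      then show thesis using that(1)[OF 1(1)] r by simp
    next
      case False
      then have "l = (GenA (zqp a), False)" unfolding l 1(2) by simp
      then show thesis using that(1)[OF NA_neg[OF 1(1)]] inv by simp
    qed
  next
    case (2 a)
    note inv = inverse_letter[OF letters(2)[OF 2(1)] letters(2)[OF NB_neg[OF 2(1)]] cancel_LB[OF 2(1)]]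
    show thesis
    proof (cases b)
      case True
      then have "l = LB a" unfolding l 2(2) by simp
      then show thesis using that(2)[OF 2(1)] r by simp
    next
      case False
      then have "l = (GenB (zqp a), False)" unfolding l 2(2) by simp
      then show thesis using that(2)[OF NB_neg[OF 2(1)]] inv by simp
    qed
  qed
qed

lemma normal_form:
  assumes "u \<in> lists (SS \<times> UNIV)"
  shows "\<exists>xs\<in>lists NA. \<exists>ys\<in>lists NB. reduced xs \<and> reduced ys \<and> u \<approx> map LA xs @ map LB ys"
proof -
  have "\<exists>xs\<in>lists NA. \<exists>ys\<in>lists NB. u \<approx> map LA xs @ map LB ys"
    using assms
  proof (induction u)
    case Nil
    show ?case by (intro bexI[of _ "[]"]) (auto intro: pres_eq.refl)
  next
    case (Cons l u)
    then obtain xs ys where xy: "xs \<in> lists NA" "ys \<in> lists NB" "u \<approx> map LA xs @ map LB ys" by blast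
    have L: "map LA xs \<in> lists (SS \<times> UNIV)" "map LB ys \<in> lists (SS \<times> UNIV)" "[] \<in> lists (SS \<times> (UNIV :: bool set))"
      "[l] \<in> lists (SS \<times> UNIV)"
      using map_LA_lists map_LB_lists xy Cons.hyps by auto
    from Cons.hyps(1) show ?case
    proof (cases rule: letter_cases)
      case (1 a)
      have "[l] @ u \<approx> [LA a] @ map LA xs @ map LB ys" by (rule pres_eq.append[OF 1(2) xy(3)])
      then have "l # u \<approx> map LA (a # xs) @ map LB ys" by simp
      then show ?thesis using xy 1(1) by (intro bexI[of _ "a # xs"] bexI[of _ ys]) auto
    next
      case (2 a)
      obtain xs' b' where x: "xs' \<in> lists NA" "b' \<in> NB" "LB a # map LA xs \<approx> map LA xs' @ [LB b']"
        using push_LB[OF 2(1) xy(1)] by blast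
      have "[l] @ u \<approx> [LB a] @ map LA xs @ map LB ys" by (rule pres_eq.append[OF 2(2) xy(3)])
      then have "l # u \<approx> LB a # map LA xs @ map LB ys" by simp
      moreover from pe_cong[OF x(3) L(3,2)]
      have "LB a # map LA xs @ map LB ys \<approx> map LA xs' @ map LB (b' # ys)" by simp
      ultimately have "l # u \<approx> map LA xs' @ map LB (b' # ys)" by (rule pres_eq.trans)
      then show ?thesis using xy x(1,2) by (intro bexI[of _ xs'] bexI[of _ "b' # ys"]) auto
    qed
  qed
  then obtain xs ys where xy: "xs \<in> lists NA" "ys \<in> lists NB" "u \<approx> map LA xs @ map LB ys" by blast
  obtain xs' where x: "xs' \<in> lists NA" "reduced xs'" "map LA xs \<approx> map LA xs'"
    using reduce_gen[of NA LA xs] NA_neg cancel_LA letters(1) xy(1) by blast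
  obtain ys' where y: "ys' \<in> lists NB" "reduced ys'" "map LB ys \<approx> map LB ys'"
    using reduce_gen[of NB LB ys] NB_neg cancel_LB letters(2) xy(2) by blast
  have "u \<approx> map LA xs' @ map LB ys'" using pres_eq.trans[OF xy(3) pres_eq.append[OF x(3) y(3)]] .
  then show ?thesis using x y by blast
qed

text \<open>At t = infinity the second factor fixes the base vertex, so the first one must fix it
  too and is empty. What remains is a word in the second family, to be tested at t = \<tau>.\<close>

lemma fixes_base_imp_Nil:
  assumes xs: "xs \<in> lists NA" "reduced xs" and ys: "ys \<in> lists NB" "reduced ys"
    and fT: "vx (T.rep (mulD (qprod c xs) (qprod c ys))) = vx (mat 1)"
    and fI: "vx (I.rep (mulD (qprod c xs) (qprod c ys))) = vx (mat 1)"
  shows "xs = []" "ys = []"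
proof -
  have "det (I.rep (qprod c xs)) \<noteq> 0" using nrd_qprod_NA[OF xs(1)] by (simp add: I.det_rep)
  then have "vx (I.rep (qprod c xs) ** I.rep (qprod c ys)) = vx (I.rep (qprod c xs))"
    by (rule I.vx_mult_cong) (rule qprod_NB_fixed[OF ys(1)])
  then have "vx (I.rep (qprod c xs)) = vx (mat 1)" using fI unfolding I.rep_mult by (rule HOL.trans[OF HOL.sym])
  then show 1: "xs = []" by (rule qprod_NA_moves[OF xs])
  have "vx (T.rep (qprod c ys)) = vx (mat 1)" using fT unfolding 1 by simp
  then show "ys = []" by (rule qprod_NB_moves[OF ys])
qed

lemma vx_rep_class:
  assumes "GK_class c x = GK_class c y"
  shows "vx (T.rep x) = vx (T.rep y)" "vx (I.rep x) = vx (I.rep y)"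
proof -
  obtain s where s: "s \<noteq> 0" "x = quat_smult s y" using assms GK_eq_iff by blast
  show "vx (T.rep x) = vx (T.rep y)" unfolding s(2) T.rep_smult by (rule vx_scale) (simp add: s(1))
  show "vx (I.rep x) = vx (I.rep y)" unfolding s(2) I.rep_smult by (rule vx_scale) (simp add: s(1))
qed

lemma val_normal_form:
  assumes "u \<approx> map LA xs @ map LB ys" "xs \<in> lists NA" "ys \<in> lists NB"
  shows "val u = GK_class c (mulD (qprod c xs) (qprod c ys))"
proof -
  have "val u = val (map LA xs @ map LB ys)"
    by (rule G.word_val_pres_eq[OF gen_value_in pres_rels_lists val_relation assms(1)])
  also have "\<dots> = val (map LA xs) \<otimes>\<^bsub>GK c\<^esub> val (map LB ys)"
    by (rule G.word_val_append[OF gen_value_in map_LA_lists[OF assms(2)] map_LB_lists[OF assms(3)]])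
  also have "\<dots> = GK_class c (mulD (qprod c xs) (qprod c ys))"
    unfolding val_map_LA[OF assms(2)] val_map_LB[OF assms(3)]
    by (rule GK_mult[OF nrd_qprod_NA[OF assms(2)] nrd_qprod_NB[OF assms(3)]])
  finally show ?thesis .
qed

text \<open>Serves twice: with \<open>x\<close> the unit element it gives the kernel of the
  presentation, and for general \<open>x\<close> the triviality of stabilisers.\<close>

lemma val_stabilizer:
  assumes u: "u \<in> lists (SS \<times> UNIV)" and x: "val u = GK_class c x"
    and fixed: "vx (T.rep x) = vx (mat 1)" "vx (I.rep x) = vx (mat 1)"
  shows "u \<approx> []"
proof -
  obtain xs ys where n: "xs \<in> lists NA" "ys \<in> lists NB" "reduced xs" "reduced ys" "u \<approx> map LA xs @ map LB ys"
    using normal_form[OF u] by blast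
  have eq: "GK_class c (mulD (qprod c xs) (qprod c ys)) = GK_class c x"
    using val_normal_form[OF n(5,1,2)] x by simp
  have "xs = []" "ys = []"
    by (rule fixes_base_imp_Nil[OF n(1,3,2,4)], unfold vx_rep_class[OF eq], rule fixed, rule fixed)+
  then show ?thesis using n(5) by simp
qed

lemma Gamma_set_eq: "Gamma_set c \<tau> = generate (GK c) (gen_value c ` SS)"
proof -
  have "gen_value c ` SS = gen_elt c ` normset_a c \<union> gen_elt c ` normset_b c \<tau>"
    unfolding pres_gens_def image_Un image_image by simp
  then show ?thesis unfolding Gamma_set_def by simp
qed

theorem presentation: "has_finite_presentation (Gamma c \<tau>) SS RR (gen_value c)"
  unfolding Gamma_def Gamma_set_eq
proof (rule G.has_finite_presentationI[OF finite_pres pres_rels_lists gen_value_in val_relation])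
  fix u assume u: "u \<in> lists (SS \<times> UNIV)" "val u = \<one>\<^bsub>GK c\<^esub>"
  show "u \<approx> []"
  proof (rule val_stabilizer[OF u(1)])
    show "val u = GK_class c (quat_scalar 1)" using u(2) by (simp only: GK_one)
  qed (simp_all add: T.rep_scalar I.rep_scalar T.emb_1 I.emb_1)
qed

section \<open>Stabilisers and transitivity\<close>

lemma Gamma_subgroup: "subgroup (Gamma_set c \<tau>) (GK c)"
  unfolding Gamma_set_eq by (rule G.generate_is_subgroup[OF gen_value_in])

lemma Gamma_stabilizer:
  assumes "GK_class c x \<in> Gamma_set c \<tau>" "vx (T.rep x) = vx (mat 1)" "vx (I.rep x) = vx (mat 1)"
  shows "GK_class c x = \<one>\<^bsub>GK c\<^esub>"
proof -
  obtain u where u: "u \<in> lists (SS \<times> UNIV)" "val u = GK_class c x"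
    using G.word_val_generate[OF gen_value_in] assms(1) unfolding Gamma_set_eq by blast
  have "val u = val []"
    by (rule G.word_val_pres_eq[OF gen_value_in pres_rels_lists val_relation val_stabilizer[OF u assms(2,3)]])
  then show ?thesis using u(2) by simp
qed

text \<open>A word in the \<open>a\<close>-letters reaches \<open>w\<close> at t = infinity. It is
  followed on the right by a word in the \<open>b\<close>-letters reaching, at t = \<tau>, the
  vertex that the first word moves to \<open>v\<close>; this does not disturb \<open>w\<close>,
  because the \<open>b\<close>-letters fix the base vertex at t = infinity.\<close>

lemma Gamma_transitive:
  assumes "v \<in> bt_vertices" "w \<in> bt_vertices"
  shows "\<exists>x. nrdD x \<noteq> 0 \<and> GK_class c x \<in> Gamma_set c \<tau> \<and> vx (T.rep x) = v \<and> vx (I.rep x) = w"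
proof -
  obtain xs where xs: "xs \<in> lists NA" "w = vx (I.rep (qprod c xs))"
    using qprod_NA_transitive[OF assms(2)] by (rule bexE)
  define M where "M = T.rep (qprod c xs)"
  have M: "det M \<noteq> 0" using nrd_qprod_NA[OF xs(1)] by (simp add: M_def T.det_rep)
  have MI: "det (I.rep (qprod c xs)) \<noteq> 0" using nrd_qprod_NA[OF xs(1)] by (simp add: I.det_rep)
  obtain B where B: "det B \<noteq> 0" "v = vx B" using assms(1) by (auto simp: bt_vertices_eq)
  obtain C where C: "B = M ** C" using matrix_eq_mult[OF M] by blast
  have "det C \<noteq> 0" using B C by (auto simp: det_mul)
  then have "vx C \<in> bt_vertices" by (rule vx_in)
  from qprod_NB_transitive[OF this] obtain ys where ys: "ys \<in> lists NB" "vx C = vx (T.rep (qprod c ys))"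
    by (rule bexE)
  define x where "x = mulD (qprod c xs) (qprod c ys)"
  have "val (map LA xs @ map LB ys) = GK_class c x"
    unfolding x_def
    by (rule val_normal_form[OF pres_eq.refl xs(1) ys(1)])
       (simp only: append_in_lists_conv map_LA_lists[OF xs(1)] map_LB_lists[OF ys(1)])
  moreover have "val (map LA xs @ map LB ys) \<in> Gamma_set c \<tau>"
    unfolding Gamma_set_eq
    by (rule G.word_val_in_generate)
       (simp only: append_in_lists_conv map_LA_lists[OF xs(1)] map_LB_lists[OF ys(1)])
  moreover have "nrdD x \<noteq> 0"
    unfolding x_def nrd_mult using nrd_qprod_NA[OF xs(1)] nrd_qprod_NB[OF ys(1)] by simp
  moreover have "vx (T.rep x) = v"
    unfolding x_def T.rep_mult M_def[symmetric] B(2) C vx_mult_eq_iff[OF M] by (rule ys(2)[symmetric])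
  moreover have "vx (I.rep x) = w"
    unfolding x_def I.rep_mult xs(2) by (rule I.vx_mult_cong[OF MI qprod_NB_fixed[OF ys(1)]])
  ultimately show ?thesis by (intro exI[of _ x]) (simp only: simp_thms)
qed

end


section \<open>Torsion freeness\<close>

text \<open>Coordinates of powers of \<open>x0 + v\<close> with respect to \<open>1\<close> and \<open>v\<close>, where \<open>v\<^sup>2 = d\<close>.\<close>

primrec pow_coords :: "'k::comm_ring_1 \<Rightarrow> 'k \<Rightarrow> nat \<Rightarrow> 'k \<times> 'k" where
  "pow_coords d x 0 = (1, 0)"
| "pow_coords d x (Suc n) = (let (P, S) = pow_coords d x n in (P * x + S * d, P + S * x))"

lemma pow_coords_root:
  assumes "s * s = d"
  shows "fst (pow_coords d x n) + snd (pow_coords d x n) * s = (x + s) ^ n"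
    and "fst (pow_coords d x n) - snd (pow_coords d x n) * s = (x - s) ^ n"
proof -
  show "fst (pow_coords d x n) + snd (pow_coords d x n) * s = (x + s) ^ n"
  proof (induction n)
    case (Suc n)
    obtain P S where PS: "pow_coords d x n = (P, S)" by (cases "pow_coords d x n")
    have "(x + s) ^ Suc n = (P + S * s) * (x + s)" using Suc by (simp add: PS mult.commute)
    also have "\<dots> = P * x + S * (s * s) + (P + S * x) * s" by (simp add: algebra_simps)
    finally show ?case by (simp add: PS assms)
  qed simp
  show "fst (pow_coords d x n) - snd (pow_coords d x n) * s = (x - s) ^ n"
  proof (induction n)
    case (Suc n)
    obtain P S where PS: "pow_coords d x n = (P, S)" by (cases "pow_coords d x n")
    have "(x - s) ^ Suc n = (P - S * s) * (x - s)" using Suc by (simp add: PS mult.commute)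
    also have "\<dots> = P * x + S * (s * s) - (P + S * x) * s" by (simp add: algebra_simps)
    finally show ?case by (simp add: PS assms)
  qed simp
qed

lemma pow_coords_hom:
  assumes "f 1 = 1" "f 0 = 0" "\<And>x y. f (x + y) = f x + f y" "\<And>x y. f (x * y) = f x * f y"
  shows "pow_coords (f d) (f x) n = (f (fst (pow_coords d x n)), f (snd (pow_coords d x n)))"
proof (induction n)
  case (Suc n)
  obtain P S where PS: "pow_coords d x n = (P, S)" by (cases "pow_coords d x n")
  show ?case using Suc by (simp add: PS assms)
qed (simp add: assms)

text \<open>At a root of \<open>d\<close> the element v has square 0, and (x + v)^n = x^n + n x^(n -
  1) v.\<close>

lemma pow_coords_at_root:
  assumes "poly d r = 0"
  shows "poly (fst (pow_coords d x n)) r = poly x r ^ n"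
    and "poly (snd (pow_coords d x n)) r = of_nat n * poly x r ^ (n - 1)"
proof -
  \<comment> \<open>Multiplied by the value of \<open>x\<close>, the second formula avoids the
    exponent \<open>n - 1\<close> in the induction.\<close>
  have *: "poly (fst (pow_coords d x n)) r = poly x r ^ n \<and>
      poly (snd (pow_coords d x n)) r * poly x r = of_nat n * poly x r ^ n" for n
  proof (induction n)
    case (Suc n)
    obtain P S where PS: "pow_coords d x n = (P, S)" by (cases "pow_coords d x n")
    show ?case using Suc assms by (simp add: PS algebra_simps)
  qed simp
  then show "poly (fst (pow_coords d x n)) r = poly x r ^ n" by simp
  show "poly (snd (pow_coords d x n)) r = of_nat n * poly x r ^ (n - 1)"
  proof (cases n)
    case (Suc k)
    obtain P S where PS: "pow_coords d x k = (P, S)" by (cases "pow_coords d x k")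
    show ?thesis using *[of k] by (simp add: PS Suc algebra_simps)
  qed simp
qed

lemma quat_power_coords:
  assumes d: "d = a * x1 ^ 2 + b * x2 ^ 2 - a * b * x3 ^ 2"
    and ps: "pow_coords d x0 n = (P, S)"
  shows "((\<lambda>q. quat_mult a b q (Quat x0 x1 x2 x3)) ^^ n) (quat_scalar 1) = Quat P (S * x1) (S * x2) (S * x3)"
  using ps
proof (induction n arbitrary: P S)
  case 0
  then show ?case by (simp add: quat_scalar_def)
next
  case (Suc n)
  obtain P' S' where PS: "pow_coords d x0 n = (P', S')" by (cases "pow_coords d x0 n")
  then have "P = P' * x0 + S' * d" "S = P' + S' * x0" using Suc.prems by simp_all
  then show ?case using Suc.IH[OF PS] by (simp add: d algebra_simps power2_eq_square)
qed

text \<open>The second coordinate vanishes exactly when (x + s)^n = (x - s)^n. If the characteristic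
  divides \<open>n\<close>, injectivity of Frobenius gives the same equation for the quotient. The
  resulting \<open>k\<close> is not 0, since the characteristic divides 0.\<close>

lemma pow_coords_zero_descent:
  fixes x d s :: "'k::field"
  assumes s: "s * s = d" "s \<noteq> 0" and 2: "(2 :: 'k) \<noteq> 0" and p: "prime CHAR('k)"
    and "snd (pow_coords d x n) = 0" "n > 0"
  shows "\<exists>k. \<not> CHAR('k) dvd k \<and> snd (pow_coords d x k) = 0"
  using assms(5,6)
proof (induction n rule: less_induct)
  case (less n)
  show ?case
  proof (cases "CHAR('k) dvd n")
    case True
    then obtain k where k: "n = k * CHAR('k)" by (metis dvd_def mult.commute)
    have "1 < CHAR('k)" using p prime_gt_1_nat by blast
    then have kn: "0 < k" "k < n" using less.prems(2) k by auto
    have "(x + s) ^ n = (x - s) ^ n"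
      using pow_coords_root[OF s(1), of x n] less.prems(1) by simp
    then have eq: "((x + s) ^ k) ^ CHAR('k) = ((x - s) ^ k) ^ CHAR('k)" by (simp add: k power_mult)
    define u where "u = (x + s) ^ k - (x - s) ^ k"
    have "((x + s) ^ k) ^ CHAR('k) = u ^ CHAR('k) + ((x - s) ^ k) ^ CHAR('k)"
      using freshmans_dream[OF p HOL.refl, of u "(x - s) ^ k"] by (simp add: u_def)
    then have "u ^ CHAR('k) = 0" using eq by simp
    then have "u = 0" by simp
    then have "(x + s) ^ k - (x - s) ^ k = 0" by (simp add: u_def)
    then have "2 * (snd (pow_coords d x k) * s) = 0"
      unfolding pow_coords_root[OF s(1), symmetric] by (simp add: algebra_simps)
    then have "snd (pow_coords d x k) = 0" using 2 s(2) by simp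
    then show ?thesis by (rule less.IH[OF kn(2) _ kn(1)])
  next
    case False
    then show ?thesis using less.prems by blast
  qed
qed

lemma CHAR_eq_of_inj_hom:
  fixes f :: "'k::comm_ring_1 \<Rightarrow> 'l::comm_ring_1"
  assumes "\<And>n. f (of_nat n) = of_nat n" "f 0 = 0" "inj f"
  shows "CHAR('l) = CHAR('k)"
proof (rule CHAR_eqI)
  have "of_nat CHAR('k) = f (of_nat CHAR('k))" by (rule assms(1)[symmetric])
  then show "of_nat CHAR('k) = (0 :: 'l)" by (simp only: of_nat_CHAR assms(2))
  fix n assume "of_nat n = (0 :: 'l)"
  then have "f (of_nat n) = f 0" by (simp only: assms(1,2))
  then have "of_nat n = (0 :: 'k)" by (rule injD[OF assms(3)])
  then show "CHAR('k) dvd n" by (simp only: of_nat_eq_0_iff_char_dvd)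
qed

text \<open>\<open>D\<close> is ramified at \<open>t = 0\<close>: the pure quaternions have no isotropic vector there.\<close>

lemma pure_norm_anisotropic:
  fixes p1 p2 p3 m :: "'a::field poly"
  assumes c: "\<nexists>x. x ^ 2 = c" and m: "poly m 0 \<noteq> 0"
    and eq: "[:c:] * p1 ^ 2 + [:0, 1:] * (m * (p2 ^ 2 - [:c:] * p3 ^ 2)) = 0"
  shows "p1 = 0 \<and> p2 = 0 \<and> p3 = 0"
proof -
  define l :: "'a poly" where "l = [:0, 1:]"
  have l: "poly l 0 = 0" "l \<noteq> 0" by (simp_all add: l_def)
  have c0: "c \<noteq> 0" using c by (metis power_zero_numeral)
  have dvd: "l dvd p \<longleftrightarrow> poly p 0 = 0" for p using poly_eq_0_iff_dvd[of p 0] by (simp add: l_def)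
  \<comment> \<open>Infinite descent: reduction at 0 kills \<open>p1\<close>; after division by
    \<open>l\<close> the anisotropic norm form kills \<open>p2\<close> and \<open>p3\<close>; the
    three quotients satisfy the original equation.\<close>
  have step: "l ^ n dvd p1 \<and> l ^ n dvd p2 \<and> l ^ n dvd p3"
    if "[:c:] * p1 ^ 2 + l * (m * (p2 ^ 2 - [:c:] * p3 ^ 2)) = 0" for n p1 p2 p3
    using that
  proof (induction n arbitrary: p1 p2 p3)
    case (Suc n)
    have "poly ([:c:] * p1 ^ 2 + l * (m * (p2 ^ 2 - [:c:] * p3 ^ 2))) 0 = 0" unfolding Suc.prems by simp
    then have "poly p1 0 = 0" using c0 by (simp add: l)
    then obtain r1 where r1: "p1 = l * r1" unfolding dvd[symmetric] by (rule dvdE)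
    have "l * ([:c:] * (l * r1 ^ 2) + m * (p2 ^ 2 - [:c:] * p3 ^ 2)) = 0"
      using Suc.prems unfolding r1 by (simp add: power2_eq_square algebra_simps)
    then have eq2: "[:c:] * (l * r1 ^ 2) + m * (p2 ^ 2 - [:c:] * p3 ^ 2) = 0" using l(2) by (simp only: mult_eq_0_iff simp_thms)
    have "poly ([:c:] * (l * r1 ^ 2) + m * (p2 ^ 2 - [:c:] * p3 ^ 2)) 0 = 0" unfolding eq2 by simp
    then have "nrm c (poly p2 0) (poly p3 0) = 0" using m by (simp add: l nrm_def)
    then have "poly p2 0 = 0" "poly p3 0 = 0" by (simp_all add: nrm_eq_0_iff[OF c])
    then obtain r2 r3 where r: "p2 = l * r2" "p3 = l * r3" unfolding dvd[symmetric] by (elim dvdE)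
    have "l * ([:c:] * r1 ^ 2 + l * (m * (r2 ^ 2 - [:c:] * r3 ^ 2))) = 0"
      using eq2 unfolding r by (simp add: power2_eq_square algebra_simps)
    then have "[:c:] * r1 ^ 2 + l * (m * (r2 ^ 2 - [:c:] * r3 ^ 2)) = 0" using l(2) by (simp only: mult_eq_0_iff simp_thms)
    from Suc.IH[OF this] show ?case unfolding r r1 power_Suc by (simp only: mult_dvd_mono dvd_refl simp_thms)
  qed simp
  have "p = 0" if "\<And>n. l ^ n dvd p" for p
  proof (rule ccontr)
    assume "p \<noteq> 0"
    have "degree (l ^ Suc (degree p)) \<le> degree p" using that \<open>p \<noteq> 0\<close> by (rule dvd_imp_degree_le)
    then show False by (simp add: l_def degree_power_eq)
  qed
  then show ?thesis using step[OF eq[folded l_def]] by blast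
qed

context quat_lattice
begin

section \<open>Reduction at the ramified place t = 1\<close>

definition Bp :: "'a poly" where
  "Bp = [:0, 1:] * [:-1, 1:]"

lemma D_b_Bp: "D_b = rf Bp"
  unfolding Bp_def by (rule D_b_rf)

definition qp :: "'a poly \<Rightarrow> 'a poly \<Rightarrow> 'a poly \<Rightarrow> 'a poly \<Rightarrow> 'a poly fract quat" where
  "qp p0 p1 p2 p3 = Quat (rf p0) (rf p1) (rf p2) (rf p3)"

text \<open>\<open>Bp\<close> vanishes at 1, so there the scalar and Z-coordinates of a product
  depend only on those of the factors. Each generator contributes the value \<open>c\<close> of ct
  and no Z-part.\<close>

lemma qprod_reduction_at_1:
  "\<exists>p0 p1 p2 p3. qprod c zs = qp p0 p1 p2 p3 \<and> poly p0 1 \<noteq> 0 \<and> poly p1 1 = 0"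
proof (induction zs)
  case Nil
  show ?case by (intro exI[of _ 1] exI[of _ 0]) (simp add: qp_def quat_scalar_def)
next
  case (Cons a zs)
  then obtain p0 p1 p2 p3 where p: "qprod c zs = qp p0 p1 p2 p3" "poly p0 1 \<noteq> 0" "poly p1 1 = 0" by blast
  obtain x y where a: "a = (x, y)" by (cases a)
  have g: "gq c x y = Quat (rf [:0, c:]) 0 (rf [:- (c * y):]) (rf [:- x:])"
  proof -
    have "[:c:] * [:0, 1:] = [:0, c:]" by simp
    then have "ratfun_const c * ratfun_t = rf [:0, c:]" unfolding ratfun_const_rf ratfun_t_rf rf_simps(2)[symmetric] by simp
    moreover have "- ratfun_const (c * y) = rf [:- (c * y):]" "- ratfun_const x = rf [:- x:]"
      unfolding ratfun_const_rf rf_simps(3)[symmetric] by simp_all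
    ultimately show ?thesis unfolding gq_def by simp
  qed
  define q0 where "q0 = [:0, c:] * p0 + Bp * [:- (c * y):] * p2 - [:c:] * Bp * [:- x:] * p3"
  define q1 where "q1 = [:0, c:] * p1 - Bp * [:- (c * y):] * p3 + Bp * [:- x:] * p2"
  define q2 where "q2 = [:0, c:] * p2 + [:- (c * y):] * p0 - [:c:] * [:- x:] * p1"
  define q3 where "q3 = [:0, c:] * p3 + [:- x:] * p0 - [:- (c * y):] * p1"
  have "qprod c (a # zs) = qp q0 q1 q2 q3"
    unfolding qprod_simps p(1) a fst_conv snd_conv g qp_def q0_def q1_def q2_def q3_def D_b_Bp ratfun_const_rf
    by (simp only: quat_mult.simps rf_simps mult_zero_left mult_zero_right add_0_right add_0_left diff_0_right)
  moreover have "poly Bp 1 = 0" by (simp add: Bp_def)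
  then have "poly q0 1 = c * poly p0 1" "poly q1 1 = c * poly p1 1"
    by (simp_all add: q0_def q1_def)
  ultimately show ?case using p T.c_nonzero by (intro exI[of _ q0] exI[of _ q1] exI[of _ q2] exI[of _ q3]) simp
qed

lemma Gamma_set_poly:
  assumes "g \<in> Gamma_set c \<tau>"
  shows "\<exists>p0 p1 p2 p3. g = GK_class c (qp p0 p1 p2 p3) \<and> nrdD (qp p0 p1 p2 p3) \<noteq> 0 \<and>
    poly p0 1 \<noteq> 0 \<and> poly p1 1 = 0"
proof -
  obtain u where u: "u \<in> lists (SS \<times> UNIV)" "val u = g"
    using G.word_val_generate[OF gen_value_in] assms unfolding Gamma_set_eq by blast
  obtain xs ys where n: "xs \<in> lists NA" "ys \<in> lists NB" "u \<approx> map LA xs @ map LB ys"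
    using normal_form[OF u(1)] by blast
  have "g = GK_class c (qprod c (xs @ ys))"
    using val_normal_form[OF n(3,1,2)] u(2) by (simp add: qprod_append)
  moreover have "nrdD (qprod c (xs @ ys)) \<noteq> 0"
    unfolding qprod_append nrd_mult using nrd_qprod_NA[OF n(1)] nrd_qprod_NB[OF n(2)] by simp
  ultimately show ?thesis using qprod_reduction_at_1[of "xs @ ys"] by metis
qed

lemma GK_power:
  assumes "nrdD x \<noteq> 0"
  shows "GK_class c x [^]\<^bsub>GK c\<^esub> (n :: nat) = GK_class c (((\<lambda>q. mulD q x) ^^ n) (quat_scalar 1)) \<and>
    nrdD (((\<lambda>q. mulD q x) ^^ n) (quat_scalar 1)) \<noteq> 0"
proof (induction n)
  case 0
  show ?case by (simp add: GK_one)
next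
  case (Suc n)
  then show ?case using assms by (simp add: GK_mult nrd_mult)
qed

theorem Gamma_torsion_free: "torsion_free (Gamma c \<tau>)"
  unfolding torsion_free_def
proof (intro ballI allI impI)
  fix g and n :: nat
  assume g: "g \<in> carrier (Gamma c \<tau>)" and n: "n > 0 \<and> g [^]\<^bsub>Gamma c \<tau>\<^esub> n = \<one>\<^bsub>Gamma c \<tau>\<^esub>"
  have g': "g \<in> Gamma_set c \<tau>" using g by (simp add: Gamma_def)
  have pow: "g [^]\<^bsub>GK c\<^esub> n = \<one>\<^bsub>GK c\<^esub>" using n by (simp add: Gamma_def nat_pow_def)
  obtain p0 p1 p2 p3 where p: "g = GK_class c (qp p0 p1 p2 p3)" "nrdD (qp p0 p1 p2 p3) \<noteq> 0"
      "poly p0 1 \<noteq> 0" "poly p1 1 = 0"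
    using Gamma_set_poly[OF g'] by blast
  \<comment> \<open>The square of the pure part v, so that (p0 + v)^k = \<open>P k\<close> +
    \<open>S k\<close> v.\<close>
  define d where "d = [:c:] * p1 ^ 2 + Bp * p2 ^ 2 - [:c:] * Bp * p3 ^ 2"
  define S where "S = (\<lambda>k. snd (pow_coords d p0 k))"
  define P where "P = (\<lambda>k. fst (pow_coords d p0 k))"
  have rfd: "pow_coords (rf d) (rf p0) k = (rf (P k), rf (S k))" for k
    unfolding P_def S_def by (rule pow_coords_hom) simp_all
  have "((\<lambda>q. mulD q (qp p0 p1 p2 p3)) ^^ n) (quat_scalar 1) = Quat (rf (P n)) (rf (S n) * rf p1) (rf (S n) * rf p2) (rf (S n) * rf p3)"
    unfolding qp_def
    by (rule quat_power_coords[OF _ rfd]) (simp only: d_def rf_simps rf_power D_b_Bp ratfun_const_rf)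
  moreover have "GK_class c (((\<lambda>q. mulD q (qp p0 p1 p2 p3)) ^^ n) (quat_scalar 1)) = GK_class c (quat_scalar 1)"
    using GK_power[OF p(2), of n] pow p(1) GK_one by metis
  ultimately obtain s where s: "Quat (rf (P n)) (rf (S n) * rf p1) (rf (S n) * rf p2) (rf (S n) * rf p3) = quat_smult s (quat_scalar 1)"
    unfolding GK_eq_iff by metis
  have zero: "p1 = 0 \<and> p2 = 0 \<and> p3 = 0" if "d = 0"
  proof (rule pure_norm_anisotropic[OF T.nonsquare])
    show "poly [:-1, 1:] (0 :: 'a) \<noteq> 0" by simp
    have "[:c:] * p1 ^ 2 + [:0, 1:] * ([:-1, 1:] * (p2 ^ 2 - [:c:] * p3 ^ 2)) =
        [:c:] * p1 ^ 2 + Bp * p2 ^ 2 - [:c:] * Bp * p3 ^ 2"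
      unfolding Bp_def by (simp only: algebra_simps)
    also have "\<dots> = 0" using that unfolding d_def .
    finally show "[:c:] * p1 ^ 2 + [:0, 1:] * ([:-1, 1:] * (p2 ^ 2 - [:c:] * p3 ^ 2)) = 0" .
  qed
  have "p1 = 0 \<and> p2 = 0 \<and> p3 = 0"
  proof (rule ccontr)
    assume nz: "\<not> (p1 = 0 \<and> p2 = 0 \<and> p3 = 0)"
    then have d: "d \<noteq> 0" using zero by blast
    have "rf (S n) * rf p1 = 0" "rf (S n) * rf p2 = 0" "rf (S n) * rf p3 = 0"
      using s by (simp_all add: quat_scalar_def)
    then have Sn: "S n = 0" using nz by auto
    \<comment> \<open>The powers of p0 + v are read in a commutative field with v replaced by the
      root \<open>r\<close>, where Frobenius is available.\<close>
    obtain r :: "'a poly fract alg_closure" where r: "r ^ 2 = to_ac (rf d)"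
      using nth_root_exists[of 2 "to_ac (rf d)"] by auto
    have r0: "r \<noteq> 0" using r d by auto
    have coords: "snd (pow_coords (to_ac (rf d)) (to_ac (rf p0)) k) = to_ac (rf (S k))" for k
      unfolding S_def by (subst pow_coords_hom[where f = "\<lambda>p. to_ac (rf p)"]) simp_all
    have rf_nat: "rf (of_nat k) = of_nat k" for k by (induction k) simp_all
    have "CHAR('a poly fract alg_closure) = CHAR('a poly)"
    proof (rule CHAR_eq_of_inj_hom[where f = "\<lambda>p. to_ac (rf p)"])
      show "inj (\<lambda>p. to_ac (rf p) :: 'a poly fract alg_closure)" by (rule injI) simp
    qed (simp_all add: rf_nat)
    then have CH: "CHAR('a poly fract alg_closure) = CHAR('a)" by simp
    have pr: "prime CHAR('a)" by (rule prime_CHAR_semidom) (simp add: finite_imp_CHAR_pos)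
    have "(2 :: 'a) \<noteq> 0" by (rule two_neq_0_of_nonsquare[OF T.nonsquare])
    then have "of_nat 2 \<noteq> (0 :: 'a)" by simp
    then have "\<not> CHAR('a) dvd 2" unfolding of_nat_eq_0_iff_char_dvd .
    then have "of_nat 2 \<noteq> (0 :: 'a poly fract alg_closure)" unfolding of_nat_eq_0_iff_char_dvd CH .
    then have two: "(2 :: 'a poly fract alg_closure) \<noteq> 0" by simp
    have "\<exists>k. \<not> CHAR('a poly fract alg_closure) dvd k \<and>
        snd (pow_coords (to_ac (rf d)) (to_ac (rf p0)) k) = 0"
    proof (rule pow_coords_zero_descent[of r])
      show "r * r = to_ac (rf d)" using r by (simp add: power2_eq_square)
      show "snd (pow_coords (to_ac (rf d)) (to_ac (rf p0)) n) = 0" by (simp add: coords Sn)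
    qed (use r0 two pr CH n in simp_all)
    then obtain k where k: "\<not> CHAR('a) dvd k" "S k = 0" unfolding CH coords by auto
    \<comment> \<open>So \<open>S k\<close> takes the value k p0(1)^(k - 1) at 1. This is nonzero,
      as \<open>k\<close> is prime to the characteristic, and contradicts
      \<open>S k = 0\<close>.\<close>
    have "poly d 1 = 0" using p(4) by (simp add: d_def Bp_def)
    then have "of_nat k * poly p0 1 ^ (k - 1) = 0"
      using pow_coords_at_root(2)[of d 1 p0 k] k(2) by (simp add: S_def)
    then have "of_nat k = (0 :: 'a)" using p(3) by simp
    then show False using k(1) by (simp add: of_nat_eq_0_iff_char_dvd)
  qed
  then have q: "qp p0 p1 p2 p3 = quat_smult (rf p0) (quat_scalar 1)" by (simp add: qp_def quat_scalar_def)
  moreover have "rf p0 \<noteq> 0" using p(3) by auto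
  ultimately have "GK_class c (qp p0 p1 p2 p3) = GK_class c (quat_scalar 1)" unfolding GK_eq_iff by blast
  then show "g = \<one>\<^bsub>Gamma c \<tau>\<^esub>" using p(1) by (simp add: Gamma_def GK_one)
qed

end


section \<open>Arithmeticity\<close>

context quat_lattice
begin

section \<open>The ring \<open>R_ring \<tau>\<close> and the units of the order over it\<close>

definition Wp :: "'a poly" where
  "Wp = [:0, 1:] * ([:-1, 1:] * [:-\<tau>, 1:])"

lemma Wp_nonzero: "Wp \<noteq> 0"
  by (simp add: Wp_def)

lemma t_minus_const_rf: "ratfun_t - ratfun_const r = rf [:- r, 1:]"
  unfolding ratfun_t_rf ratfun_const_rf rf_simps(4)[symmetric] by simp

lemma t_minus_1_rf: "ratfun_t - 1 = (rf [:-1, 1:] :: 'a poly fract)"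
  using t_minus_const_rf[of 1] by simp

lemma Wp_rf: "ratfun_t * (ratfun_t - 1) * (ratfun_t - ratfun_const \<tau>) = rf Wp"
  unfolding t_minus_const_rf t_minus_1_rf unfolding ratfun_t_rf Wp_def rf_simps(2) by (rule mult.assoc)

lemma R_ring_eq: "R_ring \<tau> = {rf p / rf Wp ^ n | p n. True}"
  unfolding R_ring_def Wp_rf rf_def ..

lemma R_ringI: "x = rf p / rf Wp ^ n \<Longrightarrow> x \<in> R_ring \<tau>"
  unfolding R_ring_eq by blast

lemma R_ring_rf: "rf p \<in> R_ring \<tau>"
  by (rule R_ringI[of _ p 0]) simp

lemma R_ring_mult: "x \<in> R_ring \<tau> \<Longrightarrow> y \<in> R_ring \<tau> \<Longrightarrow> x * y \<in> R_ring \<tau>"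
proof -
  assume "x \<in> R_ring \<tau>" "y \<in> R_ring \<tau>"
  then obtain p n r k where "x = rf p / rf Wp ^ n" "y = rf r / rf Wp ^ k" unfolding R_ring_eq by blast
  then have "x * y = rf (p * r) / rf Wp ^ (n + k)" by (simp add: power_add)
  then show ?thesis by (rule R_ringI)
qed

lemma R_ring_add: "x \<in> R_ring \<tau> \<Longrightarrow> y \<in> R_ring \<tau> \<Longrightarrow> x + y \<in> R_ring \<tau>"
proof -
  assume "x \<in> R_ring \<tau>" "y \<in> R_ring \<tau>"
  then obtain p n r k where "x = rf p / rf Wp ^ n" "y = rf r / rf Wp ^ k" unfolding R_ring_eq by blast
  then have "x + y = rf (p * Wp ^ k + r * Wp ^ n) / rf Wp ^ (n + k)"
    using Wp_nonzero by (simp add: power_add add_frac_eq)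
  then show ?thesis by (rule R_ringI)
qed

lemma R_ring_uminus: "x \<in> R_ring \<tau> \<Longrightarrow> - x \<in> R_ring \<tau>"
proof -
  assume "x \<in> R_ring \<tau>"
  then obtain p n where "x = rf p / rf Wp ^ n" unfolding R_ring_eq by blast
  then have "- x = rf (- p) / rf Wp ^ n" by simp
  then show ?thesis by (rule R_ringI)
qed

lemma R_ring_diff: "x \<in> R_ring \<tau> \<Longrightarrow> y \<in> R_ring \<tau> \<Longrightarrow> x - y \<in> R_ring \<tau>"
  using R_ring_add[of x "- y"] R_ring_uminus[of y] by simp

lemma R_ring_const: "ratfun_const u \<in> R_ring \<tau>" and R_ring_t: "ratfun_t \<in> R_ring \<tau>"
  and R_ring_D_b: "D_b \<in> R_ring \<tau>" and R_ring_0: "0 \<in> R_ring \<tau>" and R_ring_1: "1 \<in> R_ring \<tau>"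
  using R_ring_rf[of "[:u:]"] R_ring_rf[of "[:0, 1:]"] R_ring_rf[of Bp] R_ring_rf[of 0] R_ring_rf[of 1]
  by (simp_all add: ratfun_const_rf ratfun_t_rf D_b_Bp)

lemma R_ring_inverse_t: "inverse ratfun_t \<in> R_ring \<tau>"
  and R_ring_inverse_t_minus: "inverse (ratfun_t - ratfun_const \<tau>) \<in> R_ring \<tau>"
proof -
  have nz: "rf Wp \<noteq> 0" "ratfun_t \<noteq> (0 :: 'a poly fract)" "ratfun_t - ratfun_const \<tau> \<noteq> 0"
    using Wp_nonzero t_nonzero by simp_all
  have "inverse ratfun_t = rf ([:-1, 1:] * [:-\<tau>, 1:]) / rf Wp ^ 1"
    using nz unfolding Wp_def rf_simps(2)[of "[:0, 1:]"] ratfun_t_rf[symmetric] by (simp add: field_simps del: mult_pCons_left mult_pCons_right)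
  then show "inverse ratfun_t \<in> R_ring \<tau>" by (rule R_ringI)
  have "rf Wp = rf ([:0, 1:] * [:-1, 1:]) * (ratfun_t - ratfun_const \<tau>)"
    unfolding t_minus_const_rf rf_simps(2)[symmetric] Wp_def by (simp only: mult.assoc)
  then have "inverse (ratfun_t - ratfun_const \<tau>) = rf ([:0, 1:] * [:-1, 1:]) / rf Wp ^ 1"
    using nz by (simp add: field_simps del: mult_pCons_left mult_pCons_right)
  then show "inverse (ratfun_t - ratfun_const \<tau>) \<in> R_ring \<tau>" by (rule R_ringI)
qed

lemma R_order_iff: "Quat x0 x1 x2 x3 \<in> R_order \<tau> \<longleftrightarrow>
    x0 \<in> R_ring \<tau> \<and> x1 \<in> R_ring \<tau> \<and> x2 \<in> R_ring \<tau> \<and> x3 \<in> R_ring \<tau>"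
  by (simp add: R_order_def)

lemma R_order_mult: "x \<in> R_order \<tau> \<Longrightarrow> y \<in> R_order \<tau> \<Longrightarrow> mulD x y \<in> R_order \<tau>"
  by (cases x; cases y)
     (simp add: R_order_iff R_ring_add R_ring_diff R_ring_mult R_ring_const R_ring_D_b)

lemma R_order_conj: "x \<in> R_order \<tau> \<Longrightarrow> quat_conj x \<in> R_order \<tau>"
  by (cases x) (simp add: R_order_iff R_ring_uminus)

lemma R_order_smult: "s \<in> R_ring \<tau> \<Longrightarrow> x \<in> R_order \<tau> \<Longrightarrow> quat_smult s x \<in> R_order \<tau>"
  by (cases x) (simp add: R_order_iff R_ring_mult)

lemma R_order_1: "quat_scalar 1 \<in> R_order \<tau>"
  by (simp add: quat_scalar_def R_order_iff R_ring_0 R_ring_1)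

abbreviation "Ord \<equiv> (D_alg c)\<lparr>carrier := R_order \<tau>\<rparr>"

lemma monoid_Ord: "Group.monoid Ord"
  by (rule Group.monoidI) (simp_all add: R_order_mult R_order_1 quat_mult_assoc)

lemma Units_Ord: "x \<in> Units Ord \<longleftrightarrow>
    x \<in> R_order \<tau> \<and> (\<exists>y\<in>R_order \<tau>. mulD y x = quat_scalar 1 \<and> mulD x y = quat_scalar 1)"
  by (auto simp: Units_def)

lemma nrd_Units_Ord: "x \<in> Units Ord \<Longrightarrow> nrdD x \<noteq> 0"
  unfolding Units_Ord by (metis nrd_mult nrd_simps(3) mult_zero_right power_one zero_neq_one)

lemma GR_subgroup: "subgroup (GR_set c \<tau>) (GK c)"
proof (rule G.subgroupI)
  show "GR_set c \<tau> \<subseteq> carrier (GK c)"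
    unfolding GR_set_def using GK_closed nrd_Units_Ord by blast
  have "quat_scalar 1 \<in> Units Ord" unfolding Units_Ord by (auto intro!: R_order_1 bexI[of _ "quat_scalar 1"])
  then show "GR_set c \<tau> \<noteq> {}" unfolding GR_set_def by blast
  fix g assume "g \<in> GR_set c \<tau>"
  then obtain x where x: "x \<in> Units Ord" "g = GK_class c x" unfolding GR_set_def by blast
  then obtain y where y: "y \<in> R_order \<tau>" "mulD y x = quat_scalar 1" "mulD x y = quat_scalar 1"
    unfolding Units_Ord by blast
  have yU: "y \<in> Units Ord" using x(1) y unfolding Units_Ord by blast
  have "inv\<^bsub>GK c\<^esub> g = GK_class c y"
    by (rule G.inv_equality)
       (simp_all add: x(2) GK_mult nrd_Units_Ord[OF x(1)] nrd_Units_Ord[OF yU] y(2) GK_one GK_closed)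
  then show "inv\<^bsub>GK c\<^esub> g \<in> GR_set c \<tau>" unfolding GR_set_def using yU by blast
  fix h assume "h \<in> GR_set c \<tau>"
  then obtain z where z: "z \<in> Units Ord" "h = GK_class c z" unfolding GR_set_def by blast
  have "mulD x z \<in> Units Ord" using monoid.Units_m_closed[OF monoid_Ord x(1) z(1)] by simp
  moreover have "g \<otimes>\<^bsub>GK c\<^esub> h = GK_class c (mulD x z)"
    by (simp add: x(2) z(2) GK_mult nrd_Units_Ord[OF x(1)] nrd_Units_Ord[OF z(1)])
  ultimately show "g \<otimes>\<^bsub>GK c\<^esub> h \<in> GR_set c \<tau>" unfolding GR_set_def by blast
qed

lemma unit_of_nrd:
  assumes "x \<in> R_order \<tau>" "nrdD x \<noteq> 0" "inverse (nrdD x) \<in> R_ring \<tau>"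
  shows "x \<in> Units Ord"
  unfolding Units_Ord
  by (auto simp: assms quat_mult_conj intro!: bexI[of _ "quat_smult (inverse (nrdD x)) (quat_conj x)"]
      R_order_smult R_order_conj)

lemma Gamma_subset_GR: "Gamma_set c \<tau> \<subseteq> GR_set c \<tau>"
  unfolding Gamma_set_eq
proof (rule G.generate_subgroup_incl[OF _ GR_subgroup], rule image_subsetI)
  fix s assume "s \<in> SS"
  have R: "gqp c a \<in> R_order \<tau>" for a
    unfolding gq_def R_order_iff by (intro conjI R_ring_mult R_ring_const R_ring_t R_ring_0 R_ring_uminus)
  have inv_const: "inverse (ratfun_const u) \<in> R_ring \<tau>" for u
    using R_ring_const[of "1 / u"] by (simp add: inverse_eq_divide)
  from \<open>s \<in> SS\<close> show "gen_value c s \<in> GR_set c \<tau>"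
  proof (cases rule: pres_gens_cases)
    case (1 a)
    have "inverse (nrdD (gqp c a)) \<in> R_ring \<tau>"
      unfolding nrd_NA[OF 1(1)] inverse_mult_distrib by (intro R_ring_mult inv_const R_ring_inverse_t)
    then have "gqp c a \<in> Units Ord" by (rule unit_of_nrd[OF R nz_NA[OF 1(1)]])
    then show ?thesis unfolding 1(2) gen_value.simps gen_elt_zq GR_set_def by blast
  next
    case (2 a)
    have "inverse (nrdD (gqp c a)) \<in> R_ring \<tau>"
      unfolding nrd_NB[OF 2(1)] inverse_mult_distrib
      by (intro R_ring_mult inv_const R_ring_inverse_t R_ring_inverse_t_minus)
    then have "gqp c a \<in> Units Ord" by (rule unit_of_nrd[OF R nz_NB[OF 2(1)]])
    then show ?thesis unfolding 2(2) gen_value.simps gen_elt_zq GR_set_def by blast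
  qed
qed

section \<open>Polynomial representatives and the stabiliser of the base vertex\<close>

definition Np :: "'a poly \<Rightarrow> 'a poly \<Rightarrow> 'a poly \<Rightarrow> 'a poly \<Rightarrow> 'a poly" where
  "Np p0 p1 p2 p3 = p0 ^ 2 - [:c:] * p1 ^ 2 - Bp * (p2 ^ 2 - [:c:] * p3 ^ 2)"

lemma nrd_qp: "nrdD (qp p0 p1 p2 p3) = rf (Np p0 p1 p2 p3)"
  unfolding qp_def Np_def nrd.simps nrm_def D_b_Bp ratfun_const_rf by (simp only: rf_simps rf_power)

lemma R_order_clear_denominators:
  assumes "x \<in> R_order \<tau>"
  shows "\<exists>n p0 p1 p2 p3. quat_smult (rf Wp ^ n) x = qp p0 p1 p2 p3"
proof -
  obtain x0 x1 x2 x3 where x: "x = Quat x0 x1 x2 x3" by (cases x)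
  obtain p0 n0 p1 n1 p2 n2 p3 n3 where p: "x0 = rf p0 / rf Wp ^ n0" "x1 = rf p1 / rf Wp ^ n1"
      "x2 = rf p2 / rf Wp ^ n2" "x3 = rf p3 / rf Wp ^ n3"
    using assms unfolding x R_order_iff R_ring_eq by blast
  define n where "n = n0 + n1 + n2 + n3"
  have *: "rf Wp ^ n * (rf r / rf Wp ^ k) = rf (Wp ^ (n - k) * r)" if "k \<le> n" for r k
  proof -
    have "rf Wp ^ n = rf Wp ^ (n - k) * rf Wp ^ k" using that by (simp flip: power_add)
    then show ?thesis using Wp_nonzero by simp
  qed
  have "quat_smult (rf Wp ^ n) x = qp (Wp ^ (n - n0) * p0) (Wp ^ (n - n1) * p1) (Wp ^ (n - n2) * p2) (Wp ^ (n - n3) * p3)"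
  proof -
    have "n0 \<le> n" "n1 \<le> n" "n2 \<le> n" "n3 \<le> n" by (simp_all add: n_def)
    then show ?thesis unfolding x p quat_smult.simps qp_def by (simp only: *)
  qed
  then show ?thesis by blast
qed

text \<open>Denominators are cleared in a unit and in its inverse. The two polynomial norms then
  multiply to a power of \<open>Wp\<close>, so each divides it.\<close>

lemma GR_poly:
  assumes "g \<in> GR_set c \<tau>"
  shows "\<exists>p0 p1 p2 p3 k. g = GK_class c (qp p0 p1 p2 p3) \<and> Np p0 p1 p2 p3 dvd Wp ^ k"
proof -
  obtain x where x: "x \<in> Units Ord" "g = GK_class c x" using assms unfolding GR_set_def by blast
  then obtain y where y: "x \<in> R_order \<tau>" "y \<in> R_order \<tau>" "mulD x y = quat_scalar 1"
    unfolding Units_Ord by blast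
  obtain n p0 p1 p2 p3 where p: "quat_smult (rf Wp ^ n) x = qp p0 p1 p2 p3"
    using R_order_clear_denominators[OF y(1)] by blast
  obtain k r0 r1 r2 r3 where r: "quat_smult (rf Wp ^ k) y = qp r0 r1 r2 r3"
    using R_order_clear_denominators[OF y(2)] by blast
  have "mulD (qp p0 p1 p2 p3) (qp r0 r1 r2 r3) = quat_scalar (rf Wp ^ n * rf Wp ^ k)"
    unfolding p[symmetric] r[symmetric] by (simp add: y(3) mult.commute)
  then have "nrdD (qp p0 p1 p2 p3) * nrdD (qp r0 r1 r2 r3) = (rf Wp ^ n * rf Wp ^ k) ^ 2"
    by (metis nrd_mult nrd_simps(3))
  then have "rf (Np p0 p1 p2 p3 * Np r0 r1 r2 r3) = rf (Wp ^ (2 * (n + k)))"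
    unfolding nrd_qp by (simp add: power_mult power_add mult.commute power_mult_distrib power2_eq_square)
  then have "Np p0 p1 p2 p3 * Np r0 r1 r2 r3 = Wp ^ (2 * (n + k))" unfolding rf_simps(7) .
  then have "Np p0 p1 p2 p3 dvd Wp ^ (2 * (n + k))" by (metis dvd_triv_left)
  moreover have "g = GK_class c (qp p0 p1 p2 p3)"
  proof -
    have "qp p0 p1 p2 p3 = quat_smult (rf Wp ^ n) x" "rf Wp ^ n \<noteq> 0" using p Wp_nonzero by simp_all
    then have "GK_class c (qp p0 p1 p2 p3) = GK_class c x" unfolding GK_eq_iff by blast
    then show ?thesis using x(2) by simp
  qed
  ultimately show ?thesis by blast
qed

definition vanish :: "'a \<Rightarrow> 'a poly \<Rightarrow> 'a poly \<Rightarrow> 'a poly \<Rightarrow> 'a poly \<Rightarrow> bool" where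
  "vanish r p0 p1 p2 p3 \<longleftrightarrow> poly p0 r = 0 \<and> poly p1 r = 0 \<and> poly p2 r = 0 \<and> poly p3 r = 0"

text \<open>Dividing out a common linear factor lowers the degree of the norm by 2. Linear factors
  are enough: any common factor divides the norm, hence a power of \<open>Wp\<close>, which splits
  over the constants.\<close>

lemma primitive_rep:
  assumes "Np p0 p1 p2 p3 dvd Wp ^ k"
  shows "\<exists>q0 q1 q2 q3. GK_class c (qp q0 q1 q2 q3) = GK_class c (qp p0 p1 p2 p3) \<and>
    Np q0 q1 q2 q3 dvd Wp ^ k \<and> (\<forall>r. \<not> vanish r q0 q1 q2 q3)"
  using assms
proof (induction "degree (Np p0 p1 p2 p3)" arbitrary: p0 p1 p2 p3 rule: less_induct)
  case less
  show ?case
  proof (cases "\<forall>r. \<not> vanish r p0 p1 p2 p3")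
    case True
    then show ?thesis using less.prems by blast
  next
    case False
    then obtain r where v: "vanish r p0 p1 p2 p3" by blast
    define l where "l = [:- r, 1:]"
    have l: "l \<noteq> 0" "degree l = 1" by (simp_all add: l_def)
    obtain q0 q1 q2 q3 where q: "p0 = l * q0" "p1 = l * q1" "p2 = l * q2" "p3 = l * q3"
      using v unfolding vanish_def poly_eq_0_iff_dvd l_def[symmetric] by (elim conjE dvdE)
    have N: "Np p0 p1 p2 p3 = l ^ 2 * Np q0 q1 q2 q3"
      unfolding q Np_def by (simp add: power_mult_distrib algebra_simps)
    have nz: "Np p0 p1 p2 p3 \<noteq> 0" using less.prems Wp_nonzero by auto
    then have nz': "Np q0 q1 q2 q3 \<noteq> 0" using N by auto
    then have "degree (Np p0 p1 p2 p3) = 2 + degree (Np q0 q1 q2 q3)"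
      unfolding N using l by (simp add: degree_mult_eq degree_power_eq)
    then have less': "degree (Np q0 q1 q2 q3) < degree (Np p0 p1 p2 p3)" by simp
    have dvd: "Np q0 q1 q2 q3 dvd Wp ^ k" using less.prems unfolding N by (rule dvd_mult_right)
    have "qp p0 p1 p2 p3 = quat_smult (rf l) (qp q0 q1 q2 q3)" unfolding q qp_def by simp
    moreover have "rf l \<noteq> 0" using l by simp
    ultimately have "GK_class c (qp p0 p1 p2 p3) = GK_class c (qp q0 q1 q2 q3)"
      unfolding GK_eq_iff by blast
    then show ?thesis using less.hyps[OF less' dvd] by simp
  qed
qed

text \<open>At the places \<open>t = 0\<close> and \<open>t = 1\<close> the algebra \<open>D\<close> is ramified.\<close>

lemma Np_simple_root:
  assumes Bp: "Bp = [:- r, 1:] * m" "poly m r \<noteq> 0"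
    and prim: "\<not> vanish r p0 p1 p2 p3"
  shows "\<not> [:- r, 1:] ^ 2 dvd Np p0 p1 p2 p3"
proof
  define l where "l = [:- r, 1:]"
  have l: "l \<noteq> 0" "poly l r = 0" by (simp_all add: l_def)
  have dvd: "l dvd p \<longleftrightarrow> poly p r = 0" for p unfolding l_def poly_eq_0_iff_dvd ..
  assume "[:- r, 1:] ^ 2 dvd Np p0 p1 p2 p3"
  then obtain E where E: "Np p0 p1 p2 p3 = l ^ 2 * E" unfolding l_def[symmetric] by (rule dvdE)
  \<comment> \<open>Two reductions at \<open>r\<close>: the first makes \<open>p0\<close> and
    \<open>p1\<close> vanish there; after division by \<open>l\<close> the second does the same for
    \<open>p2\<close> and \<open>p3\<close>, against primitivity.\<close>
  have "poly (Np p0 p1 p2 p3) r = 0" unfolding E by (simp add: l)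
  then have "nrm c (poly p0 r) (poly p1 r) = 0" unfolding Np_def Bp(1) l_def[symmetric] by (simp add: l nrm_def)
  then have 01: "poly p0 r = 0" "poly p1 r = 0" by (simp_all add: nrm_eq_0_iff[OF T.nonsquare])
  then obtain q0 q1 where q: "p0 = l * q0" "p1 = l * q1" unfolding dvd[symmetric] by (elim dvdE)
  have "l * (l * E) = l * (l * (q0 ^ 2 - [:c:] * q1 ^ 2) - m * (p2 ^ 2 - [:c:] * p3 ^ 2))"
    using E unfolding Np_def Bp(1) l_def[symmetric] q by (simp add: power2_eq_square algebra_simps)
  then have "l * E = l * (q0 ^ 2 - [:c:] * q1 ^ 2) - m * (p2 ^ 2 - [:c:] * p3 ^ 2)"
    unfolding mult_cancel_left using l by blast
  then have "poly (l * E) r = poly (l * (q0 ^ 2 - [:c:] * q1 ^ 2) - m * (p2 ^ 2 - [:c:] * p3 ^ 2)) r" by simp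
  then have "nrm c (poly p2 r) (poly p3 r) = 0" using Bp(2) by (simp add: l nrm_def)
  then have "poly p2 r = 0" "poly p3 r = 0" by (simp_all add: nrm_eq_0_iff[OF T.nonsquare])
  then show False using prim 01 by (simp add: vanish_def)
qed

lemma dvd_linear_mult:
  fixes p :: "'a poly"
  assumes "p dvd [:- r, 1:] * e" "poly p r \<noteq> 0"
  shows "p dvd e"
proof -
  obtain h where h: "[:- r, 1:] * e = p * h" using assms(1) by (rule dvdE)
  have "poly ([:- r, 1:] * e) r = 0" by simp
  then have "poly h r = 0" using assms(2) unfolding h by simp
  then obtain h' where "h = [:- r, 1:] * h'" unfolding poly_eq_0_iff_dvd by (rule dvdE)
  then have "[:- r, 1:] * e = [:- r, 1:] * (p * h')" using h by (simp only: mult.left_commute)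
  then have "e = p * h'" unfolding mult_cancel_left by simp
  then show ?thesis by simp
qed

lemma dvd_Wp_power:
  assumes "p dvd Wp ^ k" "poly p 0 \<noteq> 0" "poly p 1 \<noteq> 0" "poly p \<tau> \<noteq> 0"
  shows "degree p = 0"
proof -
  have "p dvd 1"
    using assms(1)
  proof (induction k)
    case (Suc k)
    have "p dvd [:- 0, 1:] * ([:- 1, 1:] * ([:- \<tau>, 1:] * Wp ^ k))"
      using Suc.prems unfolding power_Suc Wp_def by (simp only: mult.assoc minus_zero)
    then have "p dvd Wp ^ k" using assms(2-4) by (blast dest: dvd_linear_mult)
    then show ?case by (rule Suc.IH)
  qed simp
  then have "degree p \<le> degree (1 :: 'a poly)" by (rule dvd_imp_degree_le) simp
  then show ?thesis by simp
qed

text \<open>The last two clauses keep the hypotheses available for a second application at another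
  root.\<close>

lemma strip_simple_root:
  assumes "\<not> [:- r, 1:] ^ 2 dvd p" "p \<noteq> (0 :: 'a poly)"
  shows "\<exists>q. q dvd p \<and> poly q r \<noteq> 0 \<and> degree p \<le> degree q + 1 \<and> (\<forall>s. poly p s \<noteq> 0 \<longrightarrow> poly q s \<noteq> 0)
     \<and> (\<forall>s. \<not> [:- s, 1:] ^ 2 dvd p \<longrightarrow> \<not> [:- s, 1:] ^ 2 dvd q)"
proof (cases "poly p r = 0")
  case True
  then obtain q where q: "p = [:- r, 1:] * q" unfolding poly_eq_0_iff_dvd by (rule dvdE)
  have "poly q r \<noteq> 0"
  proof
    assume "poly q r = 0"
    then obtain h where "q = [:- r, 1:] * h" unfolding poly_eq_0_iff_dvd by (rule dvdE)
    then have "p = [:- r, 1:] ^ 2 * h" unfolding q power2_eq_square by (simp only: mult.assoc)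
    then show False using assms(1) by simp
  qed
  moreover have "degree p \<le> degree q + 1" unfolding q using degree_mult_le[of "[:- r, 1:]" q] by simp
  moreover have "q dvd p" unfolding q by (rule dvd_triv_right)
  moreover have "\<forall>s. poly p s \<noteq> 0 \<longrightarrow> poly q s \<noteq> 0" unfolding q by simp
  ultimately show ?thesis by (intro exI[of _ q]) (blast intro: dvd_trans)
next
  case False
  then show ?thesis by (intro exI[of _ p]) simp
qed

lemma embed_at_rf: "embed_at \<tau> (rf p) \<in> val_ring" "fls_nth (embed_at \<tau> (rf p)) 0 = poly p \<tau>"
proof -
  have eq: "embed_at \<tau> (rf p) = fps_to_fls (fps_of_poly (p \<circ>\<^sub>p [:\<tau>, 1:]))"
    unfolding rf_def by (subst embed_at_Fract) (simp_all add: poly_fls_shift)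
  show "embed_at \<tau> (rf p) \<in> val_ring" unfolding eq val_ring_def by blast
  show "fls_nth (embed_at \<tau> (rf p)) 0 = poly p \<tau>"
    unfolding eq by (simp add: poly_pcompose flip: poly_0_coeff_0)
qed

lemma fls_nth_0_of_divisible: "Xp (- 1) * f \<in> val_ring \<Longrightarrow> fls_nth f 0 = 0"
  by (cases "f = 0") (simp_all add: val_ring_iff)

lemma subdegree_embed_infinity: "p \<noteq> 0 \<Longrightarrow> fls_subdegree (embed_infinity (rf p)) = - int (degree p)"
proof -
  assume p: "p \<noteq> 0"
  have eq: "embed_infinity (rf p) = poly_fls fls_X_inv p"
    unfolding rf_def by (subst embed_infinity_Fract) simp_all
  have nth: "fls_nth (poly_fls fls_X_inv p) k = (if k \<le> 0 then coeff p (nat (- k)) else 0)" for k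
  proof -
    have "fls_nth (poly_fls fls_X_inv p) k = (\<Sum>i\<le>degree p. if int i = - k then coeff p i else 0)"
      unfolding poly_fls_altdef fls_nth_sum by (intro sum.cong) auto
    also have "\<dots> = (if k \<le> 0 then coeff p (nat (- k)) else 0)"
    proof (cases "k \<le> 0")
      case True
      then have "(\<Sum>i\<le>degree p. if int i = - k then coeff p i else 0) =
          (\<Sum>i\<le>degree p. if i = nat (- k) then coeff p i else 0)" by (intro sum.cong) auto
      then show ?thesis using True by (simp add: coeff_eq_0)
    next
      case False
      then have "(\<Sum>i\<le>degree p. if int i = - k then coeff p i else 0) = 0" by (intro sum.neutral) auto
      then show ?thesis using False by simp
    qed
    finally show ?thesis .
  qed
  show ?thesis
    unfolding eq by (rule fls_subdegree_eqI) (use p in \<open>auto simp: nth coeff_eq_0\<close>)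
qed

lemma stabilizer_bounded:
  assumes g: "g \<in> GR_set c \<tau>" and gx: "g = GK_class c x"
    and fixed: "vx (T.rep x) = vx (mat 1)" "vx (I.rep x) = vx (mat 1)"
  shows "\<exists>p0 p1 p2 p3. g = GK_class c (qp p0 p1 p2 p3) \<and>
    degree p0 \<le> 1 \<and> degree p1 \<le> 1 \<and> degree p2 \<le> 1 \<and> degree p3 \<le> 1"
proof -
  obtain q0 q1 q2 q3 k where q: "g = GK_class c (qp q0 q1 q2 q3)" "Np q0 q1 q2 q3 dvd Wp ^ k"
    using GR_poly[OF g] by blast
  obtain p0 p1 p2 p3 where p: "GK_class c (qp p0 p1 p2 p3) = GK_class c (qp q0 q1 q2 q3)"
      "Np p0 p1 p2 p3 dvd Wp ^ k" "\<And>r. \<not> vanish r p0 p1 p2 p3"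
    using primitive_rep[OF q(2)] by blast
  define N where "N = Np p0 p1 p2 p3"
  have gp: "g = GK_class c (qp p0 p1 p2 p3)" using p(1) q(1) by simp
  have N: "N \<noteq> 0" using p(2) Wp_nonzero by (auto simp: N_def)
  have fT: "vx (T.rep (qp p0 p1 p2 p3)) = vx (mat 1)" and fI: "vx (I.rep (qp p0 p1 p2 p3)) = vx (mat 1)"
    using vx_rep_class[of "qp p0 p1 p2 p3" x] gp gx fixed by simp_all
  have dT: "det (T.rep (qp p0 p1 p2 p3)) = embed_at \<tau> (rf N)" "embed_at \<tau> (rf N) \<noteq> 0"
    and dI: "det (I.rep (qp p0 p1 p2 p3)) = embed_infinity (rf N)" "embed_infinity (rf N) \<noteq> 0"
    using N by (simp_all add: T.det_rep I.det_rep nrd_qp N_def)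
  \<comment> \<open>If \<open>N\<close> vanished at \<tau>, the factor \<open>s\<close> that makes
    the matrix integral would have valuation at most -1, and all four coordinates would be divisible
    by t - \<tau>, against primitivity.\<close>
  have "poly N \<tau> \<noteq> 0"
  proof
    assume "poly N \<tau> = 0"
    then have "fls_nth (embed_at \<tau> (rf N)) 0 = 0" by (simp add: embed_at_rf)
    moreover have "0 \<le> fls_subdegree (embed_at \<tau> (rf N))"
      using embed_at_rf(1)[of N] by (simp add: val_ring_iff)
    moreover have "fls_nth (embed_at \<tau> (rf N)) (fls_subdegree (embed_at \<tau> (rf N))) \<noteq> 0"
      using dT(2) by (rule nth_fls_subdegree_nonzero)
    ultimately have pos: "0 < fls_subdegree (embed_at \<tau> (rf N))" by (cases "fls_subdegree (embed_at \<tau> (rf N)) = 0") auto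
    have "det (T.rep (qp p0 p1 p2 p3)) \<noteq> 0" unfolding dT(1) by (rule dT(2))
    then obtain s where s: "s \<noteq> 0" "int_mat (mat s ** T.rep (qp p0 p1 p2 p3))"
        "2 * fls_subdegree s + fls_subdegree (embed_at \<tau> (rf N)) = 0"
      using fT vx_eq_1_iff[of "T.rep (qp p0 p1 p2 p3)"] unfolding dT(1)[symmetric] by metis
    obtain u where u: "s = Xp (fls_subdegree s) * u" "u \<noteq> 0" "fls_subdegree u = 0" using Xp_decomp[OF s(1)] by blast
    have le: "fls_subdegree s \<le> - 1" using s(3) pos by linarith
    have van: "poly r \<tau> = 0" if r: "s * embed_at \<tau> (rf r) \<in> val_ring" for r
    proof -
      have "u * (Xp (fls_subdegree s) * embed_at \<tau> (rf r)) \<in> val_ring"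
        using r by (subst (asm) u(1)) (simp only: ac_simps)
      then have "Xp (fls_subdegree s) * embed_at \<tau> (rf r) \<in> val_ring"
        unfolding val_ring_unit_mult_iff(1)[OF u(2,3)] .
      then have "Xp (- 1) * embed_at \<tau> (rf r) \<in> val_ring" using le by (rule Xp_mult_in_val_ring)
      then show ?thesis using fls_nth_0_of_divisible embed_at_rf(2) by metis
    qed
    have "vanish \<tau> p0 p1 p2 p3"
      using s(2) unfolding qp_def T.int_mat_rep vanish_def by (simp add: van)
    then show False using p(3) by blast
  qed
  moreover have "\<not> [:- 0, 1:] ^ 2 dvd N" unfolding N_def
    by (rule Np_simple_root[of 0 "[:-1, 1:]"]) (simp_all add: Bp_def p(3))
  moreover have "\<not> [:- 1, 1:] ^ 2 dvd N" unfolding N_def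
    by (rule Np_simple_root[of 1 "[:0, 1:]"]) (simp_all add: Bp_def p(3))
  ultimately have deg: "degree N \<le> 2"
  proof -
    assume a: "poly N \<tau> \<noteq> 0" "\<not> [:- 0, 1:] ^ 2 dvd N" "\<not> [:- 1, 1:] ^ 2 dvd N"
    obtain M where M: "M dvd N" "poly M 0 \<noteq> 0" "degree N \<le> degree M + 1" "poly M \<tau> \<noteq> 0" "\<not> [:- 1, 1:] ^ 2 dvd M"
      using strip_simple_root[OF a(2) N] a(1,3) by blast
    have M0: "M \<noteq> 0" using M(2) by auto
    obtain L where L: "L dvd M" "poly L 1 \<noteq> 0" "degree M \<le> degree L + 1" "poly L \<tau> \<noteq> 0" "poly L 0 \<noteq> 0"
      using strip_simple_root[OF M(5) M0] M(2,4) by blast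
    have "L dvd Wp ^ k" using L(1) M(1) p(2) unfolding N_def by (blast intro: dvd_trans)
    then have "degree L = 0" using L by (intro dvd_Wp_power)
    then show ?thesis using M(3) L(3) by simp
  qed
  have "det (I.rep (qp p0 p1 p2 p3)) \<noteq> 0" unfolding dI(1) by (rule dI(2))
  then obtain s where s: "s \<noteq> 0" "int_mat (mat s ** I.rep (qp p0 p1 p2 p3))"
      "2 * fls_subdegree s + fls_subdegree (embed_infinity (rf N)) = 0"
    using fI vx_eq_1_iff[of "I.rep (qp p0 p1 p2 p3)"] unfolding dI(1)[symmetric] by metis
  \<comment> \<open>The valuation of \<open>s\<close> is half the degree of \<open>N\<close>. Since
    the embedding at t = infinity turns degrees into negative valuations, integrality after scaling
    by \<open>s\<close> bounds the degrees of the coordinates.\<close>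
  have s1: "fls_subdegree s \<le> 1" using s(3) deg subdegree_embed_infinity[OF N] by simp
  have d1: "degree r \<le> 1" if "s * embed_infinity (rf r) \<in> val_ring" for r
  proof (cases "r = 0")
    case False
    then show ?thesis using that s(1) s1 subdegree_embed_infinity[OF False] by (simp add: val_ring_iff)
  qed simp
  have d2: "degree r \<le> 1" if "s * (Xp (- 1) * embed_infinity (rf r)) \<in> val_ring" for r
  proof (cases "r = 0")
    case False
    then show ?thesis using that s(1) s1 subdegree_embed_infinity[OF False] by (simp add: val_ring_iff)
  qed simp
  show ?thesis
    using gp s(2) d1 d2 unfolding qp_def I.int_mat_rep by blast
qed

lemma finite_bounded_degree: "finite {p :: 'a poly. degree p \<le> 1}"
proof (rule finite_subset)
  show "{p :: 'a poly. degree p \<le> 1} \<subseteq> (\<lambda>(a, b). [:a, b:]) ` UNIV"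
  proof
    fix p :: "'a poly" assume "p \<in> {p. degree p \<le> 1}"
    then have "p = [:coeff p 0, coeff p 1:]"
      by (intro poly_eqI) (auto simp: coeff_pCons coeff_eq_0 split: nat.split)
    then show "p \<in> (\<lambda>(a, b). [:a, b:]) ` UNIV" by (metis (mono_tags, lifting) UNIV_I case_prod_conv image_eqI)
  qed
qed simp

theorem Gamma_arithmetic: "arithmetic_lattice c \<tau> (Gamma_set c \<tau>)"
  unfolding arithmetic_lattice_def commensurable_def
proof (intro conjI)
  show "subgroup (Gamma_set c \<tau>) (GK c)" by (rule Gamma_subgroup)
  have int: "Gamma_set c \<tau> \<inter> GR_set c \<tau> = Gamma_set c \<tau>" using Gamma_subset_GR by blast
  have rc: "rcosets\<^bsub>(GK c)\<lparr>carrier := H\<rparr>\<^esub> K = (\<lambda>g. K #>\<^bsub>GK c\<^esub> g) ` H" for H K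
    by (auto simp: RCOSETS_def r_coset_def)
  have sub: "Gamma_set c \<tau> \<subseteq> carrier (GK c)" using Gamma_subgroup by (rule subgroup.subset)
  have "rcosets\<^bsub>(GK c)\<lparr>carrier := Gamma_set c \<tau>\<rparr>\<^esub> (Gamma_set c \<tau> \<inter> GR_set c \<tau>) \<subseteq> {Gamma_set c \<tau>}"
    unfolding rc int using G.coset_join2[OF _ Gamma_subgroup] sub by blast
  then show "finite (rcosets\<^bsub>(GK c)\<lparr>carrier := Gamma_set c \<tau>\<rparr>\<^esub> (Gamma_set c \<tau> \<inter> GR_set c \<tau>))"
    by (rule finite_subset) simp
  define P1 where "P1 = {p :: 'a poly. degree p \<le> 1}"
  define Fin where "Fin = (\<lambda>(p0, p1, p2, p3). GK_class c (qp p0 p1 p2 p3)) ` (P1 \<times> P1 \<times> P1 \<times> P1)"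
  have "finite Fin" unfolding Fin_def P1_def by (intro finite_imageI finite_cartesian_product finite_bounded_degree)
  moreover have "rcosets\<^bsub>(GK c)\<lparr>carrier := GR_set c \<tau>\<rparr>\<^esub> (Gamma_set c \<tau> \<inter> GR_set c \<tau>) \<subseteq>
      (\<lambda>g. Gamma_set c \<tau> #>\<^bsub>GK c\<^esub> g) ` Fin"
    unfolding rc int
  proof (rule image_subsetI)
    fix g assume g: "g \<in> GR_set c \<tau>"
    then obtain x where x: "x \<in> Units Ord" "g = GK_class c x" unfolding GR_set_def by blast
    have nx: "nrdD x \<noteq> 0" using x(1) by (rule nrd_Units_Ord)
    \<comment> \<open>By transitivity some \<open>y\<close> in the group moves the base vertex as
      \<open>x\<close> does. Then \<open>z\<close>, the inverse of \<open>y\<close> times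
      \<open>x\<close> up to a scalar, lies in the same coset and in the finite stabiliser.\<close>
    obtain y where y: "nrdD y \<noteq> 0" "GK_class c y \<in> Gamma_set c \<tau>"
        "vx (T.rep y) = vx (T.rep x)" "vx (I.rep y) = vx (I.rep x)"
      using Gamma_transitive[of "vx (T.rep x)" "vx (I.rep x)"] nx by (auto simp: T.det_rep I.det_rep)
    define z where "z = mulD (quat_conj y) x"
    have dy: "det (T.rep (quat_conj y)) \<noteq> 0" "det (I.rep (quat_conj y)) \<noteq> 0"
      using y(1) by (simp_all add: T.det_rep I.det_rep)
    have one: "GK_class c (mulD (quat_conj y) y) = GK_class c (quat_scalar 1)"
      unfolding quat_mult_conj GK_eq_iff using y(1) by (intro exI[of _ "nrdD y"]) simp
    have "vx (T.rep z) = vx (T.rep (mulD (quat_conj y) y))"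
      unfolding z_def T.rep_mult vx_mult_eq_iff[OF dy(1)] by (rule y(3)[symmetric])
    then have zT: "vx (T.rep z) = vx (mat 1)"
      unfolding vx_rep_class(1)[OF one] T.rep_scalar T.emb_1 .
    have "vx (I.rep z) = vx (I.rep (mulD (quat_conj y) y))"
      unfolding z_def I.rep_mult vx_mult_eq_iff[OF dy(2)] by (rule y(4)[symmetric])
    then have zI: "vx (I.rep z) = vx (mat 1)"
      unfolding vx_rep_class(2)[OF one] I.rep_scalar I.emb_1 .
    have inv: "inv\<^bsub>GK c\<^esub> (GK_class c y) = GK_class c (quat_conj y)"
      using inv_PGL1[OF y(1)] unfolding GK_def GK_class_def .
    have iG: "GK_class c (quat_conj y) \<in> Gamma_set c \<tau>"
      using subgroup.m_inv_closed[OF Gamma_subgroup y(2)] unfolding inv .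
    have zg: "GK_class c z = GK_class c (quat_conj y) \<otimes>\<^bsub>GK c\<^esub> g"
      unfolding x(2) z_def using nx y(1) by (simp add: GK_mult)
    then have "GK_class c z \<in> GR_set c \<tau>"
      using subgroup.m_closed[OF GR_subgroup _ g] iG Gamma_subset_GR by (metis subsetD)
    then have "GK_class c z \<in> Fin"
      using stabilizer_bounded[OF _ HOL.refl zT zI] unfolding Fin_def P1_def by force
    moreover have "Gamma_set c \<tau> #>\<^bsub>GK c\<^esub> g = Gamma_set c \<tau> #>\<^bsub>GK c\<^esub> GK_class c z"
    proof -
      have gc: "g \<in> carrier (GK c)" unfolding x(2) using nx by (rule GK_closed)
      have "Gamma_set c \<tau> #>\<^bsub>GK c\<^esub> GK_class c z = (Gamma_set c \<tau> #>\<^bsub>GK c\<^esub> GK_class c (quat_conj y)) #>\<^bsub>GK c\<^esub> g"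
        unfolding zg using G.coset_mult_assoc[OF sub _ gc] iG sub by (metis subsetD)
      also have "Gamma_set c \<tau> #>\<^bsub>GK c\<^esub> GK_class c (quat_conj y) = Gamma_set c \<tau>"
        using G.coset_join2[OF _ Gamma_subgroup iG] iG sub by blast
      finally show ?thesis by (rule HOL.sym)
    qed
    ultimately show "Gamma_set c \<tau> #>\<^bsub>GK c\<^esub> g \<in> (\<lambda>g. Gamma_set c \<tau> #>\<^bsub>GK c\<^esub> g) ` Fin" by (rule image_eqI[rotated])
  qed
  ultimately show "finite (rcosets\<^bsub>(GK c)\<lparr>carrier := GR_set c \<tau>\<rparr>\<^esub> (Gamma_set c \<tau> \<inter> GR_set c \<tau>))"
    using finite_subset by blast
qed

end


section \<open>The action for arbitrary splittings\<close>

lemma group_actionI: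
  assumes G: "group G"
    and ext: "\<And>g. g \<in> carrier G \<Longrightarrow> \<phi> g \<in> extensional E"
    and closed: "\<And>g x. g \<in> carrier G \<Longrightarrow> x \<in> E \<Longrightarrow> \<phi> g x \<in> E"
    and one: "\<And>x. x \<in> E \<Longrightarrow> \<phi> \<one>\<^bsub>G\<^esub> x = x"
    and mult: "\<And>g h x. g \<in> carrier G \<Longrightarrow> h \<in> carrier G \<Longrightarrow> x \<in> E \<Longrightarrow> \<phi> (g \<otimes>\<^bsub>G\<^esub> h) x = \<phi> g (\<phi> h x)"
  shows "group_action G E \<phi>"
proof -
  interpret group G by (rule G)
  have Bij: "\<phi> g \<in> Bij E" if g: "g \<in> carrier G" for g
  proof -
    have ig: "inv\<^bsub>G\<^esub> g \<in> carrier G" using g by simp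
    have "\<phi> (inv\<^bsub>G\<^esub> g) (\<phi> g x) = x" "\<phi> g (\<phi> (inv\<^bsub>G\<^esub> g) x) = x" if x: "x \<in> E" for x
      using mult[OF ig g x, symmetric] mult[OF g ig x, symmetric] g one[OF x] by simp_all
    then have "bij_betw (\<phi> g) E E"
      by (intro bij_betw_byWitness[of _ "\<phi> (inv\<^bsub>G\<^esub> g)"]) (auto intro: closed g ig)
    then show ?thesis using ext[OF g] by (simp add: Bij_def)
  qed
  have "\<phi> \<in> hom G (BijGroup E)"
  proof (rule homI)
    fix g h assume gh: "g \<in> carrier G" "h \<in> carrier G"
    show "\<phi> g \<in> carrier (BijGroup E)" using Bij[OF gh(1)] by (simp add: BijGroup_def)
    have "\<phi> (g \<otimes>\<^bsub>G\<^esub> h) = compose E (\<phi> g) (\<phi> h)"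
    proof (rule extensionalityI[of _ E])
      show "\<phi> (g \<otimes>\<^bsub>G\<^esub> h) \<in> extensional E" using gh by (intro ext) simp
    qed (simp_all add: compose_def mult[OF gh])
    then show "\<phi> (g \<otimes>\<^bsub>G\<^esub> h) = \<phi> g \<otimes>\<^bsub>BijGroup E\<^esub> \<phi> h"
      using Bij gh by (simp add: BijGroup_def)
  qed
  then show ?thesis
    unfolding group_action_def group_hom_def group_hom_axioms_def using G group_BijGroup by blast
qed

context place
begin

text \<open>Composing \<phi> with the inverse of the explicit splitting gives an automorphism of the
  matrix algebra that fixes scalars, hence conjugation by some \<open>G\<close>. The vertex
  \<open>vx G\<close> takes over the role of the standard one for \<phi>.\<close>

lemma splitting_conjugate:
  assumes \<phi>: "D_splitting c emb \<phi>"
  obtains G where "det G \<noteq> 0" "\<And>x. \<phi> (map_quat emb x) ** G = G ** rep x"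
proof -
  define \<phi>0 where "\<phi>0 = split_mat (fls_const c) (Xp (- k) * w0) (Xp (- k) * w1)"
  have s: "is_splitting (emb (ratfun_const c)) (emb D_b) \<phi>" using \<phi> by (simp add: D_splitting_def)
  have s0: "is_splitting (emb (ratfun_const c)) (emb D_b) \<phi>0" unfolding \<phi>0_def by (rule is_splitting_rep)
  have bij0: "bij \<phi>0" using s0 by (simp add: is_splitting_def)
  define inv0 where "inv0 = inv_into UNIV \<phi>0"
  have i1: "\<phi>0 (inv0 A) = A" for A unfolding inv0_def using bij0 by (simp add: bij_is_surj surj_f_inv_f)
  have i2: "inv0 (\<phi>0 x) = x" for x unfolding inv0_def using bij0 by (simp add: bij_is_inj inv_f_f)
  have ia: "inv0 (A + B) = quat_add (inv0 A) (inv0 B)" for A B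
    using s0 i1[of A] i1[of B] i2[of "quat_add (inv0 A) (inv0 B)"] by (simp add: is_splitting_def)
  have im: "inv0 (A ** B) = quat_mult (emb (ratfun_const c)) (emb D_b) (inv0 A) (inv0 B)" for A B
    using s0 i1[of A] i1[of B] i2[of "quat_mult (emb (ratfun_const c)) (emb D_b) (inv0 A) (inv0 B)"]
    by (simp add: is_splitting_def)
  have iscal: "inv0 (mat r) = quat_scalar r" for r
    using s0 i2[of "quat_scalar r"] by (simp add: is_splitting_def)
  obtain G where G: "det G \<noteq> 0" "\<And>A. \<phi> (inv0 A) ** G = G ** A"
  proof (rule matrix_automorphism_inner[of "\<lambda>A. \<phi> (inv0 A)"])
    show "\<phi> (inv0 (x + y)) = \<phi> (inv0 x) + \<phi> (inv0 y)" for x y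
      using s unfolding ia is_splitting_def by simp
    show "\<phi> (inv0 (x ** y)) = \<phi> (inv0 x) ** \<phi> (inv0 y)" for x y
      using s unfolding im is_splitting_def by simp
    show "\<phi> (inv0 (mat r)) = mat r" for r
      using s unfolding iscal is_splitting_def by simp
  qed blast
  have "\<phi> (map_quat emb x) ** G = G ** rep x" for x
    using G(2)[of "\<phi>0 (map_quat emb x)"] unfolding i2 unfolding \<phi>0_def rep_def .
  then show thesis using G(1) that by blast
qed

lemma splitting_act:
  assumes \<phi>: "D_splitting c emb \<phi>"
  shows "bt_act (\<phi> \<circ> map_quat emb) (GK_class c x) (vx B) = vx (\<phi> (map_quat emb x) ** B)"
proof -
  have s: "is_splitting (emb (ratfun_const c)) (emb D_b) \<phi>" using \<phi> by (simp add: D_splitting_def)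
  have "\<phi> (map_quat emb (quat_smult r x)) = mat (emb r) ** \<phi> (map_quat emb x)" for r
  proof -
    have "\<phi> (quat_mult (emb (ratfun_const c)) (emb D_b) (quat_scalar (emb r)) (map_quat emb x)) =
        mat (emb r) ** \<phi> (map_quat emb x)"
      using s unfolding is_splitting_def by (simp del: quat_mult_scalar)
    then show ?thesis by (simp add: map_quat_smult)
  qed
  then have "\<exists>t. t \<noteq> 0 \<and> (\<phi> \<circ> map_quat emb) (quat_smult r x) = mat t ** (\<phi> \<circ> map_quat emb) x"
    if "r \<noteq> 0" for r
    using that by (intro exI[of _ "emb r"]) simp
  from bt_act_vx[of "\<phi> \<circ> map_quat emb" x, OF this] show ?thesis unfolding GK_class_def by simp
qed

lemma splitting_mult:
  assumes "D_splitting c emb \<phi>"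
  shows "\<phi> (map_quat emb (quat_mult (ratfun_const c) D_b x y)) = \<phi> (map_quat emb x) ** \<phi> (map_quat emb y)"
proof -
  have "map_quat emb (quat_mult (ratfun_const c) D_b x y) =
      quat_mult (emb (ratfun_const c)) (emb D_b) (map_quat emb x) (map_quat emb y)"
    by (cases x; cases y) (simp add: emb_simps)
  then show ?thesis using assms by (simp add: D_splitting_def is_splitting_def)
qed

lemma splitting_one:
  assumes "D_splitting c emb \<phi>"
  shows "\<phi> (map_quat emb (quat_scalar 1)) = mat 1"
proof -
  have "map_quat emb (quat_scalar 1) = quat_scalar 1" by (simp add: quat_scalar_def emb_1)
  then show ?thesis using assms by (simp add: D_splitting_def is_splitting_def)
qed

lemma splitting_det:
  assumes "D_splitting c emb \<phi>" "nrd (ratfun_const c) D_b x \<noteq> 0"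
  shows "det (\<phi> (map_quat emb x)) \<noteq> 0"
proof -
  obtain G where G: "det G \<noteq> 0" "\<And>x. \<phi> (map_quat emb x) ** G = G ** rep x"
    using splitting_conjugate[OF assms(1)] by blast
  have "det (\<phi> (map_quat emb x)) * det G = det G * det (rep x)"
    unfolding det_mul[symmetric] G(2) ..
  then show ?thesis using G(1) assms(2) by (auto simp: det_rep)
qed

end

context quat_lattice
begin

text \<open>The base point is \<open>(vx A, vx H)\<close> for the conjugating matrices of the two
  splittings. Left multiplication by \<open>A\<close> and \<open>H\<close> then carries over the
  results for \<open>T.rep\<close> and \<open>I.rep\<close>.\<close>

theorem simply_transitive:
  assumes \<phi>: "D_splitting c (embed_at \<tau>) \<phi>" and \<psi>: "D_splitting c embed_infinity \<psi>"
  shows "simply_transitive_action (Gamma c \<tau>) (bt_vertices \<times> bt_vertices) (Gamma_act \<tau> \<phi> \<psi>)"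
proof -
  define R where "R = (\<lambda>x. \<phi> (map_quat (embed_at \<tau>) x))"
  define Q where "Q = (\<lambda>x. \<psi> (map_quat embed_infinity x))"
  have act: "Gamma_act \<tau> \<phi> \<psi> (GK_class c x) (vx B, vx C) = (vx (R x ** B), vx (Q x ** C))"
    if "det B \<noteq> 0" "det C \<noteq> 0" for x B C
    unfolding Gamma_act_def bt_product_act_def R_def Q_def
    using that by (simp add: T.splitting_act[OF \<phi>] I.splitting_act[OF \<psi>])
  have det: "det (R x) \<noteq> 0" "det (Q x) \<noteq> 0" if "nrdD x \<noteq> 0" for x
    unfolding R_def Q_def using T.splitting_det[OF \<phi> that] I.splitting_det[OF \<psi> that] by simp_all
  have mult: "R (mulD x y) = R x ** R y" "Q (mulD x y) = Q x ** Q y" for x y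
    unfolding R_def Q_def by (rule T.splitting_mult[OF \<phi>], rule I.splitting_mult[OF \<psi>])
  obtain A where A: "det A \<noteq> 0" "\<And>x. R x ** A = A ** T.rep x"
    unfolding R_def using T.splitting_conjugate[OF \<phi>] by blast
  obtain H where H: "det H \<noteq> 0" "\<And>x. Q x ** H = H ** I.rep x"
    unfolding Q_def using I.splitting_conjugate[OF \<psi>] by blast
  have E: "\<exists>B C. det B \<noteq> 0 \<and> det C \<noteq> 0 \<and> e = (vx B, vx C)" if "e \<in> bt_vertices \<times> bt_vertices" for e
    using that by (auto simp: bt_vertices_eq)
  have Gam: "\<exists>x. nrdD x \<noteq> 0 \<and> g = GK_class c x" if "g \<in> carrier (Gamma c \<tau>)" for g
  proof -
    have "g \<in> carrier (GK c)" using that subgroup.subset[OF Gamma_subgroup] by (auto simp: Gamma_def)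
    then show ?thesis unfolding GK_def GK_class_def carrier_PGL1 by blast
  qed
  have Gone: "\<one>\<^bsub>Gamma c \<tau>\<^esub> = GK_class c (quat_scalar 1)" by (simp add: Gamma_def GK_one)
  have ga: "group_action (Gamma c \<tau>) (bt_vertices \<times> bt_vertices) (Gamma_act \<tau> \<phi> \<psi>)"
  proof (rule group_actionI)
    show "group (Gamma c \<tau>)" unfolding Gamma_def by (rule G.subgroup_imp_group[OF Gamma_subgroup])
    fix g assume "g \<in> carrier (Gamma c \<tau>)"
    then obtain x where x: "nrdD x \<noteq> 0" "g = GK_class c x" using Gam by blast
    show "Gamma_act \<tau> \<phi> \<psi> g \<in> extensional (bt_vertices \<times> bt_vertices)"
      by (simp add: Gamma_act_def bt_product_act_def)
    fix e :: "('a fls ^ 2) set set \<times> ('a fls ^ 2) set set"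
    assume "e \<in> bt_vertices \<times> bt_vertices"
    then obtain B C where e: "det B \<noteq> 0" "det C \<noteq> 0" "e = (vx B, vx C)" using E by blast
    show "Gamma_act \<tau> \<phi> \<psi> g e \<in> bt_vertices \<times> bt_vertices"
      unfolding x(2) e(3) act[OF e(1,2)] using det[OF x(1)] e(1,2) by (simp add: det_mul)
    fix h assume "h \<in> carrier (Gamma c \<tau>)"
    then obtain y where y: "nrdD y \<noteq> 0" "h = GK_class c y" using Gam by blast
    have "g \<otimes>\<^bsub>Gamma c \<tau>\<^esub> h = GK_class c (mulD x y)"
      by (simp add: Gamma_def x(2) y(2) GK_mult x(1) y(1))
    then have "Gamma_act \<tau> \<phi> \<psi> (g \<otimes>\<^bsub>Gamma c \<tau>\<^esub> h) e = (vx (R x ** (R y ** B)), vx (Q x ** (Q y ** C)))"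
      unfolding e(3) by (simp only: act[OF e(1,2)] mult matrix_mul_assoc)
    moreover have d: "det (R y ** B) \<noteq> 0" "det (Q y ** C) \<noteq> 0"
      using det[OF y(1)] e(1,2) by (simp_all add: det_mul)
    ultimately show "Gamma_act \<tau> \<phi> \<psi> (g \<otimes>\<^bsub>Gamma c \<tau>\<^esub> h) e = Gamma_act \<tau> \<phi> \<psi> g (Gamma_act \<tau> \<phi> \<psi> h e)"
      unfolding x(2) y(2) e(3) act[OF e(1,2)] act[OF d] by simp
  next
    fix e :: "('a fls ^ 2) set set \<times> ('a fls ^ 2) set set"
    assume "e \<in> bt_vertices \<times> bt_vertices"
    then obtain B C where e: "det B \<noteq> 0" "det C \<noteq> 0" "e = (vx B, vx C)" using E by blast
    have "R (quat_scalar 1) = mat 1" "Q (quat_scalar 1) = mat 1"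
      unfolding R_def Q_def by (rule T.splitting_one[OF \<phi>], rule I.splitting_one[OF \<psi>])
    then show "Gamma_act \<tau> \<phi> \<psi> \<one>\<^bsub>Gamma c \<tau>\<^esub> e = e"
      unfolding Gone e(3) act[OF e(1,2)] by simp
  qed
  have base: "Gamma_act \<tau> \<phi> \<psi> (GK_class c x) (vx A, vx H) = (vx (A ** T.rep x), vx (H ** I.rep x))" for x
    unfolding act[OF A(1) H(1)] A(2) H(2) ..
  show ?thesis
  proof (rule simply_transitive_actionI[OF ga])
    show "(vx A, vx H) \<in> bt_vertices \<times> bt_vertices" using A(1) H(1) by simp
  next
    fix e :: "('a fls ^ 2) set set \<times> ('a fls ^ 2) set set"
    assume "e \<in> bt_vertices \<times> bt_vertices"
    then obtain B C where e: "det B \<noteq> 0" "det C \<noteq> 0" "e = (vx B, vx C)" using E by blast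
    obtain B' where B': "B = A ** B'" using matrix_eq_mult[OF A(1)] by blast
    obtain C' where C': "C = H ** C'" using matrix_eq_mult[OF H(1)] by blast
    have "det B' \<noteq> 0" "det C' \<noteq> 0" using e(1,2) by (auto simp: B' C' det_mul)
    then have "vx B' \<in> bt_vertices" "vx C' \<in> bt_vertices" by (simp_all add: vx_in)
    from Gamma_transitive[OF this] obtain x where x: "GK_class c x \<in> Gamma_set c \<tau>"
      "vx (T.rep x) = vx B'" "vx (I.rep x) = vx C'" by (elim exE conjE)
    have "vx (A ** T.rep x) = vx (A ** B')" unfolding vx_mult_eq_iff[OF A(1)] by (rule x(2))
    moreover have "vx (H ** I.rep x) = vx (H ** C')" unfolding vx_mult_eq_iff[OF H(1)] by (rule x(3))
    ultimately have "Gamma_act \<tau> \<phi> \<psi> (GK_class c x) (vx A, vx H) = e"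
      unfolding base e(3) B' C' by (simp only:)
    then show "\<exists>g\<in>carrier (Gamma c \<tau>). Gamma_act \<tau> \<phi> \<psi> g (vx A, vx H) = e"
      using x(1) by (intro bexI[of _ "GK_class c x"]) (simp_all add: Gamma_def)
  next
    fix g assume g: "g \<in> carrier (Gamma c \<tau>)" "Gamma_act \<tau> \<phi> \<psi> g (vx A, vx H) = (vx A, vx H)"
    then obtain x where x: "nrdD x \<noteq> 0" "g = GK_class c x" using Gam by blast
    have "vx (A ** T.rep x) = vx (A ** mat 1)" "vx (H ** I.rep x) = vx (H ** mat 1)"
      using g(2) unfolding x(2) base by simp_all
    then have "vx (T.rep x) = vx (mat 1)" "vx (I.rep x) = vx (mat 1)"
      unfolding vx_mult_eq_iff[OF A(1)] vx_mult_eq_iff[OF H(1)] .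
    moreover have "GK_class c x \<in> Gamma_set c \<tau>" using g(1) by (simp add: x(2) Gamma_def)
    ultimately have "GK_class c x = \<one>\<^bsub>GK c\<^esub>" by (intro Gamma_stabilizer)
    then show "g = \<one>\<^bsub>Gamma c \<tau>\<^esub>" by (simp add: x(2) Gamma_def)
  qed
qed

end

text \<open>The action depends on the chosen splittings, so the last clause treats all of them; the
  existence clauses ensure that it is not vacuous. The clause on \<open>bt_vertices\<close>
  identifies both factors with the tree of valency q + 1.\<close>

theorem theorem28:
  fixes c \<tau> :: "'a::{field,finite}" and p m :: nat
  assumes "prime p" "odd p" "CARD('a) = p ^ m"
    and "\<tau> \<noteq> 0" "\<tau> \<noteq> 1"
    and "c \<noteq> 0" "\<nexists>x. x ^ 2 = c"
  shows "arithmetic_lattice c \<tau> (Gamma_set c \<tau>)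
    \<and> torsion_free (Gamma c \<tau>)
    \<and> has_finite_presentation (Gamma c \<tau>) (pres_gens c \<tau>) (pres_rels c \<tau>) (gen_value c)
    \<and> regular_tree (CARD('a) + 1) (bt_vertices :: ('a fls ^ 2) set set set) bt_adjacent
    \<and> (\<exists>\<phi>. D_splitting c (embed_at \<tau>) \<phi>) \<and> (\<exists>\<psi>. D_splitting c embed_infinity \<psi>)
    \<and> (\<forall>\<phi> \<psi>. D_splitting c (embed_at \<tau>) \<phi> \<and> D_splitting c embed_infinity \<psi> \<longrightarrow>
          simply_transitive_action (Gamma c \<tau>) (bt_vertices \<times> bt_vertices) (Gamma_act \<tau> \<phi> \<psi>))"
proof -
  obtain w0 w1 where T: "place c (embed_at \<tau>) 0 w0 w1" using place_tau assms(4,5,7) by blast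
  obtain v0 v1 where I: "place c embed_infinity 1 v0 v1" using place_infinity assms(7) by blast
  interpret quat_lattice c \<tau> w0 w1 v0 v1 p m
    using T I assms(1,3,4,5) by (simp add: quat_lattice_def quat_lattice_axioms_def)
  have "\<exists>\<phi>. D_splitting c (embed_at \<tau>) \<phi>" "\<exists>\<psi>. D_splitting c embed_infinity \<psi>"
    unfolding D_splitting_def using T.is_splitting_rep I.is_splitting_rep by blast+
  then show ?thesis
    using Gamma_arithmetic Gamma_torsion_free presentation bt_regular_tree simply_transitive by blast
qed

end
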